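(* Let $P$ be a fractal distribution on $\mathcal{M}^{*}$, and let $P=\int P_{\mu}\,dP(\mu)$ be its ergodic decomposition with respect to the action $S^{*}=(S^*_t)_{t\in\mathbb{R}}$. Then for $P$-a.e. $\mu$ the ergodic component $P_{\mu}$ is an ergodic fractal distribution; that is, the $S^*$-ergodic components of a fractal distribution are themselves quasi-Palm.
   Context: Fix $d\ge 1$. $\mathbb{R}^d$ carries the sup-norm; $B_r(x)$ is the closed ball, $B_r=B_r(0)$, so $B_1=[-1,1]^d$. $\mathcal{M}$ is the space of Radon measures on $\mathbb{R}^d$ with the weak topology (tested against continuous compactly supported functions). "Distribution" means a Borel probability measure on a space of measures. For $\mu\in\mathcal{M}$ with $\mu(B_1)>0$ put $\mu^*=\frac{1}{\mu(B_1)}\mu$, and $\mathcal{M}^*=\{\mu\in\mathcal{M}:\mu(B_1)=1\}$. Let $T_x(y)=y-x$ and $S_t(y)=e^t y$ on $\mathbb{R}^d$, acting on measures by push-forward; $T_x^*\mu=(T_x\mu)^*$, $S_t^*\mu=(S_t\mu)^*$. $S^*=(S^*_t)_{t\in\mathbb{R}}$ is an additive $\mathbb{R}$-action on $\{\mu\in\mathcal{M}^*:0\in\operatorname{supp}\mu\}$; an $S^*$-invariant distribution is understood to be concentrated on this set. For $U\subseteq\mathbb{R}^d$, $\langle\mu\rangle_U^*=\int_U\delta_{T_x^*\mu}\,d\mu(x)$. A distribution $P$ on $\mathcal{M}^*$ is quasi-Palm if for every bounded open neighborhood $U$ of $0$, $P\sim\int\langle\mu\rangle^*_U\,dP(\mu)$,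 where $\sim$ means having the same null sets. A fractal distribution (FD) is a probability distribution on $\mathcal{M}^*$ that is $S^*$-invariant and quasi-Palm; an ergodic fractal distribution (EFD) is an FD that is ergodic for $S^*$. *)

theory Defs
  imports "HOL-Probability.Probability"
begin

text \<open>
  The space \<open>R\<^sup>d\<close> is \<open>real ^ 'n\<close> with \<open>d = CARD('n)\<close>, so that \<open>d \<ge> 1\<close>; its sup-norm is \<open>infnorm\<close>.
\<close>

definition sup_ball :: "real \<Rightarrow> real ^ 'n \<Rightarrow> (real ^ 'n) set" where
  "sup_ball r x = {y. infnorm (y - x) \<le> r}"

text \<open>On \<open>R\<^sup>d\<close> every locally finite Borel measure is regular, so these are the Radon measures.\<close>

definition radon_measures :: "(real ^ 'n) measure set" where
  "radon_measures = {\<mu>. sets \<mu> = sets borel \<and> (\<forall>K. compact K \<longrightarrow> emeasure \<mu> K < \<infinity>)}"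

definition test_functions :: "(real ^ 'n \<Rightarrow> real) set" where
  "test_functions = {f. continuous_on UNIV f \<and> compact (closure {x. f x \<noteq> 0})}"

definition radon_topology :: "(real ^ 'n) measure topology" where
  "radon_topology = topology_generated_by
     {{\<mu> \<in> radon_measures. (LINT x|\<mu>. f x) \<in> V} |f V. f \<in> test_functions \<and> open V}"

lemma topspace_radon_topology [simp]:
  "topspace (radon_topology :: (real ^ 'n) measure topology) = radon_measures"
proof -
  have "(\<lambda>x::real^'n. 0) \<in> test_functions"
    by (simp add: test_functions_def)
  then have "radon_measures \<in>
      {{\<mu> \<in> radon_measures. (LINT x|\<mu>. f x) \<in> V} |f V. f \<in> (test_functions::(real^'n \<Rightarrow> real) set) \<and> open V}"
    by blast
  then show ?thesis
    unfolding radon_topology_def topology_generated_by_topspace by blast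
qed

definition borel_algebra :: "'a topology \<Rightarrow> 'a measure" where
  "borel_algebra X = sigma (topspace X) {U. openin X U}"

definition normalized_measures :: "(real ^ 'n) measure set" where
  "normalized_measures = {\<mu> \<in> radon_measures. emeasure \<mu> (sup_ball 1 0) = 1}"

definition normalized_space :: "(real ^ 'n) measure measure" where
  "normalized_space = borel_algebra (subtopology radon_topology normalized_measures)"

lemma space_normalized_space [simp]: "space normalized_space = normalized_measures"
proof -
  have *: "topspace (subtopology radon_topology normalized_measures)
      = (normalized_measures :: (real ^ 'n) measure set)"
    by (auto simp: normalized_measures_def)
  show ?thesis
    unfolding normalized_space_def borel_algebra_def
    by (subst space_measure_of) (use * openin_subset in blast)+
qed

definition distribution :: "(real ^ 'n) measure measure \<Rightarrow> bool" where
  "distribution P \<longleftrightarrow> prob_space P \<and> sets P = sets normalized_space"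

text \<open>Only meaningful for \<open>\<mu>\<close> with positive mass on the unit ball; all uses below respect this.\<close>

definition star :: "(real ^ 'n) measure \<Rightarrow> (real ^ 'n) measure" where
  "star \<mu> = scale_measure (inverse (emeasure \<mu> (sup_ball 1 0))) \<mu>"

definition translate_star :: "real ^ 'n \<Rightarrow> (real ^ 'n) measure \<Rightarrow> (real ^ 'n) measure" where
  "translate_star x \<mu> = star (distr \<mu> borel (\<lambda>y. y - x))"

definition scale_star :: "real \<Rightarrow> (real ^ 'n) measure \<Rightarrow> (real ^ 'n) measure" where
  "scale_star t \<mu> = star (distr \<mu> borel (\<lambda>y. exp t *\<^sub>R y))"

definition supp :: "(real ^ 'n) measure \<Rightarrow> (real ^ 'n) set" where
  "supp \<mu> = {x. \<forall>U. open U \<longrightarrow> x \<in> U \<longrightarrow> 0 < emeasure \<mu> U}"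

text \<open>The phase space of the flow \<open>S\<^sup>*\<close>.\<close>

definition flow_domain :: "(real ^ 'n) measure set" where
  "flow_domain = {\<mu> \<in> normalized_measures. 0 \<in> supp \<mu>}"

definition scale_invariant :: "(real ^ 'n) measure measure \<Rightarrow> bool" where
  "scale_invariant P \<longleftrightarrow>
     (AE \<mu> in P. \<mu> \<in> flow_domain) \<and>
     (\<forall>t. \<forall>A\<in>sets P. emeasure P {\<mu> \<in> flow_domain. scale_star t \<mu> \<in> A} = emeasure P A)"

text \<open>
  The sigma-algebra of invariant Borel sets. Invariance constrains a set only on the domain of the
  flow, whose complement is null for every invariant distribution.
\<close>

definition invariant_algebra :: "(real ^ 'n) measure measure" where
  "invariant_algebra = sigma normalized_measures
     {A \<in> sets normalized_space.
        \<forall>t. {\<mu> \<in> flow_domain. scale_star t \<mu> \<in> A} = A \<inter> flow_domain}"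

lemma subalgebra_invariant_algebra: "subalgebra normalized_space invariant_algebra"
proof -
  let ?G = "{A \<in> sets (normalized_space :: (real ^ 'n) measure measure).
        \<forall>t. {\<mu> \<in> flow_domain. scale_star t \<mu> \<in> A} = A \<inter> flow_domain}"
  have sub: "?G \<subseteq> Pow normalized_measures"
    using sets.sets_into_space[of _ "normalized_space :: (real ^ 'n) measure measure"] by auto
  have "sigma_sets normalized_measures ?G \<subseteq> sets normalized_space"
    using sets.sigma_sets_subset[of ?G "normalized_space :: (real ^ 'n) measure measure"] by auto
  then show ?thesis
    unfolding subalgebra_def invariant_algebra_def sets_measure_of[OF sub] space_measure_of[OF sub]
    by simp
qed

definition ergodic :: "(real ^ 'n) measure measure \<Rightarrow> bool" where
  "ergodic P \<longleftrightarrow> scale_invariant P \<and>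
     (\<forall>A\<in>sets invariant_algebra. emeasure P A = 0 \<or> emeasure P A = 1)"

text \<open>
  The measure \<open>\<langle>\<mu>\<rangle>\<^sup>*\<close> on \<open>U\<close> is the image of \<open>\<mu>\<close> restricted to \<open>U\<close> under \<open>x \<mapsto> T\<^sub>x\<^sup>*\<mu>\<close>.
  The points where this map is undefined, i.e. where \<open>\<mu>\<close> gives no mass to the unit ball around \<open>x\<close>,
  form a \<open>\<mu>\<close>-null set and are left out.
\<close>

definition local_translates ::
    "(real ^ 'n) set \<Rightarrow> (real ^ 'n) measure \<Rightarrow> (real ^ 'n) measure measure" where
  "local_translates U \<mu> =
     distr (restrict_space \<mu> {x \<in> U. 0 < emeasure \<mu> (sup_ball 1 x)})
       normalized_space (\<lambda>x. translate_star x \<mu>)"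

definition averaged_translates ::
    "(real ^ 'n) set \<Rightarrow> (real ^ 'n) measure measure \<Rightarrow> (real ^ 'n) measure measure" where
  "averaged_translates U P = measure_of (space normalized_space) (sets normalized_space)
     (\<lambda>A. \<integral>\<^sup>+ \<mu>. emeasure (local_translates U \<mu>) A \<partial>P)"

definition quasi_palm :: "(real ^ 'n) measure measure \<Rightarrow> bool" where
  "quasi_palm P \<longleftrightarrow>
     (\<forall>U. open U \<and> bounded U \<and> 0 \<in> U \<longrightarrow> null_sets P = null_sets (averaged_translates U P))"

definition fractal_distribution :: "(real ^ 'n) measure measure \<Rightarrow> bool" where
  "fractal_distribution P \<longleftrightarrow> distribution P \<and> scale_invariant P \<and> quasi_palm P"

definition ergodic_fractal_distribution :: "(real ^ 'n) measure measure \<Rightarrow> bool" where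
  "ergodic_fractal_distribution P \<longleftrightarrow> fractal_distribution P \<and> ergodic P"

text \<open>
  \<open>Q\<close> is an ergodic decomposition of \<open>P\<close>: a measurable family of distributions with barycentre \<open>P\<close>,
  almost all of them invariant and ergodic, where \<open>Q \<mu>\<close> is the conditional distribution of \<open>P\<close> given the
  sigma-algebra of invariant sets at \<open>\<mu>\<close>. The last clause is what makes \<open>Q \<mu>\<close> the component
  of \<open>\<mu>\<close>, and determines \<open>Q\<close> up to a \<open>P\<close>-null set.
\<close>

definition ergodic_decomposition ::
    "(real ^ 'n) measure measure \<Rightarrow> ((real ^ 'n) measure \<Rightarrow> (real ^ 'n) measure measure) \<Rightarrow> bool" where
  "ergodic_decomposition P Q \<longleftrightarrow>
     Q \<in> P \<rightarrow>\<^sub>M prob_algebra normalized_space \<and>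
     P = P \<bind> Q \<and>
     (AE \<mu> in P. ergodic (Q \<mu>)) \<and>
     (\<forall>A\<in>sets normalized_space.
        AE \<mu> in P. measure (Q \<mu>) A = real_cond_exp P invariant_algebra (indicator A) \<mu>)"

end

theory Submission
  imports Defs
begin

text \<open>
  The heart of the matter is that \<open>\<mu>\<close> and \<open>T\<^sub>x\<^sup>*\<mu>\<close> lie in the same ergodic component for almost every
  \<open>\<mu>\<close> and \<open>\<mu>\<close>-almost every \<open>x\<close>. This is a Hopf argument at time \<open>-\<infinity>\<close>: contraction by \<open>exp (- n)\<close> turns the
  translation by \<open>x\<close> into a translation by \<open>exp (- n) x\<close>, so every Borel set is asymptotically unable
  to tell the two contracted measures apart. For the generating sets \<open>{\<mu>. 0 < \<integral> f d\<mu>}\<close> with \<open>f\<close> Lipschitz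
  this is continuity; it passes to all Borel sets because the laws of both measures are absolutely
  continuous with respect to \<open>P\<close> uniformly in \<open>n\<close>, by \<open>S\<^sup>*\<close>-invariance and the quasi-Palm property. For an
  invariant set it therefore holds exactly, without a limit.

  Consequently the density of \<open>\<integral> \<langle>\<mu>\<rangle>\<^sup>* dP\<close> with respect to \<open>P\<close>, taken over the unit ball, also is the density
  of \<open>\<integral> \<langle>\<nu>\<rangle>\<^sup>* dQ\<^sub>\<mu>(\<nu>)\<close> with respect to \<open>Q\<^sub>\<mu>\<close> for almost every component \<open>Q\<^sub>\<mu>\<close>, and it is almost everywhere
  positive. So the components satisfy the quasi-Palm condition on the unit ball, and \<open>S\<^sup>*\<close>-invariance
  transports it to all balls and hence to all bounded neighborhoods of \<open>0\<close>.
\<close>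

subsection \<open>A countable family of tent functions\<close>

text \<open>A null set of components may be discarded only countably often, while the quasi-Palm
  condition involves uncountably many neighborhoods; hence the reduction to a single one. The closed
  sup-norm unit ball is the natural choice: since \<mu>(B_1) = 1, drawing \<mu> from P and then x
  from \<mu> on B_1 is a probability law, under which \<mu> has law P and T_x^*\<mu> has the
  averaged law.

  The obstacle is the normalization. It is run on sets instead: what is tracked for a set A is the
  probability that exactly one of the two contracted measures lies in A, and its tending to 0
  survives complements and countable unions.

  A second difficulty is that normalized measures may be infinite and so do not form a
  subprobability kernel; measurability in \<mu> and x is obtained from their restrictions to
  balls.\<close>

definition lip_functions :: "(real ^ 'n \<Rightarrow> real) set" where
  "lip_functions = {f. (\<exists>L. L-lipschitz_on UNIV f) \<and> bounded {x. f x \<noteq> 0}}"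

text \<open>Cones over \<open>q\<close> of height \<open>c\<close>. The slope \<open>Suc k\<close>
  is never 0, so the support is bounded; a nonpositive height gives the zero function.\<close>

fun tent :: "(real ^ 'n) \<times> real \<times> nat \<Rightarrow> real ^ 'n \<Rightarrow> real" where
  "tent (q, c, k) x = max 0 (c - real (Suc k) * dist x q)"

text \<open>Lists keep the family countable, and the seed 0 makes every maximum nonnegative, that of
  the empty list included.\<close>

definition tents :: "((real ^ 'n) \<times> real \<times> nat) list \<Rightarrow> real ^ 'n \<Rightarrow> real" where
  "tents ps x = foldr (\<lambda>p v. max (tent p x) v) ps 0"

lemma tents_simps [simp]: "tents [] x = 0" "tents (p # ps) x = max (tent p x) (tents ps x)"
  by (simp_all add: tents_def)

lemma tents_le_iff: "tents ps x \<le> v \<longleftrightarrow> 0 \<le> v \<and> (\<forall>p\<in>set ps. tent p x \<le> v)"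
  by (induction ps) auto

lemma tents_nonneg: "0 \<le> tents ps x"
  by (induction ps) auto

lemma tent_le_tents: "p \<in> set ps \<Longrightarrow> tent p x \<le> tents ps x"
  using tents_le_iff[of ps x "tents ps x"] by auto

lemma lipschitz_on_max:
  fixes f g :: "'a::metric_space \<Rightarrow> real"
  assumes "L-lipschitz_on S f" "M-lipschitz_on S g"
  shows "(max L M)-lipschitz_on S (\<lambda>x. max (f x) (g x))"
proof (rule lipschitz_onI)
  fix x y assume xy: "x \<in> S" "y \<in> S"
  have "dist (f x) (f y) \<le> L * dist x y" "dist (g x) (g y) \<le> M * dist x y"
    using assms xy by (auto dest: lipschitz_onD)
  moreover have "L * dist x y \<le> max L M * dist x y" "M * dist x y \<le> max L M * dist x y"
    by (auto intro!: mult_right_mono)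
  ultimately show "dist (max (f x) (g x)) (max (f y) (g y)) \<le> max L M * dist x y"
    unfolding dist_real_def by linarith
next
  show "0 \<le> max L M"
    using assms by (auto dest: lipschitz_on_nonneg)
qed

lemma lipschitz_tent: "(real (Suc k))-lipschitz_on UNIV (tent (q, c, k))"
proof (rule lipschitz_onI)
  fix x y
  have "\<bar>dist x q - dist y q\<bar> \<le> dist x y"
    by (metis abs_dist_diff_le dist_commute)
  then have "real (Suc k) * \<bar>dist x q - dist y q\<bar> \<le> real (Suc k) * dist x y"
    by (intro mult_left_mono) auto
  moreover have "real (Suc k) * \<bar>dist x q - dist y q\<bar> = \<bar>real (Suc k) * dist x q - real (Suc k) * dist y q\<bar>"
    by (simp only: right_diff_distrib[symmetric] abs_mult abs_of_nat)
  ultimately show "dist (tent (q, c, k) x) (tent (q, c, k) y) \<le> real (Suc k) * dist x y"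
    unfolding dist_real_def tent.simps by linarith
qed auto

lemma bounded_tent: "bounded {x. tent (q, c, k) x \<noteq> 0}"
proof (rule bounded_subset[OF bounded_cball])
  show "{x. tent (q, c, k) x \<noteq> 0} \<subseteq> cball q c"
  proof
    fix x assume "x \<in> {x. tent (q, c, k) x \<noteq> 0}"
    then have "real (Suc k) * dist x q < c"
      by (auto split: if_splits simp: max_def)
    moreover have "1 * dist x q \<le> real (Suc k) * dist x q"
      by (rule mult_right_mono) auto
    ultimately show "x \<in> cball q c"
      by (simp add: dist_commute)
  qed
qed

lemma tents_in_lip_functions: "tents ps \<in> lip_functions"
proof (induction ps)
  case Nil
  have "0-lipschitz_on UNIV (tents [])"
    by (intro lipschitz_onI) auto
  then show ?case
    by (auto simp: lip_functions_def)
next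
  case (Cons p ps)
  obtain q c k where p: "p = (q, c, k)" by (cases p)
  from Cons obtain L where "L-lipschitz_on UNIV (tents ps)" "bounded {x. tents ps x \<noteq> 0}"
    by (auto simp: lip_functions_def)
  then have "(max (real (Suc k)) L)-lipschitz_on UNIV (\<lambda>x. max (tent p x) (tents ps x))"
    unfolding p by (intro lipschitz_on_max lipschitz_tent)
  moreover have "tents (p # ps) = (\<lambda>x. max (tent p x) (tents ps x))"
    by auto
  moreover have "{x. tents (p # ps) x \<noteq> 0} \<subseteq> {x. tent (q, c, k) x \<noteq> 0} \<union> {x. tents ps x \<noteq> 0}"
    by (auto simp: p simp del: tent.simps)
  then have "bounded {x. tents (p # ps) x \<noteq> 0}"
    by (rule bounded_subset[rotated]) (use bounded_tent \<open>bounded {x. tents ps x \<noteq> 0}\<close> in auto)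
  ultimately show ?case
    unfolding lip_functions_def by auto
qed

lemma lip_functions_subset_test_functions: "lip_functions \<subseteq> test_functions"
  by (auto simp: lip_functions_def test_functions_def compact_closure
      intro: lipschitz_on_continuous_on)

text \<open>Near \<open>x\<close> the function stays above a level \<open>s' > s\<close>, and a
  sufficiently steep cone of height between \<open>s\<close> and \<open>s'\<close>, with apex close
  to \<open>x\<close>, lives only there. Nonnegativity of \<open>f\<close> takes care of all points
  off the cone.\<close>

lemma tent_below:
  fixes f :: "real ^ 'n \<Rightarrow> real"
  assumes S: "\<And>x e. e > 0 \<Longrightarrow> \<exists>q\<in>S. dist x q < e"
    and f: "continuous_on UNIV f" "\<And>x. 0 \<le> f x" and s: "0 \<le> s" "s < f x"
  shows "\<exists>p\<in>S \<times> \<rat> \<times> UNIV. s < tent p x \<and> (\<forall>y. tent p y \<le> f y)"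
proof -
  obtain s' where s': "s < s'" "s' < f x" using dense[OF s(2)] by blast
  have "open {y. s' < f y}"
    by (intro open_Collect_less continuous_intros f)
  then obtain \<delta> where \<delta>: "\<delta> > 0" "ball x \<delta> \<subseteq> {y. s' < f y}"
    using s' by (metis mem_Collect_eq open_contains_ball)
  obtain c where c: "c \<in> \<rat>" "s < c" "c < s'"
    using Rats_dense_in_real[OF s'(1)] by blast
  \<comment> \<open>The slope makes the radius \<open>c / Suc k\<close> of the cone smaller than
    \<open>\<delta> / 2\<close>.\<close>
  obtain k where k: "c / (\<delta>/2) < real (Suc k)"
    by (metis reals_Archimedean2 less_trans lessI of_nat_less_iff)
  \<comment> \<open>The first bound keeps the cone inside the ball of radius \<open>\<delta>\<close>
    around \<open>x\<close>; the second makes the loss of height from \<open>q\<close> to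
    \<open>x\<close> less than \<open>c - s\<close>.\<close>
  define e where "e = min (\<delta>/2) ((c - s) / real (Suc k))"
  have "e > 0" using \<delta> c by (simp add: e_def)
  then obtain q where q: "q \<in> S" "dist x q < e" using S by blast
  have "tent (q, c, k) y \<le> f y" for y
  proof (cases "tent (q, c, k) y = 0")
    case False
    then have *: "real (Suc k) * dist y q < c"
      by (auto split: if_splits simp: max_def)
    have "dist y q < \<delta> / 2"
    proof (rule ccontr)
      assume "\<not> dist y q < \<delta> / 2"
      then have "real (Suc k) * (\<delta>/2) \<le> real (Suc k) * dist y q"
        by (intro mult_left_mono) auto
      moreover have "c < real (Suc k) * (\<delta>/2)"
        using k \<delta> by (simp add: field_simps)
      ultimately show False using * by linarith
    qed
    moreover have "dist x q < \<delta> / 2" using q by (simp add: e_def)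
    ultimately have "dist x y < \<delta>"
      by (metis dist_commute dist_triangle_half_r)
    then have "s' < f y" using \<delta> by auto
    moreover have "tent (q, c, k) y \<le> c"
      using s c by auto
    ultimately show ?thesis using c by linarith
  qed (use f in simp)
  moreover have "real (Suc k) * dist x q < c - s"
    using q(2) by (simp add: e_def field_simps)
  then have "s < tent (q, c, k) x" by auto
  ultimately show ?thesis using q c by (intro bexI[of _ "(q, c, k)"]) auto
qed

text \<open>The supremum of the cones below \<open>f\<close> is \<open>f\<close>, and finite maxima
  along an enumeration of them converge to it from below. The domination clause will turn lower
  bounds for integrals into upper ones, through \<open>d - f\<close>.\<close>

lemma countable_lip_family:
  obtains D :: "(real ^ 'n \<Rightarrow> real) set" where
    "countable D" "D \<subseteq> lip_functions" "\<And>d x. d \<in> D \<Longrightarrow> 0 \<le> d x"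
    "\<And>f. f \<in> test_functions \<Longrightarrow> (\<And>x. 0 \<le> f x) \<Longrightarrow>
      \<exists>g. (\<forall>n. g n \<in> D) \<and> (\<forall>n x. g n x \<le> f x) \<and> (\<forall>x. (\<lambda>n. g n x) \<longlonglongrightarrow> f x)"
    "\<And>f. f \<in> test_functions \<Longrightarrow> \<exists>d\<in>D. \<forall>x. f x \<le> d x"
proof -
  obtain S :: "(real ^ 'n) set" where S: "countable S" "\<And>X. open X \<Longrightarrow> X \<noteq> {} \<Longrightarrow> \<exists>s\<in>S. s \<in> X"
    using countable_dense_exists[where 'a="real ^ 'n"] by blast
  have S': "\<exists>q\<in>S. dist x q < e" if "e > 0" for x e
    using S(2)[of "ball x e"] that by auto
  define T where "T = S \<times> (\<rat> :: real set) \<times> (UNIV :: nat set)"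
  have T: "countable T"
    unfolding T_def by (intro countable_SIGMA S countable_rat) auto
  show thesis
  proof (rule that[of "tents ` lists T"])
    show "countable (tents ` lists T)"
      by (intro countable_image countable_lists T)
    show "tents ` lists T \<subseteq> lip_functions"
      using tents_in_lip_functions by auto
    show "\<And>d x. d \<in> tents ` lists T \<Longrightarrow> 0 \<le> d x"
      using tents_nonneg by auto
    fix f :: "real ^ 'n \<Rightarrow> real" assume f: "f \<in> test_functions"
    show "\<exists>g. (\<forall>n. g n \<in> tents ` lists T) \<and> (\<forall>n x. g n x \<le> f x) \<and> (\<forall>x. (\<lambda>n. g n x) \<longlonglongrightarrow> f x)"
      if f0: "\<And>x. 0 \<le> f x"
    proof -
      define E where "E = {p\<in>T. \<forall>y. tent p y \<le> f y}"
      \<comment> \<open>The zero cone belongs to \<open>E\<close>: enumerating by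
        \<open>from_nat_into\<close> requires a nonempty set.\<close>
      obtain q where "q \<in> S" using S'[of 1] by auto
      then have "(q, 0, 0) \<in> E" using f0 by (auto simp: E_def T_def)
      then have ne: "E \<noteq> {}" by auto
      have cE: "countable E" using T by (auto simp: E_def intro: countable_subset)
      define e where "e = from_nat_into E"
      have e: "e n \<in> E" for n using ne by (auto simp: e_def intro: from_nat_into)
      define g where "g n = tents (map e [0..<n])" for n
      have "g n \<in> tents ` lists T" for n
        unfolding g_def using e by (intro imageI) (auto simp: E_def)
      moreover have le: "g n x \<le> f x" for n x
        unfolding g_def tents_le_iff using f0 e by (auto simp: E_def)
      moreover have "(\<lambda>n. g n x) \<longlonglongrightarrow> f x" for x
      proof (rule order_tendstoI)
        fix a assume "f x < a"
        then show "\<forall>\<^sub>F n in sequentially. g n x < a"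
          using le by (auto intro!: always_eventually intro: le_less_trans)
      next
        fix a assume a: "a < f x"
        show "\<forall>\<^sub>F n in sequentially. a < g n x"
        proof (cases "a < 0")
          case True
          then show ?thesis
            using tents_nonneg by (auto intro!: always_eventually intro: less_le_trans simp: g_def)
        next
          case False
          have fc: "continuous_on UNIV f" using f by (simp add: test_functions_def)
          obtain p where p: "p \<in> E" "a < tent p x"
            using tent_below[OF S' fc f0 _ a] False by (auto simp: E_def T_def simp del: tent.simps)
          obtain m where "e m = p"
            using p(1) cE by (metis e_def from_nat_into_surj)
          then have "a < g n x" if "n \<ge> Suc m" for n
            using that p(2) unfolding g_def
            by (intro less_le_trans[OF p(2)] tent_le_tents) auto
          then show ?thesis
            using eventually_sequentially by blast
        qed
      qed
      ultimately show ?thesis by blast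
    qed
    have "compact (f ` closure {x. f x \<noteq> 0})"
      using f by (auto simp: test_functions_def intro!: compact_continuous_image intro: continuous_on_subset)
    then obtain B where B: "\<And>x. x \<in> closure {x. f x \<noteq> 0} \<Longrightarrow> \<bar>f x\<bar> \<le> B"
      using compact_imp_bounded[of "f ` closure {x. f x \<noteq> 0}"] unfolding bounded_iff by auto
    obtain q where q: "q \<in> S" using S'[of 1] by auto
    have "bounded {x. f x \<noteq> 0}"
      using f by (simp add: test_functions_def compact_closure)
    then obtain R where R: "\<And>x. f x \<noteq> 0 \<Longrightarrow> dist x q \<le> R"
      unfolding bounded_any_center[where a=q] by (auto simp: dist_commute)
    \<comment> \<open>A cone of slope 1 loses at most \<open>\<bar>R\<bar>\<close> of its height on
      the support of \<open>f\<close>, so this height leaves at least \<open>\<bar>B\<bar>\<close>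
      there; a natural number is in particular rational.\<close>
    obtain c :: nat where c: "\<bar>B\<bar> + \<bar>R\<bar> \<le> real c"
      using real_arch_simple by blast
    have "f x \<le> tents [(q, real c, 0)] x" for x
    proof (cases "f x = 0")
      case False
      then have "x \<in> closure {x. f x \<noteq> 0}" using closure_subset[of "{x. f x \<noteq> 0}"] by blast
      then show ?thesis using B[of x] R[OF False] c by auto
    qed auto
    moreover have "tents [(q, real c, 0)] \<in> tents ` lists T"
      using q by (intro imageI) (auto simp: T_def)
    ultimately show "\<exists>d\<in>tents ` lists T. \<forall>x. f x \<le> d x" by blast
  qed
qed

subsection \<open>The Borel structure of the space of normalized measures\<close>

lemma integrable_test_function:
  assumes "\<mu> \<in> radon_measures" "f \<in> test_functions"
  shows "integrable \<mu> f"
proof -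
  let ?K = "closure {x. f x \<noteq> 0}"
  have K: "compact ?K" and f: "continuous_on UNIV f"
    using assms(2) by (auto simp: test_functions_def)
  have sets: "sets \<mu> = sets borel" and fin: "emeasure \<mu> ?K < \<infinity>"
    using assms(1) K by (auto simp: radon_measures_def)
  obtain B where B: "\<And>x. x \<in> ?K \<Longrightarrow> \<bar>f x\<bar> \<le> B"
    using compact_imp_bounded[OF compact_continuous_image[OF continuous_on_subset[OF f subset_UNIV] K]]
    unfolding bounded_iff by auto
  show ?thesis
  proof (rule integrableI_bounded_set[where A="?K" and B=B])
    show "?K \<in> sets \<mu>" by (simp add: sets)
    show "f \<in> borel_measurable \<mu>"
      using borel_measurable_continuous_onI[OF f] measurable_cong_sets[OF sets refl] by auto
    show "AE x in \<mu>. x \<notin> ?K \<longrightarrow> f x = 0"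
      using closure_subset[of "{x. f x \<noteq> 0}"] by auto
  qed (use B fin in auto)
qed

text \<open>Half-lines with rational end points: a countable subbasis when \<open>D\<close> is
  countable.\<close>

definition evaluation_sets :: "(real ^ 'n \<Rightarrow> real) set \<Rightarrow> (real ^ 'n) measure set set" where
  "evaluation_sets D = (\<lambda>(d, a). {\<mu> \<in> radon_measures. a < (LINT x|\<mu>. d x)}) ` (D \<times> \<rat>)
     \<union> (\<lambda>(d, a). {\<mu> \<in> radon_measures. (LINT x|\<mu>. d x) < a}) ` (D \<times> \<rat>)"

lemma test_functions_diff:
  assumes "f \<in> test_functions" "g \<in> test_functions"
  shows "(\<lambda>x. f x - g x) \<in> test_functions"
proof -
  have "{x. f x - g x \<noteq> 0} \<subseteq> {x. f x \<noteq> 0} \<union> {x. g x \<noteq> 0}" by auto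
  then show ?thesis
    using assms by (auto simp: test_functions_def compact_closure intro!: continuous_intros
      dest: bounded_subset[rotated])
qed

lemma test_functions_pos_part:
  assumes "f \<in> test_functions"
  shows "(\<lambda>x. max 0 (f x)) \<in> test_functions"
proof -
  have "{x. max 0 (f x) \<noteq> 0} \<subseteq> {x. f x \<noteq> 0}" by auto
  then show ?thesis
    using assms by (auto simp: test_functions_def compact_closure intro!: continuous_intros
      dest: bounded_subset[rotated])
qed

lemma test_functions_uminus:
  "f \<in> test_functions \<Longrightarrow> (\<lambda>x. - f x) \<in> test_functions"
  by (auto simp: test_functions_def intro!: continuous_intros)

text \<open>Second countability of the weak topology. For nonnegative \<open>f\<close> the integral
  is the supremum of the integrals of its approximants, which gives lower semicontinuity. Upper
  semicontinuity is lower semicontinuity for \<open>h - f\<close> with a dominating \<open>h\<close>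
  from \<open>D\<close>, whose own integral is bounded above by subbasic sets. Signed functions are
  split into positive and negative parts.\<close>

lemma openin_radon_imp_generated:
  obtains D :: "(real ^ 'n \<Rightarrow> real) set" where
    "countable D" "D \<subseteq> lip_functions" "\<And>d x. d \<in> D \<Longrightarrow> 0 \<le> d x"
    "\<And>U. openin radon_topology U \<Longrightarrow> openin (topology_generated_by (evaluation_sets D)) U"
proof -
  obtain D :: "(real ^ 'n \<Rightarrow> real) set" where D: "countable D" "D \<subseteq> lip_functions" "\<And>d x. d \<in> D \<Longrightarrow> 0 \<le> d x"
    and approx: "\<And>f. f \<in> test_functions \<Longrightarrow> (\<And>x. 0 \<le> f x) \<Longrightarrow>
      \<exists>g. (\<forall>n. g n \<in> D) \<and> (\<forall>n x. g n x \<le> f x) \<and> (\<forall>x. (\<lambda>n. g n x) \<longlonglongrightarrow> f x)"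
    and dom: "\<And>f. f \<in> test_functions \<Longrightarrow> \<exists>d\<in>D. \<forall>x. f x \<le> d x"
    using countable_lip_family by metis
  have Dt: "d \<in> test_functions" if "d \<in> D" for d
    using that D(2) lip_functions_subset_test_functions by auto
  let ?T = "topology_generated_by (evaluation_sets D)"
  have basic: "openin ?T {\<mu> \<in> radon_measures. a < (LINT x|\<mu>. d x)}"
     "openin ?T {\<mu> \<in> radon_measures. (LINT x|\<mu>. d x) < a}" if "d \<in> D" "a \<in> \<rat>" for d a
    using that by (auto intro!: topology_generated_by_Basis simp: evaluation_sets_def)
  have lower: "openin ?T {\<mu> \<in> radon_measures. a < (LINT x|\<mu>. f x)}"
    if f: "f \<in> test_functions" and f0: "\<And>x. 0 \<le> f x" for f a
  proof -
    obtain g where g: "\<And>n. g n \<in> D" "\<And>n x. g n x \<le> f x" "\<And>x. (\<lambda>n. g n x) \<longlonglongrightarrow> f x"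
      using approx[OF f f0] by blast
    have "{\<mu> \<in> radon_measures. a < (LINT x|\<mu>. f x)} =
      (\<Union>n. \<Union>q\<in>{q\<in>\<rat>. a < q}. {\<mu> \<in> radon_measures. q < (LINT x|\<mu>. g n x)})" (is "?L = ?R")
    proof (intro equalityI subsetI)
      fix \<mu> assume "\<mu> \<in> ?L"
      then have \<mu>: "\<mu> \<in> radon_measures" and *: "a < (LINT x|\<mu>. f x)" by auto
      obtain q where q: "q \<in> \<rat>" "a < q" "q < (LINT x|\<mu>. f x)"
        using Rats_dense_in_real[OF *] by blast
      have "(\<lambda>n. LINT x|\<mu>. g n x) \<longlonglongrightarrow> (LINT x|\<mu>. f x)"
      proof (rule integral_dominated_convergence[where w=f])
        show "f \<in> borel_measurable \<mu>" "integrable \<mu> f"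
          using integrable_test_function[OF \<mu> f] by auto
        show "g n \<in> borel_measurable \<mu>" for n
          using integrable_test_function[OF \<mu> Dt[OF g(1)]] by auto
        show "AE x in \<mu>. norm (g n x) \<le> f x" for n
          using g(2) D(3)[OF g(1)] by (auto simp: abs_of_nonneg)
      qed (use g in auto)
      from order_tendstoD(1)[OF this q(3)]
      obtain n where "q < (LINT x|\<mu>. g n x)"
        using eventually_happens by force
      then show "\<mu> \<in> ?R" using q \<mu> by auto
    next
      fix \<mu> assume "\<mu> \<in> ?R"
      then obtain n q where \<mu>: "\<mu> \<in> radon_measures" and *: "a < q" "q < (LINT x|\<mu>. g n x)" by auto
      have "(LINT x|\<mu>. g n x) \<le> (LINT x|\<mu>. f x)"
        by (intro integral_mono integrable_test_function[OF \<mu>] f Dt g)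
      then show "\<mu> \<in> ?L" using \<mu> * by auto
    qed
    also have "openin ?T \<dots>"
      by (intro openin_Union) (auto intro!: basic g)
    finally show ?thesis .
  qed
  have cont: "continuous_map ?T euclideanreal (\<lambda>\<mu>. LINT x|\<mu>. f x)"
    if f: "f \<in> test_functions" and f0: "\<And>x. 0 \<le> f x" for f
  proof -
    obtain h where h: "h \<in> D" "\<And>x. f x \<le> h x" using dom[OF f] by blast
    have hf: "openin ?T {\<mu> \<in> radon_measures. a < (LINT x|\<mu>. h x - f x)}" for a
      using h by (intro lower test_functions_diff f Dt) auto
    \<comment> \<open>The rational \<open>c\<close> separates an upper bound on the integral of
      \<open>h\<close> from a lower bound on that of \<open>h - f\<close>.\<close>
    have upper: "openin ?T {\<mu> \<in> radon_measures. (LINT x|\<mu>. f x) < a}" for a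
    proof -
      have "{\<mu> \<in> radon_measures. (LINT x|\<mu>. f x) < a} =
        (\<Union>c\<in>\<rat>. {\<mu> \<in> radon_measures. (LINT x|\<mu>. h x) < c} \<inter> {\<mu> \<in> radon_measures. c - a < (LINT x|\<mu>. h x - f x)})"
        (is "?L = ?R")
      proof (intro equalityI subsetI)
        fix \<mu> assume "\<mu> \<in> ?L"
        then have \<mu>: "\<mu> \<in> radon_measures" and *: "(LINT x|\<mu>. f x) < a" by auto
        have "(LINT x|\<mu>. h x - f x) = (LINT x|\<mu>. h x) - (LINT x|\<mu>. f x)"
          by (intro Bochner_Integration.integral_diff integrable_test_function[OF \<mu>] f Dt h)
        moreover obtain c where "c \<in> \<rat>" "(LINT x|\<mu>. h x) < c" "c < (LINT x|\<mu>. h x) - (LINT x|\<mu>. f x) + a"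
          using Rats_dense_in_real[of "LINT x|\<mu>. h x" "(LINT x|\<mu>. h x) - (LINT x|\<mu>. f x) + a"] * by auto
        ultimately show "\<mu> \<in> ?R" using \<mu> by (intro UN_I[of c]) auto
      next
        fix \<mu> assume "\<mu> \<in> ?R"
        then obtain c where \<mu>: "\<mu> \<in> radon_measures" and *: "(LINT x|\<mu>. h x) < c" "c - a < (LINT x|\<mu>. h x - f x)" by auto
        have "(LINT x|\<mu>. h x - f x) = (LINT x|\<mu>. h x) - (LINT x|\<mu>. f x)"
          by (intro Bochner_Integration.integral_diff integrable_test_function[OF \<mu>] f Dt h)
        with * \<mu> show "\<mu> \<in> ?L" by auto
      qed
      also have "openin ?T \<dots>"
        by (intro openin_Union) (auto intro!: basic(2) h openin_Int hf)
      finally show ?thesis .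
    qed
    have top: "topspace ?T = radon_measures"
    proof -
      have "\<Union> (evaluation_sets D) \<subseteq> radon_measures"
        by (auto simp: evaluation_sets_def)
      moreover have "topspace ?T \<supseteq> radon_measures"
      proof
        fix \<mu> :: "(real ^ 'n) measure" assume "\<mu> \<in> radon_measures"
        then show "\<mu> \<in> topspace ?T"
          using openin_subset[OF upper[of "(LINT x|\<mu>. f x) + 1"]] by auto
      qed
      ultimately show ?thesis
        unfolding topology_generated_by_topspace by blast
    qed
    show ?thesis
      unfolding continuous_map_upper_lower_semicontinuous_lt top using lower[OF f f0] upper by auto
  qed
  have cont': "continuous_map ?T euclideanreal (\<lambda>\<mu>. LINT x|\<mu>. f x)"
    if f: "f \<in> test_functions" for f
  proof -
    have p: "(\<lambda>x. max 0 (f x)) \<in> test_functions" "(\<lambda>x. max 0 (- f x)) \<in> test_functions"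
      using f test_functions_pos_part test_functions_uminus by auto
    have c: "continuous_map ?T euclideanreal (\<lambda>\<mu>. (LINT x|\<mu>. max 0 (f x)) - (LINT x|\<mu>. max 0 (- f x)))"
      by (intro continuous_intros cont p) auto
    show ?thesis
    proof (rule continuous_map_eq[OF c])
      fix \<mu> assume "\<mu> \<in> topspace ?T"
      then have \<mu>: "\<mu> \<in> radon_measures"
        by (auto simp: topology_generated_by_topspace evaluation_sets_def)
      have "(LINT x|\<mu>. max 0 (f x) - max 0 (- f x)) = (LINT x|\<mu>. max 0 (f x)) - (LINT x|\<mu>. max 0 (- f x))"
        by (intro Bochner_Integration.integral_diff integrable_test_function[OF \<mu>] p)
      moreover have "(\<lambda>x. max 0 (f x) - max 0 (- f x)) = f" by (auto simp: max_def)
      ultimately show "(LINT x|\<mu>. max 0 (f x)) - (LINT x|\<mu>. max 0 (- f x)) = (LINT x|\<mu>. f x)" by simp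
    qed
  qed
  have top: "topspace ?T = radon_measures"
  proof (rule equalityI)
    show "topspace ?T \<subseteq> radon_measures"
      by (auto simp: topology_generated_by_topspace evaluation_sets_def)
    show "radon_measures \<subseteq> topspace ?T"
    proof
      fix \<mu> :: "(real ^ 'n) measure" assume \<mu>: "\<mu> \<in> radon_measures"
      \<comment> \<open>Dominating the zero function merely produces an element of
        \<open>D\<close>.\<close>
      have "(\<lambda>x::real^'n. 0::real) \<in> test_functions" by (simp add: test_functions_def)
      then obtain d where d: "d \<in> D" using dom by blast
      obtain a where "a \<in> \<rat>" "(LINT x|\<mu>. d x) < a" using Rats_dense_in_real[of "(LINT x|\<mu>. d x)"] less_add_one by blast
      then show "\<mu> \<in> topspace ?T"
        using openin_subset[OF basic(2)[OF d]] \<mu> by blast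
    qed
  qed
  show thesis
  proof (rule that[OF D(1,2)], fact D(3))
    fix U :: "(real ^ 'n) measure set" assume "openin radon_topology U"
    then have "generate_topology_on
       {{\<mu> \<in> radon_measures. (LINT x|\<mu>. f x) \<in> V} |f V. f \<in> test_functions \<and> open V} U"
      unfolding radon_topology_def by (rule openin_topology_generated_by)
    then show "openin ?T U"
    proof (rule generate_topology_on_coarsest[rotated 2])
      show "istopology (openin ?T)" by (rule istopology_openin)
      fix S :: "(real ^ 'n) measure set" assume "S \<in> {{\<mu> \<in> radon_measures. (LINT x|\<mu>. f x) \<in> V} |f V. f \<in> test_functions \<and> open V}"
      then obtain f V where f: "f \<in> test_functions" "open V" and S: "S = {\<mu> \<in> radon_measures. (LINT x|\<mu>. f x) \<in> V}" by blast
      show "openin ?T S"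
        using openin_continuous_map_preimage[OF cont'[OF f(1)], of V] f(2) unfolding S top by simp
    qed
  qed
qed

text \<open>Finite intersections of the subbasis form a countable base, so every open set is a
  countable union of base sets. The empty intersection is excluded because it would be
  \<open>UNIV\<close> rather than a subset of \<open>\<Omega>\<close>.\<close>

lemma countable_generated_topology_sigma:
  assumes "countable \<S>" "openin (topology_generated_by \<S>) U" "\<S> \<subseteq> Pow \<Omega>"
  shows "U \<in> sigma_sets \<Omega> \<S>"
proof -
  define \<B> where "\<B> = Inter ` {F. finite F \<and> F \<subseteq> \<S> \<and> F \<noteq> {}}"
  have cB: "countable \<B>"
    unfolding \<B>_def using countable_Collect_finite_subset[OF assms(1)]
    by (intro countable_image) (auto elim: countable_subset[rotated])
  have Bint: "A \<inter> B \<in> \<B>" if AB: "A \<in> \<B>" "B \<in> \<B>" for A B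
  proof -
    obtain F where "A = \<Inter>F" "F \<in> {F. finite F \<and> F \<subseteq> \<S> \<and> F \<noteq> {}}"
      using AB(1) unfolding \<B>_def by (rule imageE)
    moreover obtain G where "B = \<Inter>G" "G \<in> {F. finite F \<and> F \<subseteq> \<S> \<and> F \<noteq> {}}"
      using AB(2) unfolding \<B>_def by (rule imageE)
    ultimately show ?thesis unfolding \<B>_def by (intro image_eqI[of _ _ "F \<union> G"]) auto
  qed
  have "generate_topology_on \<S> U"
    using assms(2) by (rule openin_topology_generated_by)
  then have "\<exists>C\<subseteq>\<B>. U = \<Union>C"
  proof induction
    case Empty
    then show ?case by (intro exI[of _ "{}"]) auto
  next
    case (Int a b)
    then obtain C1 C2 where C: "C1 \<subseteq> \<B>" "C2 \<subseteq> \<B>" "a = \<Union>C1" "b = \<Union>C2" by blast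
    show ?case
      using C Bint by (intro exI[of _ "(\<lambda>(x, y). x \<inter> y) ` (C1 \<times> C2)"]) auto
  next
    case (UN K)
    then have "\<forall>k\<in>K. \<exists>C\<subseteq>\<B>. k = \<Union>C" by blast
    then obtain C where C: "\<And>k. k \<in> K \<Longrightarrow> C k \<subseteq> \<B> \<and> k = \<Union>(C k)" by metis
    show ?case
    proof (intro exI conjI)
      show "\<Union>(C ` K) \<subseteq> \<B>" using C by blast
      show "\<Union>K = \<Union>(\<Union>(C ` K))" using C by blast
    qed
  next
    case (Basis s)
    then show ?case by (intro exI[of _ "{s}"]) (auto simp: \<B>_def intro!: image_eqI[of _ _ "{s}"])
  qed
  then obtain C where C: "C \<subseteq> \<B>" "U = \<Union>C" by blast
  interpret sigma_algebra \<Omega> "sigma_sets \<Omega> \<S>"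
    by (rule sigma_algebra_sigma_sets[OF assms(3)])
  have "B \<in> sigma_sets \<Omega> \<S>" if B: "B \<in> \<B>" for B
  proof -
    obtain F where "B = \<Inter>F" "F \<in> {F. finite F \<and> F \<subseteq> \<S> \<and> F \<noteq> {}}"
      using B unfolding \<B>_def by (rule imageE)
    then show ?thesis
      using finite_INT[of F "\<lambda>x. x"] by auto
  qed
  then show ?thesis
    unfolding C(2) using C(1) countable_subset[OF C(1) cB] by (intro countable_Union) auto
qed

section \<open>Sup-norm balls and Lipschitz functions\<close>

lemma mem_sup_ball: "y \<in> sup_ball r x \<longleftrightarrow> infnorm (y - x) \<le> r"
  by (simp add: sup_ball_def)

lemma closed_sup_ball: "closed (sup_ball r x)"
  unfolding sup_ball_def by (intro closed_Collect_le continuous_intros)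

lemma sup_ball_subset_cball: "sup_ball r (x :: real ^ 'n) \<subseteq> cball x (sqrt (real DIM(real ^ 'n)) * r)"
proof
  fix y assume "y \<in> sup_ball r x"
  then have "infnorm (y - x) \<le> r" by (simp add: mem_sup_ball)
  then have "norm (y - x) \<le> sqrt (real DIM(real ^ 'n)) * r"
    by (meson norm_le_infnorm mult_left_mono order_trans real_sqrt_ge_zero of_nat_0_le_iff)
  then show "y \<in> cball x (sqrt (real DIM(real ^ 'n)) * r)"
    by (simp add: dist_norm norm_minus_commute)
qed

lemma compact_sup_ball: "compact (sup_ball r x)"
  using closed_sup_ball bounded_subset[OF bounded_cball sup_ball_subset_cball] compact_eq_bounded_closed
  by blast

lemma cball_subset_sup_ball: "cball x r \<subseteq> sup_ball r x"
  using infnorm_le_norm by (force simp: mem_sup_ball dist_norm norm_minus_commute intro: order_trans)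

lemma sup_ball_borel [measurable]: "sup_ball r x \<in> sets borel"
  by (intro borel_closed closed_sup_ball)

lemma sup_ball_mono: "r \<le> s \<Longrightarrow> sup_ball r x \<subseteq> sup_ball s x"
  by (auto simp: mem_sup_ball)

lemma lip_functions_cmult:
  assumes "f \<in> lip_functions"
  shows "(\<lambda>x. a * f x) \<in> lip_functions"
proof -
  have "{x. a * f x \<noteq> 0} \<subseteq> {x. f x \<noteq> 0}" by auto
  moreover obtain L where "L-lipschitz_on UNIV f" using assms by (auto simp: lip_functions_def)
  then have "(\<bar>a\<bar> * L)-lipschitz_on UNIV (\<lambda>x. a * f x)"
    by (rule lipschitz_on_cmult_real)
  ultimately show ?thesis
    using assms by (auto simp: lip_functions_def dest: bounded_subset[rotated])
qed

lemma lip_functions_diff: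
  assumes "f \<in> lip_functions" "g \<in> lip_functions"
  shows "(\<lambda>x. f x - g x) \<in> lip_functions"
proof -
  obtain L M where "L-lipschitz_on UNIV f" "M-lipschitz_on UNIV g" using assms by (auto simp: lip_functions_def)
  then have "(L + M)-lipschitz_on UNIV (\<lambda>x. f x - g x)"
    by (rule lipschitz_on_diff)
  moreover have "{x. f x - g x \<noteq> 0} \<subseteq> {x. f x \<noteq> 0} \<union> {x. g x \<noteq> 0}" by auto
  then have "bounded {x. f x - g x \<noteq> 0}"
    by (rule bounded_subset[rotated]) (use assms in \<open>auto simp: lip_functions_def\<close>)
  ultimately show ?thesis
    by (auto simp: lip_functions_def)
qed

text \<open>Lipschitz functions decreasing to the indicator of a nonempty closed set; for the empty
  set \<open>infdist\<close> is 0 and they are constantly 1.\<close>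

definition bump :: "(real ^ 'n) set \<Rightarrow> nat \<Rightarrow> real ^ 'n \<Rightarrow> real" where
  "bump C k x = max 0 (1 - real (Suc k) * infdist x C)"

lemma bump_bounds: "0 \<le> bump C k x" "bump C k x \<le> 1" "x \<in> C \<Longrightarrow> bump C k x = 1"
  using infdist_nonneg[of x C] by (auto simp: bump_def)

lemma bump_antimono: "m \<le> k \<Longrightarrow> bump C k x \<le> bump C m x"
proof -
  have "real (Suc m) * infdist x C \<le> real (Suc k) * infdist x C" if "m \<le> k"
    using that by (intro mult_right_mono infdist_nonneg) auto
  then show "m \<le> k \<Longrightarrow> bump C k x \<le> bump C m x"
    unfolding bump_def by linarith
qed

lemma bump_tendsto:
  assumes "closed C" "C \<noteq> {}"
  shows "(\<lambda>k. bump C k x) \<longlonglongrightarrow> indicator C x"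
proof (cases "x \<in> C")
  case False
  then have pos: "infdist x C > 0"
    using assms by (simp add: infdist_pos_not_in_closed)
  obtain k where k: "1 / infdist x C < real k" using reals_Archimedean2 by blast
  have "bump C j x = 0" if "j \<ge> k" for j
  proof -
    have "1 < real k * infdist x C" using k pos by (simp add: field_simps)
    also have "\<dots> \<le> real (Suc j) * infdist x C" using that pos by (intro mult_right_mono) auto
    finally show ?thesis by (simp add: bump_def)
  qed
  then have "\<forall>\<^sub>F j in sequentially. bump C j x = indicator C x"
    by (intro eventually_sequentiallyI[of k]) (simp add: False)
  then show ?thesis by (rule tendsto_eventually)
qed (simp add: bump_bounds)

lemma bump_in_lip_functions:
  assumes "compact C" "C \<noteq> {}"
  shows "bump C k \<in> lip_functions"
proof -
  have "(real (Suc k))-lipschitz_on UNIV (bump C k)"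
  proof (rule lipschitz_onI)
    fix x y
    have "real (Suc k) * \<bar>infdist x C - infdist y C\<bar> \<le> real (Suc k) * dist x y"
      by (intro mult_left_mono infdist_triangle_abs) auto
    moreover have "real (Suc k) * \<bar>infdist x C - infdist y C\<bar> = \<bar>real (Suc k) * infdist x C - real (Suc k) * infdist y C\<bar>"
      by (simp only: right_diff_distrib[symmetric] abs_mult abs_of_nat)
    ultimately show "dist (bump C k x) (bump C k y) \<le> real (Suc k) * dist x y"
      unfolding dist_real_def bump_def by linarith
  qed auto
  moreover have "{x. bump C k x \<noteq> 0} \<subseteq> {x. infdist x C \<le> 1}"
  proof
    fix x assume "x \<in> {x. bump C k x \<noteq> 0}"
    then have "real (Suc k) * infdist x C < 1" by (auto simp: bump_def max_def split: if_splits)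
    moreover have "1 * infdist x C \<le> real (Suc k) * infdist x C"
      by (intro mult_right_mono infdist_nonneg) auto
    ultimately show "x \<in> {x. infdist x C \<le> 1}" by simp
  qed
  then have "bounded {x. bump C k x \<noteq> 0}"
  proof (rule bounded_subset[rotated])
    show "bounded {x. infdist x C \<le> 1}"
      by (intro compact_imp_bounded compact_infdist_le assms) simp
  qed
  ultimately show ?thesis by (auto simp: lip_functions_def)
qed

lemma bump_integral_tendsto:
  assumes \<mu>: "\<mu> \<in> radon_measures" and C: "compact C" "C \<noteq> {}"
  shows "(\<lambda>k. LINT x|\<mu>. bump C k x) \<longlonglongrightarrow> measure \<mu> C"
proof -
  have b: "bump C k \<in> test_functions" for k
    using bump_in_lip_functions[OF C] lip_functions_subset_test_functions by auto
  have Cs: "C \<in> sets \<mu>" "emeasure \<mu> C < \<infinity>"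
    using \<mu> C by (auto simp: radon_measures_def compact_imp_closed)
  have "(\<lambda>k. LINT x|\<mu>. bump C k x) \<longlonglongrightarrow> (LINT x|\<mu>. indicator C x)"
  proof (rule integral_dominated_convergence[where w="bump C 0"])
    show "integrable \<mu> (bump C 0)" using integrable_test_function[OF \<mu> b] .
    show "bump C k \<in> borel_measurable \<mu>" for k using integrable_test_function[OF \<mu> b] by auto
    show "AE x in \<mu>. (\<lambda>k. bump C k x) \<longlonglongrightarrow> indicator C x"
      using bump_tendsto[OF compact_imp_closed[OF C(1)] C(2)] by simp
    show "AE x in \<mu>. norm (bump C k x) \<le> bump C 0 x" for k
      using bump_antimono[OF le0, of C k] bump_bounds(1)[of C k] by (intro AE_I2) (simp add: abs_of_nonneg)
  qed (use Cs in auto)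
  then show ?thesis using Cs by simp
qed

text \<open>
  Unlike the value of the integral, its sign does not depend on the normalization, whose jumps under
  translations would otherwise have to be controlled.
\<close>

definition pos_set :: "(real ^ 'n \<Rightarrow> real) \<Rightarrow> (real ^ 'n) measure set" where
  "pos_set f = {\<mu> \<in> normalized_measures. 0 < (LINT x|\<mu>. f x)}"

section \<open>Measurable evaluations and a countable generator adapted to the normalization\<close>

lemma normalized_measures_radon: "\<mu> \<in> normalized_measures \<Longrightarrow> \<mu> \<in> radon_measures"
  by (simp add: normalized_measures_def)

lemma sets_normalized_space_eq:
  "sets normalized_space = sigma_sets normalized_measures {U. openin (subtopology radon_topology normalized_measures) U}"
proof -
  have *: "topspace (subtopology radon_topology normalized_measures)
      = (normalized_measures :: (real ^ 'n) measure set)"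
    by (auto simp: normalized_measures_def)
  show ?thesis
    unfolding normalized_space_def borel_algebra_def *
    by (subst sets_measure_of) (use * openin_subset in blast)+
qed

lemma eval_in_sets:
  assumes "f \<in> test_functions" "open V"
  shows "{\<mu> \<in> normalized_measures. (LINT x|\<mu>. f x) \<in> V} \<in> sets normalized_space"
proof -
  have "openin radon_topology {\<mu> \<in> radon_measures. (LINT x|\<mu>. f x) \<in> V}"
    unfolding radon_topology_def using assms by (intro topology_generated_by_Basis) auto
  moreover have "{\<mu> \<in> normalized_measures. (LINT x|\<mu>. f x) \<in> V} =
      {\<mu> \<in> radon_measures. (LINT x|\<mu>. f x) \<in> V} \<inter> normalized_measures"
    using normalized_measures_radon by auto
  ultimately have "openin (subtopology radon_topology normalized_measures) {\<mu> \<in> normalized_measures. (LINT x|\<mu>. f x) \<in> V}"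
    unfolding openin_subtopology by blast
  then show ?thesis
    unfolding sets_normalized_space_eq by (intro sigma_sets.Basic) simp
qed

lemma borel_measurable_eval:
  assumes "f \<in> test_functions"
  shows "(\<lambda>\<mu>. LINT x|\<mu>. f x) \<in> borel_measurable normalized_space"
proof (rule borel_measurableI)
  fix V :: "real set" assume "open V"
  have "(\<lambda>\<mu>. LINT x|\<mu>. f x) -` V \<inter> space normalized_space = {\<mu> \<in> normalized_measures. (LINT x|\<mu>. f x) \<in> V}"
    by auto
  then show "(\<lambda>\<mu>. LINT x|\<mu>. f x) -` V \<inter> space normalized_space \<in> sets normalized_space"
    using eval_in_sets[OF assms \<open>open V\<close>] by simp
qed

lemma measure_unit_ball: "\<mu> \<in> normalized_measures \<Longrightarrow> measure \<mu> (sup_ball 1 0) = 1"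
  by (simp add: normalized_measures_def measure_def)

text \<open>Thresholds are absorbed by the normalization: as \<mu>(B_1) = 1, the condition a <
  \<integral> d d\<mu> says that d minus a times the indicator of B_1 has positive integral, and the
  indicator can be replaced by a late member of the sequence of bumps decreasing to it.\<close>

lemma normalized_space_generator:
  obtains G :: "(real ^ 'n \<Rightarrow> real) set" where
    "countable G" "G \<subseteq> lip_functions"
    "sets normalized_space = sigma_sets normalized_measures (pos_set ` G)"
proof -
  obtain D :: "(real ^ 'n \<Rightarrow> real) set" where D: "countable D" "D \<subseteq> lip_functions" "\<And>d x. d \<in> D \<Longrightarrow> 0 \<le> d x"
    and gen: "\<And>U. openin radon_topology U \<Longrightarrow> openin (topology_generated_by (evaluation_sets D)) U"
    using openin_radon_imp_generated by metis
  have Dt: "d \<in> test_functions" if "d \<in> D" for d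
    using that D(2) lip_functions_subset_test_functions by auto
  let ?B = "sup_ball 1 0 :: (real ^ 'n) set"
  have "0 \<in> ?B" by (simp add: mem_sup_ball infnorm_0)
  then have B: "compact ?B" "?B \<noteq> {}"
    using compact_sup_ball by auto
  note blip = bump_in_lip_functions[OF B]
  have bt: "bump ?B k \<in> test_functions" for k
    using blip lip_functions_subset_test_functions by auto
  define F where "F = (\<lambda>(d, a, k) x. d x - a * bump ?B k x)"
  define G where "G = F ` (D \<times> \<rat> \<times> UNIV)"
  have Glip: "G \<subseteq> lip_functions"
    using D(2) by (auto simp: G_def F_def intro!: lip_functions_diff lip_functions_cmult blip)
  let ?N = "sigma_sets normalized_measures (pos_set ` G)"
  interpret sigma_algebra normalized_measures ?N
    by (rule sigma_algebra_sigma_sets) (auto simp: pos_set_def)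
  have lower: "{\<mu> \<in> normalized_measures. a < (LINT x|\<mu>. d x)} \<in> ?N" if d: "d \<in> D" and a: "a \<in> \<rat>" for d a
  \<comment> \<open>The inclusion from right to left uses that \<open>a\<close> is at most
    \<open>a\<close> times the integral of a bump, which is at least 1; this is correct for
    nonnegative \<open>a\<close>. For negative \<open>a\<close> the condition always holds, since
    \<open>d\<close> is nonnegative.\<close>
  proof (cases "a < 0")
    case True
    have "0 \<le> (LINT x|\<mu>. d x)" for \<mu>
      using D(3)[OF d] by (simp add: integral_nonneg)
    then have "a < (LINT x|\<mu>. d x)" for \<mu>
      using True by (rule less_le_trans[rotated])
    then have "{\<mu> \<in> normalized_measures. a < (LINT x|\<mu>. d x)} = normalized_measures" by simp
    then show ?thesis by simp
  next
    case False
    have int: "(LINT x|\<mu>. d x - a * bump ?B k x) = (LINT x|\<mu>. d x) - a * (LINT x|\<mu>. bump ?B k x)"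
      if "\<mu> \<in> normalized_measures" for \<mu> k
      using integrable_test_function[OF normalized_measures_radon[OF that]] Dt[OF d] bt by simp
    have "{\<mu> \<in> normalized_measures. a < (LINT x|\<mu>. d x)} = (\<Union>k. pos_set (F (d, a, k)))"
    proof (intro equalityI subsetI)
      fix \<mu> assume "\<mu> \<in> {\<mu> \<in> normalized_measures. a < (LINT x|\<mu>. d x)}"
      then have \<mu>: "\<mu> \<in> normalized_measures" and *: "a < (LINT x|\<mu>. d x)" by auto
      have "(\<lambda>k. a * (LINT x|\<mu>. bump ?B k x)) \<longlonglongrightarrow> a * measure \<mu> ?B"
        by (intro tendsto_mult_left bump_integral_tendsto B normalized_measures_radon \<mu>)
      moreover have "a * measure \<mu> ?B < (LINT x|\<mu>. d x)"
        using * measure_unit_ball[OF \<mu>] by simp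
      ultimately have "\<forall>\<^sub>F k in sequentially. a * (LINT x|\<mu>. bump ?B k x) < (LINT x|\<mu>. d x)"
        by (rule order_tendstoD(2))
      then obtain k where "a * (LINT x|\<mu>. bump ?B k x) < (LINT x|\<mu>. d x)"
        using eventually_happens by force
      then show "\<mu> \<in> (\<Union>k. pos_set (F (d, a, k)))"
        using \<mu> by (auto simp: pos_set_def F_def int)
    next
      fix \<mu> assume "\<mu> \<in> (\<Union>k. pos_set (F (d, a, k)))"
      then obtain k where \<mu>: "\<mu> \<in> normalized_measures" and *: "a * (LINT x|\<mu>. bump ?B k x) < (LINT x|\<mu>. d x)"
        by (auto simp: pos_set_def F_def int)
      have "measure \<mu> ?B = (LINT x|\<mu>. indicator ?B x)"
        using normalized_measures_radon[OF \<mu>] by (simp add: radon_measures_def)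
      also have "\<dots> \<le> (LINT x|\<mu>. bump ?B k x)"
      proof (rule integral_mono)
        show "integrable \<mu> (bump ?B k)"
          using integrable_test_function[OF normalized_measures_radon[OF \<mu>] bt] .
        show "integrable \<mu> (indicator ?B :: _ \<Rightarrow> real)"
          using normalized_measures_radon[OF \<mu>] B(1) by (auto simp: radon_measures_def)
      qed (auto simp: bump_bounds split: split_indicator)
      finally have "a * 1 \<le> a * (LINT x|\<mu>. bump ?B k x)"
        using False measure_unit_ball[OF \<mu>] by (intro mult_left_mono) auto
      then show "\<mu> \<in> {\<mu> \<in> normalized_measures. a < (LINT x|\<mu>. d x)}" using \<mu> * by auto
    qed
    also have "\<dots> \<in> ?N"
      using d a by (intro countable_nat_UN) (auto simp: G_def)
    finally show ?thesis .
  qed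
  have upper: "{\<mu> \<in> normalized_measures. (LINT x|\<mu>. d x) < a} \<in> ?N" if d: "d \<in> D" for d a
  proof -
    have "{\<mu> \<in> normalized_measures. (LINT x|\<mu>. d x) < a} =
      (\<Union>q\<in>{q\<in>\<rat>. q < a}. normalized_measures - {\<mu> \<in> normalized_measures. q < (LINT x|\<mu>. d x)})"
    proof (intro equalityI subsetI)
      fix \<mu> assume \<mu>: "\<mu> \<in> {\<mu> \<in> normalized_measures. (LINT x|\<mu>. d x) < a}"
      then obtain q where "q \<in> \<rat>" "(LINT x|\<mu>. d x) < q" "q < a"
        using Rats_dense_in_real[of "LINT x|\<mu>. d x" a] by auto
      then show "\<mu> \<in> (\<Union>q\<in>{q\<in>\<rat>. q < a}. normalized_measures - {\<mu> \<in> normalized_measures. q < (LINT x|\<mu>. d x)})"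
        using \<mu> by (intro UN_I[of q]) auto
    qed auto
    also have "\<dots> \<in> ?N"
    proof (rule countable_UN'')
      show "countable {q \<in> \<rat>. q < a}"
        using countable_rat by (rule countable_subset[rotated]) auto
    qed (use lower[OF d] in blast)
    finally show ?thesis .
  qed
  show thesis
  proof (rule that[of G])
    show "countable G"
      unfolding G_def using D(1) by (intro countable_image countable_SIGMA countable_rat) auto
    \<comment> \<open>The subbasic sets live on \<open>radon_measures\<close>; the sigma-algebra
      they generate is traced on \<open>normalized_measures\<close>.\<close>
    have inter: "V \<inter> normalized_measures \<in> ?N" if "V \<in> sigma_sets radon_measures (evaluation_sets D)" for V
      using that
    proof induction
      case (Basic V)
      have *: "{\<mu> \<in> radon_measures. p \<mu>} \<inter> normalized_measures = {\<mu> \<in> normalized_measures. p \<mu>}" for p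
        using normalized_measures_radon by auto
      show ?case
        using Basic unfolding evaluation_sets_def by (elim UnE imageE) (auto simp only: * lower upper split: prod.splits)
    next
      case (Compl V)
      have "(radon_measures - V) \<inter> normalized_measures = normalized_measures - V \<inter> normalized_measures"
        using normalized_measures_radon by auto
      then show ?case using Compl by auto
    next
      case (Union V)
      have *: "\<Union> (range V) \<inter> normalized_measures = (\<Union>i. V i \<inter> normalized_measures)" by auto
      show ?case unfolding * using Union.IH by (intro countable_nat_UN) auto
    qed simp
    have cev: "countable (evaluation_sets D)"
      unfolding evaluation_sets_def using D(1) by (intro countable_Un countable_image countable_SIGMA countable_rat)
    show "sets normalized_space = ?N"
      unfolding sets_normalized_space_eq
    proof (intro sigma_sets_eqI)
      fix U :: "(real ^ 'n) measure set" assume "U \<in> {U. openin (subtopology radon_topology normalized_measures) U}"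
      then obtain V where V: "openin radon_topology V" "U = V \<inter> normalized_measures"
        by (auto simp: openin_subtopology)
      have "V \<in> sigma_sets radon_measures (evaluation_sets D)"
        by (rule countable_generated_topology_sigma[OF cev gen[OF V(1)]]) (auto simp: evaluation_sets_def)
      then show "U \<in> ?N" using inter V(2) by auto
    next
      fix U :: "(real ^ 'n) measure set" assume "U \<in> pos_set ` G"
      then obtain f where f: "f \<in> G" "U = pos_set f" by auto
      then have "f \<in> test_functions" using Glip lip_functions_subset_test_functions by auto
      from eval_in_sets[OF this, of "{0<..}"] f(2)
      show "U \<in> sigma_sets normalized_measures {U. openin (subtopology radon_topology normalized_measures) U}"
        unfolding sets_normalized_space_eq by (simp add: pos_set_def)
    qed
  qed (rule Glip)
qed

lemma measurable_normalized_spaceI: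
  fixes F :: "'a \<Rightarrow> (real ^ 'n) measure"
  assumes "\<And>\<omega>. \<omega> \<in> space M \<Longrightarrow> F \<omega> \<in> normalized_measures"
    and "\<And>f. f \<in> lip_functions \<Longrightarrow> (\<lambda>\<omega>. LINT x|F \<omega>. f x) \<in> borel_measurable M"
  shows "F \<in> M \<rightarrow>\<^sub>M normalized_space"
proof -
  obtain G :: "(real ^ 'n \<Rightarrow> real) set" where G: "countable G" "G \<subseteq> lip_functions"
    "sets normalized_space = sigma_sets normalized_measures (pos_set ` G)"
    using normalized_space_generator .
  show ?thesis
  proof (rule measurable_sigma_sets[OF G(3)])
    fix A assume "A \<in> pos_set ` G"
    then obtain f where f: "f \<in> lip_functions" "A = pos_set f" using G by auto
    have "F -` A \<inter> space M = {\<omega> \<in> space M. 0 < (LINT x|F \<omega>. f x)}"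
      using assms(1) f(2) by (auto simp: pos_set_def)
    then show "F -` A \<inter> space M \<in> sets M"
      using assms(2)[OF f(1)] by simp
  qed (use assms(1) in \<open>auto simp: pos_set_def\<close>)
qed

lemma measurable_emeasure_compact:
  fixes C :: "(real ^ 'n) set"
  assumes "compact C"
  shows "(\<lambda>\<mu>. emeasure \<mu> C) \<in> borel_measurable normalized_space"
proof (cases "C = {}")
  case False
  have "(\<lambda>\<mu>. measure \<mu> C) \<in> borel_measurable normalized_space"
  proof (rule borel_measurable_LIMSEQ_real)
    show "(\<lambda>k. LINT x|\<mu>. bump C k x) \<longlonglongrightarrow> measure \<mu> C" if "\<mu> \<in> space normalized_space" for \<mu>
      using that by (intro bump_integral_tendsto assms False) (simp add: normalized_measures_radon)
    show "(\<lambda>\<mu>. LINT x|\<mu>. bump C k x) \<in> borel_measurable normalized_space" for k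
      using bump_in_lip_functions[OF assms False] lip_functions_subset_test_functions
      by (intro borel_measurable_eval) auto
  qed
  then have "(\<lambda>\<mu>. ennreal (measure \<mu> C)) \<in> borel_measurable normalized_space" by simp
  then show ?thesis
  proof (rule measurable_cong[THEN iffD1, rotated])
    fix \<mu> :: "(real ^ 'n) measure" assume "\<mu> \<in> space normalized_space"
    then have "emeasure \<mu> C < \<infinity>"
      using assms by (auto simp: normalized_measures_def radon_measures_def)
    then show "ennreal (measure \<mu> C) = emeasure \<mu> C"
      by (simp add: emeasure_eq_ennreal_measure)
  qed
qed simp

subsection \<open>Normalized affine images of measures\<close>

lemma radon_sets: "\<mu> \<in> radon_measures \<Longrightarrow> sets \<mu> = sets borel"
  by (simp add: radon_measures_def)

lemma radon_space: "\<mu> \<in> radon_measures \<Longrightarrow> space \<mu> = UNIV"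
  using sets_eq_imp_space_eq[OF radon_sets] by simp

lemma radon_measurable: "\<mu> \<in> radon_measures \<Longrightarrow> f \<in> borel \<rightarrow>\<^sub>M N \<Longrightarrow> f \<in> \<mu> \<rightarrow>\<^sub>M N"
  using measurable_cong_sets[OF radon_sets refl] by blast

lemma borel_measurable_affine_map: "(\<lambda>y :: real ^ 'n. a *\<^sub>R (y - x)) \<in> borel_measurable borel"
  by (intro borel_measurable_continuous_onI continuous_intros)

lemma radon_sup_ball_finite: "\<mu> \<in> radon_measures \<Longrightarrow> emeasure \<mu> (sup_ball r x) < \<infinity>"
  using compact_sup_ball by (auto simp: radon_measures_def)

section \<open>Measurable dependence of integrals on a locally finite measure\<close>

lemma normalized_sup_ball_pos:
  assumes "\<mu> \<in> normalized_measures" "1 \<le> r"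
  shows "0 < emeasure \<mu> (sup_ball r 0)"
proof -
  have "1 = emeasure \<mu> (sup_ball 1 0)" using assms(1) by (simp add: normalized_measures_def)
  also have "\<dots> \<le> emeasure \<mu> (sup_ball r 0)"
    using radon_sets[OF normalized_measures_radon[OF assms(1)]] sup_ball_mono[OF assms(2)]
    by (intro emeasure_mono) (auto simp: sup_ball_borel)
  finally show ?thesis by (rule less_le_trans[OF zero_less_one])
qed

text \<open>The mass of the ball is positive because of \<mu>(B_1) = 1 and R \<ge> 1. Closed sets
  are the generator of choice because their intersections with the ball are compact, where the mass
  is a limit of integrals of bumps.\<close>

lemma ball_kernel:
  assumes "1 \<le> R"
  shows "(\<lambda>\<mu>. uniform_measure \<mu> (sup_ball R 0)) \<in> normalized_space \<rightarrow>\<^sub>M prob_algebra (borel :: (real ^ 'n) measure)"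
proof (rule measurable_prob_algebra_generated[where \<Omega>=UNIV and G="Collect closed"])
  show "sets (borel :: (real ^ 'n) measure) = sigma_sets UNIV (Collect closed)"
    by (subst borel_eq_closed) simp
  show "Int_stable (Collect closed :: (real ^ 'n) set set)"
    by (auto simp: Int_stable_def)
  fix \<mu> :: "(real ^ 'n) measure" assume "\<mu> \<in> space normalized_space"
  then have \<mu>: "\<mu> \<in> normalized_measures" by simp
  show "prob_space (uniform_measure \<mu> (sup_ball R 0))"
    using normalized_sup_ball_pos[OF \<mu> assms] radon_sup_ball_finite[OF normalized_measures_radon[OF \<mu>]]
    by (intro prob_space_uniform_measure) (auto simp: less_top[symmetric])
  show "sets (uniform_measure \<mu> (sup_ball R 0)) = sets borel"
    using radon_sets[OF normalized_measures_radon[OF \<mu>]] by simp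
next
  fix C :: "(real ^ 'n) set" assume "C \<in> Collect closed"
  then have C: "closed C" by simp
  have "(\<lambda>\<mu>. emeasure \<mu> (sup_ball R 0 \<inter> C) / emeasure \<mu> (sup_ball R 0)) \<in> borel_measurable normalized_space"
    using C by (intro borel_measurable_divide_ennreal measurable_emeasure_compact compact_sup_ball compact_Int_closed)
  then show "(\<lambda>\<mu>. emeasure (uniform_measure \<mu> (sup_ball R 0)) C) \<in> borel_measurable normalized_space"
  proof (rule measurable_cong[THEN iffD1, rotated])
    fix \<mu> :: "(real ^ 'n) measure" assume "\<mu> \<in> space normalized_space"
    then have "sets \<mu> = sets borel" by (simp add: radon_sets normalized_measures_radon)
    then show "emeasure \<mu> (sup_ball R 0 \<inter> C) / emeasure \<mu> (sup_ball R 0) = emeasure (uniform_measure \<mu> (sup_ball R 0)) C"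
      using C by (subst emeasure_uniform_measure) (auto simp: sup_ball_borel)
  qed
qed simp

text \<open>Writes integration against a possibly infinite measure as a supremum of multiples of
  integrals against probability measures; the radii start at 1 so that all of these are
  defined.\<close>

lemma nn_integral_sup_balls:
  assumes \<mu>: "\<mu> \<in> normalized_measures" and f: "f \<in> borel_measurable borel"
  shows "(\<integral>\<^sup>+x. f x \<partial>\<mu>) = (SUP n. emeasure \<mu> (sup_ball (real (Suc n)) 0) *
    (\<integral>\<^sup>+x. f x \<partial>uniform_measure \<mu> (sup_ball (real (Suc n)) 0)))"
proof -
  let ?B = "\<lambda>n. sup_ball (real (Suc n)) 0"
  note sets = radon_sets[OF normalized_measures_radon[OF \<mu>]]
  have [measurable]: "f \<in> borel_measurable \<mu>" "?B n \<in> sets \<mu>" for n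
    using f measurable_cong_sets[OF sets refl] by (auto simp: sets sup_ball_borel)
  have *: "(\<integral>\<^sup>+x. f x * indicator (?B n) x \<partial>\<mu>) = emeasure \<mu> (?B n) * (\<integral>\<^sup>+x. f x \<partial>uniform_measure \<mu> (?B n))" for n
  proof -
    have "0 < emeasure \<mu> (?B n)" "emeasure \<mu> (?B n) < \<infinity>"
      using normalized_sup_ball_pos[OF \<mu>, of "real (Suc n)"] radon_sup_ball_finite[OF normalized_measures_radon[OF \<mu>]] by auto
    then have "emeasure \<mu> (?B n) * (X / emeasure \<mu> (?B n)) = X" for X
      using mult_divide_eq_ennreal[of "emeasure \<mu> (?B n)" X] by (simp add: ennreal_times_divide mult.commute)
    then show ?thesis
      by (subst nn_integral_uniform_measure) (simp_all del: of_nat_Suc)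
  qed
  have "(SUP n. f x * indicator (?B n) x) = f x" for x
  proof (rule antisym)
    show "(SUP n. f x * indicator (?B n) x) \<le> f x"
      by (auto intro!: SUP_least split: split_indicator)
    obtain n where "infnorm x \<le> real n" using real_arch_simple by blast
    then have "x \<in> ?B n" by (simp add: mem_sup_ball)
    then show "f x \<le> (SUP n. f x * indicator (?B n) x)"
      by (intro SUP_upper2[of n]) auto
  qed
  then have "(\<integral>\<^sup>+x. f x \<partial>\<mu>) = (\<integral>\<^sup>+x. (SUP n. f x * indicator (?B n) x) \<partial>\<mu>)" by simp
  also have "\<dots> = (SUP n. \<integral>\<^sup>+x. f x * indicator (?B n) x \<partial>\<mu>)"
  proof (rule nn_integral_monotone_convergence_SUP)
    show "incseq (\<lambda>n x. f x * indicator (?B n) x)"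
      by (auto simp: incseq_def le_fun_def mem_sup_ball split: split_indicator)
  qed measurable
  also have "\<dots> = (SUP n. emeasure \<mu> (?B n) * (\<integral>\<^sup>+x. f x \<partial>uniform_measure \<mu> (?B n)))"
    by (simp only: *)
  finally show ?thesis .
qed

text \<open>The measurability theorem for subprobability kernels applies to each term of the
  supremum over balls, though not to \<open>g\<close> itself, whose values may be infinite
  measures.\<close>

lemma measurable_nn_integral_kernel:
  fixes g :: "'a \<Rightarrow> (real ^ 'n) measure" and f :: "'a \<Rightarrow> real ^ 'n \<Rightarrow> ennreal"
  assumes g[measurable]: "g \<in> M \<rightarrow>\<^sub>M normalized_space"
    and f[measurable]: "case_prod f \<in> borel_measurable (M \<Otimes>\<^sub>M borel)"
  shows "(\<lambda>\<omega>. \<integral>\<^sup>+x. f \<omega> x \<partial>g \<omega>) \<in> borel_measurable M"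
proof -
  let ?B = "\<lambda>n. sup_ball (real (Suc n)) (0 :: real ^ 'n)"
  have k: "(\<lambda>\<omega>. uniform_measure (g \<omega>) (?B n)) \<in> M \<rightarrow>\<^sub>M subprob_algebra borel" for n
    by (rule measurable_prob_algebraD) (rule measurable_compose[OF g ball_kernel], simp)
  have [measurable]: "(\<lambda>\<omega>. \<integral>\<^sup>+x. f \<omega> x \<partial>uniform_measure (g \<omega>) (?B n)) \<in> borel_measurable M" for n
    using f by (intro nn_integral_measurable_subprob_algebra2[OF _ k]) simp
  have [measurable]: "(\<lambda>\<omega>. emeasure (g \<omega>) (?B n)) \<in> borel_measurable M" for n
    by (rule measurable_compose[OF g measurable_emeasure_compact]) (rule compact_sup_ball)
  have "(\<lambda>\<omega>. SUP n. emeasure (g \<omega>) (?B n) * (\<integral>\<^sup>+x. f \<omega> x \<partial>uniform_measure (g \<omega>) (?B n))) \<in> borel_measurable M"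
    by measurable
  then show ?thesis
  proof (rule measurable_cong[THEN iffD1, rotated])
    fix \<omega> assume \<omega>: "\<omega> \<in> space M"
    have "f \<omega> \<in> borel_measurable borel"
      using measurable_compose[OF measurable_Pair1'[OF \<omega>] f] by simp
    then show "(SUP n. emeasure (g \<omega>) (?B n) * (\<integral>\<^sup>+x. f \<omega> x \<partial>uniform_measure (g \<omega>) (?B n))) = (\<integral>\<^sup>+x. f \<omega> x \<partial>g \<omega>)"
      using measurable_space[OF g \<omega>] by (intro nn_integral_sup_balls[symmetric]) auto
  qed
qed

lemma measurable_emeasure_kernel:
  fixes g :: "'a \<Rightarrow> (real ^ 'n) measure"
  assumes g: "g \<in> M \<rightarrow>\<^sub>M normalized_space"
    and p: "Measurable.pred (M \<Otimes>\<^sub>M borel) (\<lambda>(\<omega>, x). p \<omega> x)"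
  shows "(\<lambda>\<omega>. emeasure (g \<omega>) {x. p \<omega> x}) \<in> borel_measurable M"
proof -
  have "(\<lambda>\<omega>. \<integral>\<^sup>+x. (if p \<omega> x then 1 else 0) \<partial>g \<omega>) \<in> borel_measurable M"
  proof (rule measurable_nn_integral_kernel[OF g])
    show "(\<lambda>(\<omega>, x). if p \<omega> x then 1 else 0 :: ennreal) \<in> borel_measurable (M \<Otimes>\<^sub>M borel)"
      using p by (simp add: case_prod_beta')
  qed
  then show ?thesis
  proof (rule measurable_cong[THEN iffD1, rotated])
    fix \<omega> assume \<omega>: "\<omega> \<in> space M"
    have "Measurable.pred borel (p \<omega>)"
      using measurable_compose[OF measurable_Pair1'[OF \<omega>] p] by simp
    then have "{x. p \<omega> x} \<in> sets borel" by (simp add: pred_def)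
    then have "{x. p \<omega> x} \<in> sets (g \<omega>)"
      using measurable_space[OF g \<omega>] by (simp add: radon_sets normalized_measures_radon)
    then have "(\<integral>\<^sup>+x. indicator {x. p \<omega> x} x \<partial>g \<omega>) = emeasure (g \<omega>) {x. p \<omega> x}" by simp
    moreover have "indicator {x. p \<omega> x} = (\<lambda>x. if p \<omega> x then 1 else 0 :: ennreal)" by (auto split: split_indicator)
    ultimately show "(\<integral>\<^sup>+x. (if p \<omega> x then 1 else 0) \<partial>g \<omega>) = emeasure (g \<omega>) {x. p \<omega> x}" by simp
  qed
qed

text \<open>One family containing T_x^* (\<open>a = 1\<close>) and S_t^* (\<open>a = exp t\<close>,
  \<open>x = 0\<close>) and closed under composition.\<close>

definition renorm :: "real \<Rightarrow> real ^ 'n \<Rightarrow> (real ^ 'n) measure \<Rightarrow> (real ^ 'n) measure" where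
  "renorm a x \<mu> = star (distr \<mu> borel (\<lambda>y. a *\<^sub>R (y - x)))"

lemma translate_star_renorm: "translate_star x = renorm 1 x"
  by (simp add: fun_eq_iff translate_star_def renorm_def)

lemma scale_star_renorm: "scale_star t = renorm (exp t) 0"
  by (simp add: fun_eq_iff scale_star_def renorm_def)

lemma affine_vimage_sup_ball: "0 < a \<Longrightarrow> {y. a *\<^sub>R (y - x) \<in> sup_ball r z} = sup_ball (r / a) (x + z /\<^sub>R a)"
proof -
  assume a: "0 < a"
  have "a *\<^sub>R (y - x) - z = a *\<^sub>R (y - (x + z /\<^sub>R a))" for y
    using a by (simp add: algebra_simps)
  then have "infnorm (a *\<^sub>R (y - x) - z) = a * infnorm (y - (x + z /\<^sub>R a))" for y
    using a by (simp only: infnorm_mul abs_of_pos)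
  then show ?thesis
    using a by (simp add: mem_sup_ball set_eq_iff pos_le_divide_eq mult.commute)
qed

lemma affine_vimage_compact:
  fixes K :: "(real ^ 'n) set"
  assumes "0 < a" "compact K" shows "compact {y. a *\<^sub>R (y - x) \<in> K}"
proof -
  have "{y. a *\<^sub>R (y - x) \<in> K} = (\<lambda>z. x + (1 / a) *\<^sub>R z) ` K"
  proof (intro equalityI subsetI)
    fix y assume "y \<in> {y. a *\<^sub>R (y - x) \<in> K}"
    then show "y \<in> (\<lambda>z. x + (1 / a) *\<^sub>R z) ` K"
      using assms(1) by (intro image_eqI[of _ _ "a *\<^sub>R (y - x)"]) auto
  qed (use assms(1) in auto)
  then show ?thesis using compact_affinity[OF assms(2)] by simp
qed

lemma sets_renorm [simp]: "sets (renorm a x \<mu>) = sets borel"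
  by (simp add: renorm_def star_def)

lemma affine_vimage_borel: "B \<in> sets borel \<Longrightarrow> {y :: real ^ 'n. a *\<^sub>R (y - x) \<in> B} \<in> sets borel"
  using measurable_sets[OF borel_measurable_affine_map, of B a x] by (simp add: vimage_def)

lemma emeasure_distr_affine:
  assumes "\<mu> \<in> radon_measures" "B \<in> sets borel"
  shows "emeasure (distr \<mu> borel (\<lambda>y. a *\<^sub>R (y - x))) B = emeasure \<mu> {y. a *\<^sub>R (y - x) \<in> B}"
proof -
  have "(\<lambda>y. a *\<^sub>R (y - x)) \<in> \<mu> \<rightarrow>\<^sub>M borel"
    by (rule radon_measurable[OF assms(1) borel_measurable_affine_map])
  then show ?thesis
    using assms by (subst emeasure_distr) (auto simp: radon_space vimage_def)
qed

lemma emeasure_renorm: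
  assumes "\<mu> \<in> radon_measures" "B \<in> sets borel" "0 < a"
  shows "emeasure (renorm a x \<mu>) B = emeasure \<mu> {y. a *\<^sub>R (y - x) \<in> B} / emeasure \<mu> (sup_ball (1 / a) x)"
  using emeasure_distr_affine[OF assms(1,2)] emeasure_distr_affine[OF assms(1) sup_ball_borel, of a x 1 0] assms(3)
  by (simp add: renorm_def star_def affine_vimage_sup_ball divide_ennreal_def mult.commute)

lemma renorm_normalized:
  assumes \<mu>: "\<mu> \<in> radon_measures" and "0 < a" "0 < emeasure \<mu> (sup_ball (1 / a) x)"
  shows "renorm a x \<mu> \<in> normalized_measures"
proof -
  have fin: "emeasure \<mu> (sup_ball (1 / a) x) < \<infinity>" by (rule radon_sup_ball_finite[OF \<mu>])
  have "emeasure (renorm a x \<mu>) K < \<infinity>" if "compact K" for K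
  proof -
    have "emeasure \<mu> {y. a *\<^sub>R (y - x) \<in> K} < \<infinity>"
      using \<mu> affine_vimage_compact[OF assms(2) that] by (auto simp: radon_measures_def)
    then show ?thesis
      using emeasure_renorm[OF \<mu> _ assms(2)] assms(3) that
      by (auto simp: compact_imp_closed ennreal_divide_eq_top_iff less_top[symmetric])
  qed
  moreover have "emeasure (renorm a x \<mu>) (sup_ball 1 0) = 1"
    using emeasure_renorm[OF \<mu> sup_ball_borel assms(2)] assms fin
    by (simp add: affine_vimage_sup_ball)
  ultimately show ?thesis
    by (simp add: normalized_measures_def radon_measures_def)
qed

text \<open>\<open>star\<close> forgets constant factors: the inner normalization, positive and
  finite, cancels. Applied in both orders this gives the commutation of S_t^* with translations, the
  vector x turning into e^t x.\<close>

lemma renorm_renorm: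
  assumes \<mu>: "\<mu> \<in> radon_measures" and ab: "0 < a" "0 < b" and pos: "0 < emeasure \<mu> (sup_ball (1 / b) z)"
  shows "renorm a x (renorm b z \<mu>) = renorm (a * b) (z + x /\<^sub>R b) \<mu>"
proof (rule measure_eqI)
  fix B assume "B \<in> sets (renorm a x (renorm b z \<mu>))"
  then have B: "B \<in> sets borel" by simp
  let ?c = "emeasure \<mu> (sup_ball (1 / b) z)"
  have c: "?c \<noteq> 0" "?c \<noteq> \<infinity>" using pos radon_sup_ball_finite[OF \<mu>] by (auto simp: less_top[symmetric])
  have cancel: "(m / ?c) / (n / ?c) = m / n" for m n
    using divide_mult_eq[of "inverse ?c" m n] c unfolding divide_ennreal_def by auto
  have r: "renorm b z \<mu> \<in> radon_measures"
    using renorm_normalized[OF \<mu> ab(2) pos] by (rule normalized_measures_radon)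
  have *: "b *\<^sub>R (y - z) - x = b *\<^sub>R (y - (z + x /\<^sub>R b))" for y
    using ab by (simp add: algebra_simps)
  have "emeasure (renorm a x (renorm b z \<mu>)) B = emeasure (renorm b z \<mu>) {y. a *\<^sub>R (y - x) \<in> B} / emeasure (renorm b z \<mu>) (sup_ball (1 / a) x)"
    by (rule emeasure_renorm[OF r B ab(1)])
  also have "emeasure (renorm b z \<mu>) {y. a *\<^sub>R (y - x) \<in> B} = emeasure \<mu> {y. a *\<^sub>R (b *\<^sub>R (y - z) - x) \<in> B} / ?c"
    by (subst emeasure_renorm[OF \<mu> affine_vimage_borel[OF B] ab(2)]) simp
  also have "emeasure (renorm b z \<mu>) (sup_ball (1 / a) x) = emeasure \<mu> (sup_ball (1 / (a * b)) (z + x /\<^sub>R b)) / ?c"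
    by (subst emeasure_renorm[OF \<mu> sup_ball_borel ab(2)]) (use ab in \<open>simp add: affine_vimage_sup_ball mult.commute\<close>)
  finally show "emeasure (renorm a x (renorm b z \<mu>)) B = emeasure (renorm (a * b) (z + x /\<^sub>R b) \<mu>) B"
    using emeasure_renorm[OF \<mu> B, of "a * b" "z + x /\<^sub>R b"] ab by (simp add: cancel *)
qed simp

lemma scale_measure_density: "scale_measure r M = density M (\<lambda>_. r)"
  by (rule measure_eqI) (auto simp: emeasure_density_const)

lemma integral_renorm:
  assumes \<mu>: "\<mu> \<in> radon_measures" and a: "0 < a" and pos: "0 < emeasure \<mu> (sup_ball (1 / a) x)"
    and f: "f \<in> borel_measurable borel"
  shows "(LINT y|renorm a x \<mu>. f y :: real) = (LINT y|\<mu>. f (a *\<^sub>R (y - x))) / measure \<mu> (sup_ball (1 / a) x)"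
proof -
  let ?c = "measure \<mu> (sup_ball (1 / a) x)"
  have c: "emeasure \<mu> (sup_ball (1 / a) x) = ennreal ?c"
    using radon_sup_ball_finite[OF \<mu>, of "1 / a" x] by (intro emeasure_eq_ennreal_measure) auto
  then have "0 < ?c" using pos by simp
  then have inv: "inverse (ennreal ?c) = ennreal (1 / ?c)"
    by (simp add: inverse_ennreal inverse_eq_divide)
  have m: "(\<lambda>y. a *\<^sub>R (y - x)) \<in> \<mu> \<rightarrow>\<^sub>M borel"
    by (rule radon_measurable[OF \<mu> borel_measurable_affine_map])
  let ?d = "distr \<mu> borel (\<lambda>y. a *\<^sub>R (y - x))"
  have "renorm a x \<mu> = density ?d (\<lambda>_. ennreal (1 / ?c))"
    using emeasure_distr_affine[OF \<mu> sup_ball_borel, of a x 1 0] a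
    by (simp add: renorm_def star_def affine_vimage_sup_ball scale_measure_density c inv)
  then have "(LINT y|renorm a x \<mu>. f y) = (LINT y|?d. (1 / ?c) * f y)"
    using f by (simp add: integral_real_density)
  also have "\<dots> = (LINT y|?d. f y) / ?c" by simp
  also have "(LINT y|?d. f y) = (LINT y|\<mu>. f (a *\<^sub>R (y - x)))"
    by (rule integral_distr[OF m f])
  finally show ?thesis .
qed

section \<open>Supports\<close>

lemma supp_sup_ball_pos:
  assumes "\<mu> \<in> radon_measures" "x \<in> supp \<mu>" "0 < r"
  shows "0 < emeasure \<mu> (sup_ball r x)"
proof -
  have "0 < emeasure \<mu> (ball x r)" using assms by (auto simp: supp_def)
  also have "\<dots> \<le> emeasure \<mu> (sup_ball r x)"
    using cball_subset_sup_ball[of x r] assms(1) by (intro emeasure_mono) (auto simp: radon_sets sup_ball_borel)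
  finally show ?thesis .
qed

text \<open>Countably many closed balls replace all open neighborhoods, so that the relation becomes
  measurable in the pair of measure and point.\<close>

lemma supp_iff:
  fixes \<mu> :: "(real ^ 'n) measure"
  assumes \<mu>: "\<mu> \<in> radon_measures"
  shows "x \<in> supp \<mu> \<longleftrightarrow> (\<forall>n. 0 < emeasure \<mu> (sup_ball (1 / real (Suc n)) x))"
proof
  assume R: "\<forall>n. 0 < emeasure \<mu> (sup_ball (1 / real (Suc n)) x)"
  show "x \<in> supp \<mu>"
    unfolding supp_def
  proof (intro CollectI allI impI)
    fix U :: "(real ^ 'n) set" assume "open U" "x \<in> U"
    then obtain e where e: "e > 0" "cball x e \<subseteq> U" by (meson open_contains_cball)
    \<comment> \<open>The factor by which the Euclidean norm may exceed the sup-norm.\<close>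
    let ?d = "sqrt (real DIM(real ^ 'n))"
    have d: "0 < ?d" by simp
    obtain n where "?d / e < real (Suc n)"
      using reals_Archimedean2 by (metis lessI less_trans of_nat_less_iff)
    then have "?d * (1 / real (Suc n)) \<le> e" using e d by (simp add: field_simps)
    then have "sup_ball (1 / real (Suc n)) x \<subseteq> U"
      using sup_ball_subset_cball[of "1 / real (Suc n)" x] e(2) by (meson order_trans subset_cball)
    then have "emeasure \<mu> (sup_ball (1 / real (Suc n)) x) \<le> emeasure \<mu> U"
      using \<open>open U\<close> by (intro emeasure_mono) (auto simp: radon_sets[OF \<mu>])
    then show "0 < emeasure \<mu> U" using R by (metis less_le_trans)
  qed
qed (auto intro: supp_sup_ball_pos[OF \<mu>])

lemma supp_renorm:
  fixes \<mu> :: "(real ^ 'n) measure"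
  assumes \<mu>: "\<mu> \<in> radon_measures" and a: "0 < a"
  shows "z \<in> supp (renorm a x \<mu>) \<longleftrightarrow> x + z /\<^sub>R a \<in> supp \<mu>"
proof -
  have fin: "emeasure \<mu> (sup_ball (1 / a) x) \<noteq> \<infinity>" 
    using radon_sup_ball_finite[OF \<mu>] by (auto simp: less_top[symmetric])
  have *: "0 < emeasure (renorm a x \<mu>) U \<longleftrightarrow> 0 < emeasure \<mu> {y. a *\<^sub>R (y - x) \<in> U}" if "open U" for U
    using emeasure_renorm[OF \<mu> _ a, of U x] that fin by (auto simp: zero_less_iff_neq_zero)
  show ?thesis
  proof
    assume L: "z \<in> supp (renorm a x \<mu>)"
    show "x + z /\<^sub>R a \<in> supp \<mu>"
      unfolding supp_def
    proof (intro CollectI allI impI)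
      fix V :: "(real ^ 'n) set" assume V: "open V" "x + z /\<^sub>R a \<in> V"
      let ?U = "(\<lambda>w. x + w /\<^sub>R a) -` V"
      have "open ?U" by (intro open_vimage V(1) continuous_intros)
      moreover have "z \<in> ?U" using V by simp
      ultimately have "0 < emeasure \<mu> {y. a *\<^sub>R (y - x) \<in> ?U}" using L * by (auto simp: supp_def)
      moreover have "{y. a *\<^sub>R (y - x) \<in> ?U} = V" using a by auto
      ultimately show "0 < emeasure \<mu> V" by simp
    qed
  next
    assume R: "x + z /\<^sub>R a \<in> supp \<mu>"
    show "z \<in> supp (renorm a x \<mu>)"
      unfolding supp_def
    proof (intro CollectI allI impI)
      fix U :: "(real ^ 'n) set" assume U: "open U" "z \<in> U"
      have "open ((\<lambda>y. a *\<^sub>R (y - x)) -` U)" by (intro open_vimage U(1) continuous_intros)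
      moreover have "x + z /\<^sub>R a \<in> ((\<lambda>y. a *\<^sub>R (y - x)) -` U)" using U a by simp
      ultimately have "0 < emeasure \<mu> ((\<lambda>y. a *\<^sub>R (y - x)) -` U)" using R by (auto simp: supp_def)
      then show "0 < emeasure (renorm a x \<mu>) U" using * U by (simp add: vimage_def)
    qed
  qed
qed

text \<open>Lindelof reduces the union of all open null sets to a countable one. This makes the
  points where T_x^* is undefined negligible.\<close>

lemma AE_supp:
  assumes \<mu>: "\<mu> \<in> radon_measures"
  shows "AE x in \<mu>. x \<in> supp \<mu>"
proof -
  let ?F = "{U. open U \<and> emeasure \<mu> U = 0}"
  obtain F' where F': "F' \<subseteq> ?F" "countable F'" "\<Union>F' = \<Union>?F"
    by (rule Lindelof[of ?F]) auto
  have "(\<Union>U\<in>F'. U) \<in> null_sets \<mu>"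
    using F' by (intro null_sets_UN') (auto simp: null_sets_def radon_sets[OF \<mu>])
  moreover have "- supp \<mu> = \<Union>?F" by (auto simp: supp_def zero_less_iff_neq_zero)
  ultimately have "- supp \<mu> \<in> null_sets \<mu>" using F' by simp
  then show ?thesis by (rule AE_I') auto
qed

section \<open>Joint measurability of renormalization in the measure and the point\<close>

lemma lip_functions_affine:
  fixes f :: "real ^ 'n \<Rightarrow> real"
  assumes f: "f \<in> lip_functions" and a: "0 < a"
  shows "(\<lambda>y. f (a *\<^sub>R (y - x))) \<in> lip_functions"
proof -
  obtain L where L: "L-lipschitz_on UNIV f" using f by (auto simp: lip_functions_def)
  have "(L * a)-lipschitz_on UNIV (\<lambda>y. f (a *\<^sub>R (y - x)))"
  proof (rule lipschitz_onI)
    fix y z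
    have "dist (f (a *\<^sub>R (y - x))) (f (a *\<^sub>R (z - x))) \<le> L * dist (a *\<^sub>R (y - x)) (a *\<^sub>R (z - x))"
      by (rule lipschitz_onD[OF L]) auto
    also have "dist (a *\<^sub>R (y - x)) (a *\<^sub>R (z - x)) = a * dist y z"
      using a by (simp add: dist_norm scaleR_diff_right[symmetric])
    finally show "dist (f (a *\<^sub>R (y - x))) (f (a *\<^sub>R (z - x))) \<le> L * a * dist y z" by (simp add: mult.assoc)
  qed (use a lipschitz_on_nonneg[OF L] in auto)
  moreover obtain R where R: "\<And>y. f y \<noteq> 0 \<Longrightarrow> norm y \<le> R"
    using f by (auto simp: lip_functions_def bounded_iff)
  have "bounded {y. f (a *\<^sub>R (y - x)) \<noteq> 0}"
  proof (rule bounded_subset[OF bounded_cball])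
    show "{y. f (a *\<^sub>R (y - x)) \<noteq> 0} \<subseteq> cball x (R / a)"
    proof
      fix y assume "y \<in> {y. f (a *\<^sub>R (y - x)) \<noteq> 0}"
      then have "norm (a *\<^sub>R (y - x)) \<le> R" using R by blast
      then have "a * norm (y - x) \<le> R" using a by (simp only: norm_scaleR abs_of_pos)
      then show "y \<in> cball x (R / a)"
        using a by (simp add: dist_norm norm_minus_commute pos_le_divide_eq mult.commute)
    qed
  qed
  ultimately show ?thesis by (auto simp: lip_functions_def)
qed

lemma lip_functions_borel: "f \<in> lip_functions \<Longrightarrow> f \<in> borel_measurable borel"
  by (auto simp: lip_functions_def intro: borel_measurable_continuous_onI lipschitz_on_continuous_on)

lemma lip_functions_integrable: "\<mu> \<in> radon_measures \<Longrightarrow> f \<in> lip_functions \<Longrightarrow> integrable \<mu> f"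
  using integrable_test_function lip_functions_subset_test_functions by blast

text \<open>The value outside the domain of \<open>renorm a x\<close> is arbitrary; it keeps the map total and measurable.\<close>

definition renorm_total :: "real \<Rightarrow> real ^ 'n \<Rightarrow> (real ^ 'n) measure \<Rightarrow> (real ^ 'n) measure" where
  "renorm_total a x \<mu> = (if 0 < emeasure \<mu> (sup_ball (1 / a) x) then renorm a x \<mu> else \<mu>)"

lemma renorm_total_normalized:
  "0 < a \<Longrightarrow> \<mu> \<in> normalized_measures \<Longrightarrow> renorm_total a x \<mu> \<in> normalized_measures"
  by (simp add: renorm_total_def renorm_normalized normalized_measures_radon)

lemma borel_measurable_infnorm: "(infnorm :: real ^ 'n \<Rightarrow> real) \<in> borel_measurable borel"
  by (intro borel_measurable_continuous_onI continuous_intros)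

lemma measurable_emeasure_sup_ball:
  "(\<lambda>(\<mu>, x :: real ^ 'n). emeasure \<mu> (sup_ball r x)) \<in> borel_measurable (normalized_space \<Otimes>\<^sub>M borel)"
proof -
  note [measurable] = borel_measurable_infnorm
  have "(\<lambda>\<omega> :: (real ^ 'n) measure \<times> (real ^ 'n). emeasure (fst \<omega>) {y. infnorm (y - snd \<omega>) \<le> r}) \<in> borel_measurable (normalized_space \<Otimes>\<^sub>M borel)"
    by (rule measurable_emeasure_kernel) measurable
  then show ?thesis by (simp add: sup_ball_def case_prod_beta')
qed

lemma measurable_integral_affine:
  fixes f :: "real ^ 'n \<Rightarrow> real"
  assumes f: "f \<in> lip_functions" and a: "0 < a"
  shows "(\<lambda>(\<mu>, x). LINT y|\<mu>. f (a *\<^sub>R (y - x))) \<in> borel_measurable (normalized_space \<Otimes>\<^sub>M borel)"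
proof -
  note [measurable] = lip_functions_borel[OF f]
  \<comment> \<open>The kernel lemma concerns nonnegative integrands, so positive and negative parts
    are treated apart.\<close>
  have [measurable]: "(\<lambda>\<omega> :: (real ^ 'n) measure \<times> (real ^ 'n). \<integral>\<^sup>+y. ennreal (f (a *\<^sub>R (y - snd \<omega>))) \<partial>fst \<omega>) \<in> borel_measurable (normalized_space \<Otimes>\<^sub>M borel)"
    "(\<lambda>\<omega> :: (real ^ 'n) measure \<times> (real ^ 'n). \<integral>\<^sup>+y. ennreal (- f (a *\<^sub>R (y - snd \<omega>))) \<partial>fst \<omega>) \<in> borel_measurable (normalized_space \<Otimes>\<^sub>M borel)"
    by (rule measurable_nn_integral_kernel; measurable)+
  have "(\<lambda>\<omega> :: (real ^ 'n) measure \<times> (real ^ 'n). enn2real (\<integral>\<^sup>+y. ennreal (f (a *\<^sub>R (y - snd \<omega>))) \<partial>fst \<omega>) -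
     enn2real (\<integral>\<^sup>+y. ennreal (- f (a *\<^sub>R (y - snd \<omega>))) \<partial>fst \<omega>)) \<in> borel_measurable (normalized_space \<Otimes>\<^sub>M borel)"
    by measurable
  then show ?thesis
  proof (rule measurable_cong[THEN iffD1, rotated])
    fix \<omega> :: "(real ^ 'n) measure \<times> (real ^ 'n)" assume "\<omega> \<in> space (normalized_space \<Otimes>\<^sub>M borel)"
    then have "fst \<omega> \<in> radon_measures" by (auto simp: space_pair_measure normalized_measures_radon)
    then have "integrable (fst \<omega>) (\<lambda>y. f (a *\<^sub>R (y - snd \<omega>)))"
      by (intro lip_functions_integrable lip_functions_affine f a)
    then show "enn2real (\<integral>\<^sup>+y. ennreal (f (a *\<^sub>R (y - snd \<omega>))) \<partial>fst \<omega>) -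
     enn2real (\<integral>\<^sup>+y. ennreal (- f (a *\<^sub>R (y - snd \<omega>))) \<partial>fst \<omega>) = (case \<omega> of (\<mu>, x) \<Rightarrow> LINT y|\<mu>. f (a *\<^sub>R (y - x)))"
      by (simp add: real_lebesgue_integral_def case_prod_beta')
  qed
qed

text \<open>By \<open>integral_renorm\<close>, integrals against the image are quotients of jointly
  measurable functions wherever \<open>renorm a x\<close> is defined, and it suffices to know the
  integrals of Lipschitz functions.\<close>

lemma measurable_renorm_total:
  assumes a: "0 < a"
  shows "(\<lambda>(\<mu>, x :: real ^ 'n). renorm_total a x \<mu>) \<in> normalized_space \<Otimes>\<^sub>M borel \<rightarrow>\<^sub>M normalized_space"
proof (rule measurable_normalized_spaceI)
  fix \<omega> :: "(real ^ 'n) measure \<times> (real ^ 'n)" assume "\<omega> \<in> space (normalized_space \<Otimes>\<^sub>M borel)"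
  then show "(case \<omega> of (\<mu>, x) \<Rightarrow> renorm_total a x \<mu>) \<in> normalized_measures"
    using renorm_total_normalized[OF a] by (auto simp: space_pair_measure)
next
  fix f :: "real ^ 'n \<Rightarrow> real" assume f: "f \<in> lip_functions"
  have [measurable]: "(\<lambda>\<omega> :: (real ^ 'n) measure \<times> (real ^ 'n). emeasure (fst \<omega>) (sup_ball (1 / a) (snd \<omega>))) \<in> borel_measurable (normalized_space \<Otimes>\<^sub>M borel)"
    using measurable_emeasure_sup_ball by (simp add: case_prod_beta')
  have [measurable]: "(\<lambda>\<omega>. LINT y|fst \<omega>. f (a *\<^sub>R (y - snd \<omega>))) \<in> borel_measurable (normalized_space \<Otimes>\<^sub>M borel)"
    using measurable_integral_affine[OF f a] by (simp add: case_prod_beta')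
  have [measurable]: "(\<lambda>\<mu>. LINT y|\<mu>. f y) \<in> borel_measurable normalized_space"
    using f lip_functions_subset_test_functions by (intro borel_measurable_eval) auto
  have "(\<lambda>\<omega> :: (real ^ 'n) measure \<times> (real ^ 'n). if 0 < emeasure (fst \<omega>) (sup_ball (1 / a) (snd \<omega>))
     then (LINT y|fst \<omega>. f (a *\<^sub>R (y - snd \<omega>))) / enn2real (emeasure (fst \<omega>) (sup_ball (1 / a) (snd \<omega>)))
     else (LINT y|fst \<omega>. f y)) \<in> borel_measurable (normalized_space \<Otimes>\<^sub>M borel)"
    by measurable
  then show "(\<lambda>\<omega>. LINT y|(case \<omega> of (\<mu>, x) \<Rightarrow> renorm_total a x \<mu>). f y) \<in> borel_measurable (normalized_space \<Otimes>\<^sub>M borel)"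
  proof (rule measurable_cong[THEN iffD1, rotated])
    fix \<omega> :: "(real ^ 'n) measure \<times> (real ^ 'n)" assume "\<omega> \<in> space (normalized_space \<Otimes>\<^sub>M borel)"
    then have \<mu>: "fst \<omega> \<in> radon_measures" by (auto simp: space_pair_measure normalized_measures_radon)
    show "(if 0 < emeasure (fst \<omega>) (sup_ball (1 / a) (snd \<omega>))
     then (LINT y|fst \<omega>. f (a *\<^sub>R (y - snd \<omega>))) / enn2real (emeasure (fst \<omega>) (sup_ball (1 / a) (snd \<omega>)))
     else (LINT y|fst \<omega>. f y)) = (LINT y|(case \<omega> of (\<mu>, x) \<Rightarrow> renorm_total a x \<mu>). f y)"
      using integral_renorm[OF \<mu> a _ lip_functions_borel[OF f], of "snd \<omega>"]
      by (simp add: renorm_total_def case_prod_beta' measure_def)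
  qed
qed

lemma measurable_renorm_total_measure [measurable]:
  "0 < a \<Longrightarrow> renorm_total a x \<in> normalized_space \<rightarrow>\<^sub>M normalized_space"
  using measurable_compose[OF measurable_Pair2'[of x borel normalized_space] measurable_renorm_total] by simp

lemma measurable_renorm_total_point:
  "0 < a \<Longrightarrow> \<mu> \<in> normalized_measures \<Longrightarrow> (\<lambda>x. renorm_total a x \<mu>) \<in> borel \<rightarrow>\<^sub>M normalized_space"
  using measurable_compose[OF measurable_Pair1'[of \<mu> normalized_space borel] measurable_renorm_total] by simp

lemma pred_supp: "Measurable.pred (normalized_space \<Otimes>\<^sub>M borel) (\<lambda>(\<mu>, x :: real ^ 'n). x \<in> supp \<mu>)"
proof -
  have [measurable]: "(\<lambda>\<omega> :: (real ^ 'n) measure \<times> (real ^ 'n). emeasure (fst \<omega>) (sup_ball r (snd \<omega>))) \<in> borel_measurable (normalized_space \<Otimes>\<^sub>M borel)" for r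
    using measurable_emeasure_sup_ball by (simp add: case_prod_beta')
  have "Measurable.pred (normalized_space \<Otimes>\<^sub>M borel)
    (\<lambda>\<omega> :: (real ^ 'n) measure \<times> (real ^ 'n). \<forall>n. 0 < emeasure (fst \<omega>) (sup_ball (1 / real (Suc n)) (snd \<omega>)))"
    by measurable
  then show ?thesis
    by (rule measurable_cong[THEN iffD1, rotated])
      (auto simp: space_pair_measure supp_iff[OF normalized_measures_radon])
qed

lemma flow_domain_sets: "flow_domain \<in> sets normalized_space"
proof -
  have "Measurable.pred normalized_space (\<lambda>\<mu>. 0 \<in> supp \<mu>)"
    using measurable_compose[OF measurable_Pair2'[of 0 borel normalized_space] pred_supp] by simp
  then show ?thesis by (simp add: pred_def flow_domain_def)
qed

section \<open>The flow on its domain and the averaged translates\<close>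

lemma flow_domain_normalized: "\<mu> \<in> flow_domain \<Longrightarrow> \<mu> \<in> normalized_measures"
  by (simp add: flow_domain_def)

lemma renorm_total_supp:
  assumes "\<mu> \<in> normalized_measures" "x \<in> supp \<mu>" "0 < a"
  shows "renorm_total a x \<mu> = renorm a x \<mu>" "renorm a x \<mu> \<in> flow_domain"
proof -
  note r = normalized_measures_radon[OF assms(1)]
  have pos: "0 < emeasure \<mu> (sup_ball (1 / a) x)"
    using assms by (intro supp_sup_ball_pos r) auto
  then show "renorm_total a x \<mu> = renorm a x \<mu>" by (simp add: renorm_total_def)
  show "renorm a x \<mu> \<in> flow_domain"
    using renorm_normalized[OF r assms(3) pos] supp_renorm[OF r assms(3), of 0 x] assms(2)
    by (simp add: flow_domain_def)
qed

lemma scale_star_eq: "\<mu> \<in> flow_domain \<Longrightarrow> scale_star t \<mu> = renorm_total (exp t) 0 \<mu>"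
  using renorm_total_supp[of \<mu> 0 "exp t"] by (simp add: scale_star_renorm flow_domain_def)

text \<open>Invariance as a push-forward identity for a map defined everywhere:
  \<open>flow_domain\<close> has full measure, and there the total map is S_t^* with
  \<open>t = ln a\<close>.\<close>

lemma distr_renorm_total:
  assumes Q: "distribution Q" "scale_invariant Q" and a: "0 < a"
  shows "distr Q normalized_space (renorm_total a 0) = Q"
proof -
  have sets: "sets Q = sets normalized_space" using Q by (simp add: distribution_def)
  then have space: "space Q = normalized_measures" using sets_eq_imp_space_eq[of Q] by simp
  have m: "renorm_total a 0 \<in> Q \<rightarrow>\<^sub>M normalized_space"
    unfolding measurable_cong_sets[OF sets refl] by (rule measurable_renorm_total_measure[OF a])
  show ?thesis
  proof (rule measure_eqI)
    fix A assume "A \<in> sets (distr Q normalized_space (renorm_total a 0))"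
    then have A: "A \<in> sets normalized_space" by simp
    have "emeasure (distr Q normalized_space (renorm_total a 0)) A = emeasure Q (renorm_total a 0 -` A \<inter> space Q)"
      by (rule emeasure_distr[OF m A])
    also have "\<dots> = emeasure Q {\<mu> \<in> flow_domain. scale_star (ln a) \<mu> \<in> A}"
    proof (rule emeasure_eq_AE)
      show "AE \<mu> in Q. \<mu> \<in> renorm_total a 0 -` A \<inter> space Q \<longleftrightarrow> \<mu> \<in> {\<mu> \<in> flow_domain. scale_star (ln a) \<mu> \<in> A}"
        using Q(2) a by (auto simp: scale_invariant_def scale_star_eq space flow_domain_normalized elim!: AE_mp)
      show "renorm_total a 0 -` A \<inter> space Q \<in> sets Q" by (rule measurable_sets[OF m A])
      have "{\<mu> \<in> flow_domain. scale_star (ln a) \<mu> \<in> A} = (renorm_total a 0 -` A \<inter> space Q) \<inter> flow_domain"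
        using a by (auto simp: scale_star_eq space flow_domain_normalized)
      then show "{\<mu> \<in> flow_domain. scale_star (ln a) \<mu> \<in> A} \<in> sets Q"
        using measurable_sets[OF m A] flow_domain_sets sets by auto
    qed
    also have "\<dots> = emeasure Q A"
      using Q(2) A sets by (simp add: scale_invariant_def)
    finally show "emeasure (distr Q normalized_space (renorm_total a 0)) A = emeasure Q A" .
  qed (simp add: sets)
qed

text \<open>Points of the support have balls of positive mass, so the points left out in
  \<open>local_translates\<close> form a null set and the total map can replace
  \<open>translate_star\<close>.\<close>

lemma emeasure_local_translates:
  assumes \<mu>: "\<mu> \<in> normalized_measures" and U: "U \<in> sets borel" and A: "A \<in> sets normalized_space"
  shows "emeasure (local_translates U \<mu>) A = emeasure \<mu> {x \<in> U. renorm_total 1 x \<mu> \<in> A}"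
proof -
  note r = normalized_measures_radon[OF \<mu>]
  let ?G = "{x \<in> U. 0 < emeasure \<mu> (sup_ball 1 x)}"
  note [measurable] = U measurable_renorm_total_point[OF zero_less_one \<mu>] A
  have "(\<lambda>x. emeasure \<mu> (sup_ball 1 x)) \<in> borel_measurable borel"
    using measurable_compose[OF measurable_Pair1'[of \<mu> normalized_space borel] measurable_emeasure_sup_ball[of 1]] \<mu> by simp
  then have [measurable]: "?G \<in> sets borel" by measurable
  then have G: "?G \<in> sets \<mu>" by (simp add: radon_sets[OF r])
  have S: "{x \<in> U. renorm_total 1 x \<mu> \<in> A} \<in> sets borel" by measurable
  have m: "(\<lambda>x. translate_star x \<mu>) \<in> restrict_space \<mu> ?G \<rightarrow>\<^sub>M normalized_space"
  proof (rule measurable_cong[THEN iffD1])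
    show "(\<lambda>x. renorm_total 1 x \<mu>) \<in> restrict_space \<mu> ?G \<rightarrow>\<^sub>M normalized_space"
      by (intro measurable_restrict_space1 radon_measurable[OF r] measurable_renorm_total_point \<mu>) simp
  qed (auto simp: space_restrict_space renorm_total_def translate_star_renorm)
  have "emeasure (local_translates U \<mu>) A = emeasure (restrict_space \<mu> ?G) ((\<lambda>x. translate_star x \<mu>) -` A \<inter> space (restrict_space \<mu> ?G))"
    unfolding local_translates_def by (rule emeasure_distr[OF m A])
  also have "\<dots> = emeasure \<mu> ((\<lambda>x. translate_star x \<mu>) -` A \<inter> space (restrict_space \<mu> ?G))"
    using G by (intro emeasure_restrict_space) (auto simp: space_restrict_space)
  also have "(\<lambda>x. translate_star x \<mu>) -` A \<inter> space (restrict_space \<mu> ?G) = {x \<in> U. renorm_total 1 x \<mu> \<in> A} \<inter> ?G"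
    by (auto simp: space_restrict_space radon_space[OF r] renorm_total_def translate_star_renorm)
  also have "emeasure \<mu> \<dots> = emeasure \<mu> {x \<in> U. renorm_total 1 x \<mu> \<in> A}"
  proof (rule emeasure_eq_AE)
    show "AE x in \<mu>. x \<in> {x \<in> U. renorm_total 1 x \<mu> \<in> A} \<inter> ?G \<longleftrightarrow> x \<in> {x \<in> U. renorm_total 1 x \<mu> \<in> A}"
      using AE_supp[OF r] by (rule AE_mp) (auto intro!: AE_I2 supp_sup_ball_pos[OF r])
  qed (use G S in \<open>auto simp: radon_sets[OF r]\<close>)
  finally show ?thesis .
qed

lemma measurable_emeasure_translates:
  assumes "U \<in> sets borel" "A \<in> sets normalized_space"
  shows "(\<lambda>\<mu> :: (real ^ 'n) measure. emeasure \<mu> {x \<in> U. renorm_total 1 x \<mu> \<in> A}) \<in> borel_measurable normalized_space"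
proof (rule measurable_emeasure_kernel)
  note [measurable] = assms measurable_renorm_total[OF zero_less_one]
  have "Measurable.pred (normalized_space \<Otimes>\<^sub>M borel) (\<lambda>\<omega> :: (real ^ 'n) measure \<times> (real ^ 'n). snd \<omega> \<in> U \<and> (case \<omega> of (\<mu>, x) \<Rightarrow> renorm_total 1 x \<mu>) \<in> A)"
    by measurable
  then show "Measurable.pred (normalized_space \<Otimes>\<^sub>M borel) (\<lambda>(\<mu> :: (real ^ 'n) measure, x). x \<in> U \<and> renorm_total 1 x \<mu> \<in> A)"
    by (simp add: case_prod_beta')
qed simp

lemma sets_averaged_translates [simp]: "sets (averaged_translates U Q) = sets normalized_space"
  unfolding averaged_translates_def by (rule sets.sets_measure_of_eq)

text \<open>The definition through \<open>measure_of\<close> yields these values once the set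
  function is known to be countably additive, which holds because the integral over \<open>Q\<close>
  commutes with countable sums.\<close>

lemma emeasure_averaged_translates:
  assumes Q: "sets Q = sets normalized_space" and U: "U \<in> sets borel" and A: "A \<in> sets normalized_space"
  shows "emeasure (averaged_translates U Q) A = (\<integral>\<^sup>+\<mu>. emeasure \<mu> {x \<in> U. renorm_total 1 x \<mu> \<in> A} \<partial>Q)"
proof -
  have sp: "space Q = normalized_measures" using sets_eq_imp_space_eq[OF Q] by simp
  have eq: "(\<integral>\<^sup>+\<mu>. emeasure (local_translates U \<mu>) A \<partial>Q) = (\<integral>\<^sup>+\<mu>. emeasure \<mu> {x \<in> U. renorm_total 1 x \<mu> \<in> A} \<partial>Q)"
    if "A \<in> sets normalized_space" for A
    using that U by (intro nn_integral_cong emeasure_local_translates) (auto simp: sp)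
  have "emeasure (averaged_translates U Q) A = (\<integral>\<^sup>+\<mu>. emeasure (local_translates U \<mu>) A \<partial>Q)"
    unfolding averaged_translates_def
  proof (rule emeasure_measure_of_sigma)
    show "sigma_algebra (space (normalized_space :: (real ^ 'a) measure measure)) (sets normalized_space)"
      by (rule sets.sigma_algebra_axioms)
    show "positive (sets normalized_space) (\<lambda>A. \<integral>\<^sup>+\<mu>. emeasure (local_translates U \<mu>) A \<partial>Q)"
      by (simp add: positive_def)
    show "countably_additive (sets normalized_space) (\<lambda>A. \<integral>\<^sup>+\<mu>. emeasure (local_translates U \<mu>) A \<partial>Q)"
    proof (rule countably_additiveI)
      fix B :: "nat \<Rightarrow> (real ^ 'a) measure set"
      assume B: "range B \<subseteq> sets normalized_space" "disjoint_family B" "(\<Union>i. B i) \<in> sets normalized_space"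
      have m: "(\<lambda>\<mu>. emeasure (local_translates U \<mu>) (B i)) \<in> borel_measurable Q" for i
      proof (rule measurable_cong[THEN iffD1])
        show "(\<lambda>\<mu>. emeasure \<mu> {x \<in> U. renorm_total 1 x \<mu> \<in> B i}) \<in> borel_measurable Q"
          unfolding measurable_cong_sets[OF Q refl] using U B(1) by (intro measurable_emeasure_translates) auto
      qed (use U B(1) in \<open>auto simp: sp emeasure_local_translates\<close>)
      have "(\<Sum>i. \<integral>\<^sup>+\<mu>. emeasure (local_translates U \<mu>) (B i) \<partial>Q) = (\<integral>\<^sup>+\<mu>. (\<Sum>i. emeasure (local_translates U \<mu>) (B i)) \<partial>Q)"
        by (rule nn_integral_suminf[symmetric]) (rule m)
      also have "\<dots> = (\<integral>\<^sup>+\<mu>. emeasure (local_translates U \<mu>) (\<Union>i. B i) \<partial>Q)"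
        using B by (intro nn_integral_cong suminf_emeasure) (auto simp: local_translates_def)
      finally show "(\<Sum>i. \<integral>\<^sup>+\<mu>. emeasure (local_translates U \<mu>) (B i) \<partial>Q) = (\<integral>\<^sup>+\<mu>. emeasure (local_translates U \<mu>) (\<Union>i. B i) \<partial>Q)" .
    qed
  qed (rule A)
  then show ?thesis using eq[OF A] by simp
qed

subsection \<open>A Hopf argument\<close>

text \<open>Otherwise there are sets of \<open>M\<close>-measure below 2^-i and
  \<open>N\<close>-measure at least \<open>e\<close>. By Borel-Cantelli their limsup is
  \<open>M\<close>-null, hence \<open>N\<close>-null, while continuity from above gives it
  \<open>N\<close>-measure at least \<open>e\<close>.\<close>

lemma absolutely_continuous_uniform:
  assumes M: "finite_measure M" and N: "finite_measure N"
    and ac: "absolutely_continuous M N" and sets: "sets N = sets M" and e: "0 < e"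
  shows "\<exists>d>0. \<forall>A\<in>sets M. measure M A < d \<longrightarrow> measure N A < e"
proof (rule ccontr)
  interpret M: finite_measure M by fact
  interpret N: finite_measure N by fact
  assume neg: "\<not> ?thesis"
  have "\<exists>A\<in>sets M. measure M A < (1 / 2) ^ i \<and> e \<le> measure N A" for i
  proof -
    have "(0 :: real) < (1 / 2) ^ i" by simp
    with neg have "\<not> (\<forall>A\<in>sets M. measure M A < (1 / 2) ^ i \<longrightarrow> measure N A < e)" by blast
    then show ?thesis by (auto simp: not_less)
  qed
  then obtain A where A: "\<And>i. A i \<in> sets M" "\<And>i. measure M (A i) < (1 / 2) ^ i" "\<And>i. e \<le> measure N (A i)"
    by metis
  have "summable (\<lambda>i. measure M (A i))"
    by (rule summable_comparison_test'[of "\<lambda>i. (1 / 2) ^ i" 0]) (use A(2) in \<open>auto intro: less_imp_le summable_geometric\<close>)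
  then have "limsup A \<in> null_sets M"
    using A(1) by (intro borel_cantelli_limsup1) (auto simp: M.emeasure_eq_measure)
  then have null: "limsup A \<in> null_sets N"
    using ac by (auto simp: absolutely_continuous_def)
  define B where "B n = (\<Union>i\<in>{n..}. A i)" for n
  have Bs: "B n \<in> sets N" for n unfolding B_def using A(1) sets by auto
  have "decseq B" unfolding decseq_def B_def by (intro allI impI UN_mono) auto
  then have "(\<lambda>n. measure N (B n)) \<longlonglongrightarrow> measure N (\<Inter>n. B n)"
    using Bs by (intro N.finite_Lim_measure_decseq) auto
  moreover have "(\<Inter>n. B n) = limsup A"
    by (simp add: B_def limsup_INF_SUP)
  moreover have "e \<le> measure N (B n)" for n
  proof -
    have "measure N (A n) \<le> measure N (B n)"
      using Bs by (intro N.finite_measure_mono) (auto simp: B_def)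
    then show ?thesis using A(3)[of n] by simp
  qed
  ultimately have "e \<le> measure N (limsup A)"
    by (intro LIMSEQ_le_const[of _ "measure N (limsup A)"]) auto
  then show False using null e by (simp add: null_sets_def measure_def)
qed

text \<open>
  The last assumption is what lets asymptotic equality pass from a generator to countable unions.
\<close>

locale asymptotic_pair = prob_space m for m :: "'a measure" +
  fixes N :: "'b measure" and P :: "'b measure" and X Y :: "nat \<Rightarrow> 'a \<Rightarrow> 'b"
  assumes P_measure: "finite_measure P" "sets P = sets N"
    and X [measurable]: "\<And>n. X n \<in> m \<rightarrow>\<^sub>M N"
    and Y [measurable]: "\<And>n. Y n \<in> m \<rightarrow>\<^sub>M N"
    and unif: "\<And>e. 0 < e \<Longrightarrow> \<exists>d>0. \<forall>A\<in>sets N. measure P A < d \<longrightarrow>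
       (\<forall>n. prob {\<omega> \<in> space m. X n \<omega> \<in> A} < e \<and> prob {\<omega> \<in> space m. Y n \<omega> \<in> A} < e)"
begin

text \<open>Takes the place of a distance tending to 0 in probability, in a form that makes sense
  for a single measurable set.\<close>

definition asymp_equal :: "'b set \<Rightarrow> bool" where
  "asymp_equal A \<longleftrightarrow> (\<lambda>n. prob {\<omega> \<in> space m. (X n \<omega> \<in> A) \<noteq> (Y n \<omega> \<in> A)}) \<longlonglongrightarrow> 0"

lemma sets_X [measurable]: "A \<in> sets N \<Longrightarrow> {\<omega> \<in> space m. X n \<omega> \<in> A} \<in> events"
  and sets_Y [measurable]: "A \<in> sets N \<Longrightarrow> {\<omega> \<in> space m. Y n \<omega> \<in> A} \<in> events"
  using measurable_sets[OF X, of A n] measurable_sets[OF Y, of A n]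
  by (simp_all add: vimage_def Int_def conj_commute)

lemma sets_ne: "A \<in> sets N \<Longrightarrow> {\<omega> \<in> space m. (X n \<omega> \<in> A) \<noteq> (Y n \<omega> \<in> A)} \<in> events"
proof -
  assume A: "A \<in> sets N"
  have "{\<omega> \<in> space m. (X n \<omega> \<in> A) \<noteq> (Y n \<omega> \<in> A)} =
      ({\<omega> \<in> space m. X n \<omega> \<in> A} - {\<omega> \<in> space m. Y n \<omega> \<in> A}) \<union>
      ({\<omega> \<in> space m. Y n \<omega> \<in> A} - {\<omega> \<in> space m. X n \<omega> \<in> A})" by auto
  then show ?thesis using sets_X[OF A] sets_Y[OF A] by simp
qed

text \<open>Disagreement about \<open>A\<close> is charged to a set \<open>Z j\<close>, which both
  sequences visit with small probability uniformly in \<open>n\<close>, and to an event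
  \<open>W n j\<close>, whose probability vanishes as \<open>n\<close> grows with \<open>j\<close>
  fixed. Choosing \<open>j\<close> first and \<open>n\<close> afterwards makes the total
  small.\<close>

lemma asymp_equal_approx:
  assumes A: "A \<in> sets N" and Z: "\<And>j. Z j \<in> sets N" "(\<lambda>j. measure P (Z j)) \<longlonglongrightarrow> 0"
    and W: "\<And>n j. W n j \<in> events" "\<And>j. (\<lambda>n. prob (W n j)) \<longlonglongrightarrow> 0"
    and sub: "\<And>j. \<forall>\<^sub>F n in sequentially. AE \<omega> in m. (X n \<omega> \<in> A) \<noteq> (Y n \<omega> \<in> A) \<longrightarrow>
       X n \<omega> \<in> Z j \<or> Y n \<omega> \<in> Z j \<or> \<omega> \<in> W n j"
  shows "asymp_equal A"
  unfolding asymp_equal_def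
proof (rule LIMSEQ_I)
  fix e :: real assume e: "0 < e"
  then obtain d where d: "0 < d" and small: "\<And>A n. A \<in> sets N \<Longrightarrow> measure P A < d \<Longrightarrow>
       prob {\<omega> \<in> space m. X n \<omega> \<in> A} < e / 3 \<and> prob {\<omega> \<in> space m. Y n \<omega> \<in> A} < e / 3"
    using unif[of "e / 3"] by auto
  obtain j where j: "measure P (Z j) < d"
    using order_tendstoD(2)[OF Z(2) d] eventually_happens by force
  have "0 < e / 3" using e by simp
  from sub[of j] order_tendstoD(2)[OF W(2) this, of j]
  have "\<forall>\<^sub>F n in sequentially. prob {\<omega> \<in> space m. (X n \<omega> \<in> A) \<noteq> (Y n \<omega> \<in> A)} < e"
  proof (eventually_elim)
    case (elim n)
    let ?X = "{\<omega> \<in> space m. X n \<omega> \<in> Z j}" and ?Y = "{\<omega> \<in> space m. Y n \<omega> \<in> Z j}"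
    have ev: "?X \<in> events" "?Y \<in> events" using Z(1) by auto
    have "prob {\<omega> \<in> space m. (X n \<omega> \<in> A) \<noteq> (Y n \<omega> \<in> A)} \<le> prob (?X \<union> ?Y \<union> W n j)"
    proof (rule finite_measure_mono_AE)
      show "AE \<omega> in m. \<omega> \<in> {\<omega> \<in> space m. (X n \<omega> \<in> A) \<noteq> (Y n \<omega> \<in> A)} \<longrightarrow> \<omega> \<in> ?X \<union> ?Y \<union> W n j"
        using elim(1) by (rule AE_mp) (auto intro!: AE_I2)
    qed (use ev W(1) in auto)
    also have "\<dots> \<le> prob ?X + prob ?Y + prob (W n j)"
      using measure_Un_le[OF sets.Un[OF ev] W(1)[of n j]] measure_Un_le[OF ev] by linarith
    also have "\<dots> < e" using small[OF Z(1) j, of n] elim(2) by linarith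
    finally show ?case .
  qed
  then show "\<exists>n0. \<forall>n\<ge>n0. norm (prob {\<omega> \<in> space m. (X n \<omega> \<in> A) \<noteq> (Y n \<omega> \<in> A)} - 0) < e"
    by (simp add: eventually_sequentially)
qed

lemma asymp_equal_sigma_sets:
  assumes gen: "sets N = sigma_sets (space N) G" and basic: "\<And>A. A \<in> G \<Longrightarrow> asymp_equal A"
    and A: "A \<in> sets N"
  shows "asymp_equal A"
  using A unfolding gen
proof induction
  case (Basic A)
  then show ?case by (rule basic)
next
  case Empty
  show ?case by (simp add: asymp_equal_def)
next
  case (Compl A)
  have "{\<omega> \<in> space m. (X n \<omega> \<in> space N - A) \<noteq> (Y n \<omega> \<in> space N - A)} =
      {\<omega> \<in> space m. (X n \<omega> \<in> A) \<noteq> (Y n \<omega> \<in> A)}" for n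
    using measurable_space[OF X] measurable_space[OF Y] by auto
  then show ?case using Compl.IH by (simp add: asymp_equal_def)
next
  case (Union A)
  interpret P: finite_measure P by (rule P_measure(1))
  have As: "A i \<in> sets N" for i using Union.hyps gen by simp
  let ?U = "\<Union>i. A i"
  \<comment> \<open>Off \<open>Z j\<close>, membership in the union is decided by the first
    \<open>j\<close> sets alone, and \<open>W n j\<close> is a disagreement about one of
    these.\<close>
  define Z where "Z j = ?U - (\<Union>i<j. A i)" for j
  define W where "W n j = (\<Union>i<j. {\<omega> \<in> space m. (X n \<omega> \<in> A i) \<noteq> (Y n \<omega> \<in> A i)})" for n j
  show ?case
  proof (rule asymp_equal_approx[where Z=Z and W=W])
    show "?U \<in> sets N" using As by auto
    show Zs: "Z j \<in> sets N" for j unfolding Z_def using As by auto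
    have "decseq Z" unfolding decseq_def Z_def by (auto intro: less_le_trans)
    moreover have "(\<Inter>j. Z j) = {}" unfolding Z_def by auto
    ultimately show "(\<lambda>j. measure P (Z j)) \<longlonglongrightarrow> 0"
      using P.finite_Lim_measure_decseq[of Z] Zs P_measure(2) by auto
    show "W n j \<in> events" for n j
      unfolding W_def using sets_ne[OF As] by auto
    show "(\<lambda>n. prob (W n j)) \<longlonglongrightarrow> 0" for j
    proof (rule tendsto_sandwich[OF _ _ tendsto_const])
      show "(\<lambda>n. \<Sum>i<j. prob {\<omega> \<in> space m. (X n \<omega> \<in> A i) \<noteq> (Y n \<omega> \<in> A i)}) \<longlonglongrightarrow> 0"
        using Union.IH by (intro tendsto_null_sum) (simp add: asymp_equal_def)
      show "\<forall>\<^sub>F n in sequentially. prob (W n j) \<le> (\<Sum>i<j. prob {\<omega> \<in> space m. (X n \<omega> \<in> A i) \<noteq> (Y n \<omega> \<in> A i)})"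
        unfolding W_def using sets_ne[OF As] by (intro always_eventually allI measure_UNION_le) auto
    qed simp
    show "\<forall>\<^sub>F n in sequentially. AE \<omega> in m. (X n \<omega> \<in> ?U) \<noteq> (Y n \<omega> \<in> ?U) \<longrightarrow>
       X n \<omega> \<in> Z j \<or> Y n \<omega> \<in> Z j \<or> \<omega> \<in> W n j" for j
      by (intro always_eventually allI AE_I2) (auto simp: Z_def W_def)
  qed
qed

end

text \<open>The integrand changes by at most L \<eta> under the shift, and only inside the ball of
  radius R + 1, which contains the supports of f and of its shift because \<eta> \<le> 1. Dividing
  by the normalizing mass preserves the sign.\<close>

lemma integral_translate_pos:
  fixes f :: "real ^ 'n \<Rightarrow> real"
  assumes \<nu>: "\<nu> \<in> radon_measures" and f: "f \<in> lip_functions"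
    and L: "L-lipschitz_on UNIV f" and R: "\<And>z. f z \<noteq> 0 \<Longrightarrow> norm z \<le> R"
    and y: "norm y \<le> \<eta>" "\<eta> \<le> 1"
    and pos: "0 < emeasure \<nu> (sup_ball 1 y)"
    and big: "L * \<eta> * measure \<nu> (cball 0 (R + 1)) < (LINT z|\<nu>. f z)"
  shows "0 < (LINT z|renorm 1 y \<nu>. f z)"
proof -
  have L0: "0 \<le> L" using L by (rule lipschitz_on_nonneg)
  have cb: "cball 0 (R + 1) \<in> sets \<nu>" "emeasure \<nu> (cball 0 (R + 1)) < \<infinity>"
    using \<nu> by (auto simp: radon_measures_def)
  have fy: "(\<lambda>z. f (z - y)) \<in> lip_functions"
    using lip_functions_affine[OF f zero_less_one, of y] by simp
  have i: "integrable \<nu> f" "integrable \<nu> (\<lambda>z. f (z - y))"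
    by (rule lip_functions_integrable[OF \<nu>]; fact)+
  have bound: "f z - f (z - y) \<le> L * \<eta> * indicator (cball 0 (R + 1)) z" for z
  proof (cases "z \<in> cball 0 (R + 1)")
    case True
    have "\<bar>f z - f (z - y)\<bar> \<le> L * dist z (z - y)"
      using lipschitz_onD[OF L, of z "z - y"] by (simp add: dist_real_def)
    also have "\<dots> \<le> L * \<eta>" using y(1) L0 by (intro mult_left_mono) (auto simp: dist_norm)
    finally show ?thesis using True by simp
  next
    case False
    have "norm z \<le> norm (z - y) + norm y" by (metis diff_add_cancel norm_triangle_ineq)
    then have "R < norm (z - y)" "R < norm z" using False y norm_ge_zero[of y] by auto
    then have "f z = 0" "f (z - y) = 0" using R by (meson not_le)+
    then show ?thesis using False by simp
  qed
  have "(LINT z|\<nu>. f z) - (LINT z|\<nu>. f (z - y)) = (LINT z|\<nu>. f z - f (z - y))"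
    using i by simp
  also have "\<dots> \<le> (LINT z|\<nu>. L * \<eta> * indicator (cball 0 (R + 1)) z)"
    using i cb bound by (intro integral_mono) auto
  also have "\<dots> = L * \<eta> * measure \<nu> (cball 0 (R + 1))"
    using cb by simp
  finally have "0 < (LINT z|\<nu>. f (z - y))" using big by linarith
  moreover have "0 < measure \<nu> (sup_ball 1 y)"
    using pos radon_sup_ball_finite[OF \<nu>] by (simp add: measure_def enn2real_positive_iff less_top)
  ultimately show ?thesis
    using integral_renorm[OF \<nu> zero_less_one _ lip_functions_borel[OF f], of y] pos by simp
qed

section \<open>The joint law of a measure and a random point of the unit ball\<close>

definition joint_law :: "(real ^ 'n) measure measure \<Rightarrow> ((real ^ 'n) measure \<times> (real ^ 'n)) measure" where
  "joint_law P = P \<bind> (\<lambda>\<mu>. distr (uniform_measure \<mu> (sup_ball 1 0)) (normalized_space \<Otimes>\<^sub>M borel) (Pair \<mu>))"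

lemma joint_kernel:
  "(\<lambda>\<mu>. distr (uniform_measure \<mu> (sup_ball 1 0)) (normalized_space \<Otimes>\<^sub>M borel) (Pair \<mu>))
     \<in> normalized_space \<rightarrow>\<^sub>M prob_algebra (normalized_space \<Otimes>\<^sub>M borel)"
  by (rule measurable_distr_prob_space2[OF ball_kernel]) simp_all

lemma distribution_prob_algebra: "distribution P \<Longrightarrow> P \<in> space (prob_algebra normalized_space)"
  by (simp add: distribution_def space_prob_algebra)

lemma distribution_sets: "distribution P \<Longrightarrow> sets P = sets normalized_space"
  by (simp add: distribution_def)

lemma distribution_space: "distribution P \<Longrightarrow> space P = normalized_measures"
  using sets_eq_imp_space_eq[OF distribution_sets] by simp

lemma sets_joint_law [simp, measurable_cong]:
  "distribution P \<Longrightarrow> sets (joint_law P) = sets (normalized_space \<Otimes>\<^sub>M borel)"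
  unfolding joint_law_def by (rule sets_bind'[OF distribution_prob_algebra joint_kernel])

lemma prob_space_joint_law: "distribution P \<Longrightarrow> prob_space (joint_law P)"
  unfolding joint_law_def by (rule prob_space_bind'[OF distribution_prob_algebra joint_kernel])

text \<open>The normalization hidden in \<open>uniform_measure\<close> is by \<mu>(B_1) = 1 and
  disappears.\<close>

lemma emeasure_joint_law:
  assumes P: "distribution P" and W: "W \<in> sets (normalized_space \<Otimes>\<^sub>M borel)"
  shows "emeasure (joint_law P) W = (\<integral>\<^sup>+\<mu>. emeasure \<mu> {x \<in> sup_ball 1 0. (\<mu>, x) \<in> W} \<partial>P)"
proof -
  have "emeasure (joint_law P) W = (\<integral>\<^sup>+\<mu>. emeasure (distr (uniform_measure \<mu> (sup_ball 1 0)) (normalized_space \<Otimes>\<^sub>M borel) (Pair \<mu>)) W \<partial>P)"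
    unfolding joint_law_def by (rule emeasure_bind_prob_algebra[OF distribution_prob_algebra[OF P] joint_kernel W])
  also have "\<dots> = (\<integral>\<^sup>+\<mu>. emeasure \<mu> {x \<in> sup_ball 1 0. (\<mu>, x) \<in> W} \<partial>P)"
  proof (rule nn_integral_cong)
    fix \<mu> assume "\<mu> \<in> space P"
    then have \<mu>: "\<mu> \<in> normalized_measures" by (simp add: distribution_space[OF P])
    note r = normalized_measures_radon[OF \<mu>]
    have m: "Pair \<mu> \<in> uniform_measure \<mu> (sup_ball 1 0) \<rightarrow>\<^sub>M normalized_space \<Otimes>\<^sub>M borel"
      using measurable_Pair1'[of \<mu> normalized_space borel] \<mu> radon_sets[OF r]
      by (simp cong: measurable_cong_sets)
    have "Pair \<mu> -` W \<in> sets \<mu>"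
      using measurable_sets[OF measurable_Pair1'[of \<mu> normalized_space borel] W] \<mu> radon_sets[OF r] by simp
    then have "emeasure (uniform_measure \<mu> (sup_ball 1 0)) (Pair \<mu> -` W) = emeasure \<mu> (sup_ball 1 0 \<inter> Pair \<mu> -` W)"
      using \<mu> radon_sets[OF r] by (simp add: sup_ball_borel normalized_measures_def divide_ennreal_def)
    moreover have "sup_ball 1 0 \<inter> Pair \<mu> -` W = {x \<in> sup_ball 1 0. (\<mu>, x) \<in> W}" by auto
    ultimately show "emeasure (distr (uniform_measure \<mu> (sup_ball 1 0)) (normalized_space \<Otimes>\<^sub>M borel) (Pair \<mu>)) W
        = emeasure \<mu> {x \<in> sup_ball 1 0. (\<mu>, x) \<in> W}"
      by (simp add: emeasure_distr[OF m W] radon_space[OF r])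
  qed
  finally show ?thesis .
qed

lemma AE_joint_law:
  assumes P: "distribution P" and p: "Measurable.pred (normalized_space \<Otimes>\<^sub>M borel) p"
    and AE: "AE \<mu> in P. AE x in \<mu>. x \<in> sup_ball 1 0 \<longrightarrow> p (\<mu>, x)"
  shows "AE \<omega> in joint_law P. p \<omega>"
proof -
  let ?W = "{\<omega> \<in> space (normalized_space \<Otimes>\<^sub>M borel). \<not> p \<omega>}"
  have W: "?W \<in> sets (normalized_space \<Otimes>\<^sub>M borel)" using p by measurable
  have "emeasure (joint_law P) ?W = (\<integral>\<^sup>+\<mu>. emeasure \<mu> {x \<in> sup_ball 1 0. (\<mu>, x) \<in> ?W} \<partial>P)"
    by (rule emeasure_joint_law[OF P W])
  also have "\<dots> = (\<integral>\<^sup>+\<mu>. 0 \<partial>P)"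
  proof (rule nn_integral_cong_AE)
    show "AE \<mu> in P. emeasure \<mu> {x \<in> sup_ball 1 0. (\<mu>, x) \<in> ?W} = 0"
      using AE
    proof (rule AE_mp, intro AE_I2 impI)
      fix \<mu> assume "\<mu> \<in> space P" and "AE x in \<mu>. x \<in> sup_ball 1 0 \<longrightarrow> p (\<mu>, x)"
      then have "AE x in \<mu>. \<not> (x \<in> sup_ball 1 0 \<and> (\<mu>, x) \<in> ?W)"
        by (elim AE_mp) (auto intro!: AE_I2)
      moreover have "space \<mu> = UNIV"
        using \<open>\<mu> \<in> space P\<close> by (simp add: distribution_space[OF P] radon_space normalized_measures_radon)
      ultimately show "emeasure \<mu> {x \<in> sup_ball 1 0. (\<mu>, x) \<in> ?W} = 0"
        using emeasure_eq_0_AE[of "\<lambda>x. x \<in> sup_ball 1 0 \<and> (\<mu>, x) \<in> ?W" \<mu>] by simp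
    qed
  qed
  finally have "?W \<in> null_sets (joint_law P)"
    using W P by (simp add: null_sets_def)
  then show ?thesis
    by (rule AE_I') (use sets_eq_imp_space_eq[OF sets_joint_law[OF P]] in auto)
qed

abbreviation translated :: "(real ^ 'n) measure \<times> (real ^ 'n) \<Rightarrow> (real ^ 'n) measure" where
  "translated \<omega> \<equiv> renorm_total 1 (snd \<omega>) (fst \<omega>)"

lemma measurable_translated: "translated \<in> normalized_space \<Otimes>\<^sub>M borel \<rightarrow>\<^sub>M normalized_space"
  using measurable_renorm_total[OF zero_less_one] by (simp add: case_prod_beta')

lemma space_joint_law: "distribution P \<Longrightarrow> space (joint_law P) = normalized_measures \<times> UNIV"
  using sets_eq_imp_space_eq[OF sets_joint_law] by (simp add: space_pair_measure)

lemma distr_fst_joint_law: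
  assumes P: "distribution P"
  shows "distr (joint_law P) normalized_space fst = P"
proof (rule measure_eqI)
  fix A assume "A \<in> sets (distr (joint_law P) normalized_space fst)"
  then have A: "A \<in> sets normalized_space" by simp
  have m: "fst \<in> joint_law P \<rightarrow>\<^sub>M normalized_space"
    unfolding measurable_cong_sets[OF sets_joint_law[OF P] refl] by simp
  have W: "fst -` A \<inter> space (joint_law P) \<in> sets (normalized_space \<Otimes>\<^sub>M borel)"
    using measurable_sets[OF m A] P by simp
  have "emeasure (distr (joint_law P) normalized_space fst) A = emeasure (joint_law P) (fst -` A \<inter> space (joint_law P))"
    by (rule emeasure_distr[OF m A])
  also have "\<dots> = (\<integral>\<^sup>+\<mu>. emeasure \<mu> {x \<in> sup_ball 1 0. (\<mu>, x) \<in> fst -` A \<inter> space (joint_law P)} \<partial>P)"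
    by (rule emeasure_joint_law[OF P W])
  also have "\<dots> = (\<integral>\<^sup>+\<mu>. indicator A \<mu> \<partial>P)"
    by (rule nn_integral_cong) (auto simp: distribution_space[OF P] space_joint_law[OF P] normalized_measures_def split: split_indicator)
  also have "\<dots> = emeasure P A" using A by (simp add: distribution_sets[OF P])
  finally show "emeasure (distr (joint_law P) normalized_space fst) A = emeasure P A" .
qed (simp add: distribution_sets[OF P])

lemma distr_translated_joint_law:
  assumes P: "distribution P"
  shows "distr (joint_law P) normalized_space translated = averaged_translates (sup_ball 1 0) P"
proof (rule measure_eqI)
  fix A assume "A \<in> sets (distr (joint_law P) normalized_space translated)"
  then have A: "A \<in> sets normalized_space" by simp
  have m: "translated \<in> joint_law P \<rightarrow>\<^sub>M normalized_space"
    unfolding measurable_cong_sets[OF sets_joint_law[OF P] refl] by (rule measurable_translated)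
  have W: "translated -` A \<inter> space (joint_law P) \<in> sets (normalized_space \<Otimes>\<^sub>M borel)"
    using measurable_sets[OF m A] P by simp
  have "emeasure (distr (joint_law P) normalized_space translated) A = emeasure (joint_law P) (translated -` A \<inter> space (joint_law P))"
    by (rule emeasure_distr[OF m A])
  also have "\<dots> = (\<integral>\<^sup>+\<mu>. emeasure \<mu> {x \<in> sup_ball 1 0. (\<mu>, x) \<in> translated -` A \<inter> space (joint_law P)} \<partial>P)"
    by (rule emeasure_joint_law[OF P W])
  also have "\<dots> = (\<integral>\<^sup>+\<mu>. emeasure \<mu> {x \<in> sup_ball 1 0. renorm_total 1 x \<mu> \<in> A} \<partial>P)"
    by (rule nn_integral_cong) (simp add: distribution_space[OF P] space_joint_law[OF P])
  also have "\<dots> = emeasure (averaged_translates (sup_ball 1 0) P) A"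
    by (rule emeasure_averaged_translates[OF distribution_sets[OF P] sup_ball_borel A, symmetric])
  finally show "emeasure (distr (joint_law P) normalized_space translated) A = emeasure (averaged_translates (sup_ball 1 0) P) A" .
qed simp

text \<open>The total mass is the mean of \<mu>(B_1) = 1; for larger balls and a general
  distribution it may be infinite.\<close>

lemma prob_space_averaged_unit_ball:
  assumes "distribution P"
  shows "prob_space (averaged_translates (sup_ball 1 0) P)"
  unfolding distr_translated_joint_law[OF assms, symmetric]
  by (rule prob_space.prob_space_distr[OF prob_space_joint_law[OF assms]])
    (simp add: measurable_cong_sets[OF sets_joint_law[OF assms] refl] measurable_translated)

text \<open>The sets \<open>Z j\<close> collect the members of \<open>pos_set f\<close> whose margin
  of positivity is too small, or whose mass on a fixed ball is too large, to withstand a translation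
  of prescribed size. Each single measure has a positive margin and a real-valued mass, so these
  sets decrease to the empty set.\<close>

lemma pos_set_shrinking:
  fixes f :: "real ^ 'n \<Rightarrow> real" and R :: real
  assumes P: "distribution P" and f: "f \<in> lip_functions"
  defines "Z \<equiv> \<lambda>j. {\<mu> \<in> normalized_measures. 0 < (LINT z|\<mu>. f z) \<and>
      ((LINT z|\<mu>. f z) \<le> 1 / real (Suc j) \<or> real j \<le> measure \<mu> (cball 0 R))}"
  shows "Z j \<in> sets normalized_space" "(\<lambda>j. measure P (Z j)) \<longlonglongrightarrow> 0"
proof -
  interpret P: prob_space P using P by (simp add: distribution_def)
  have [measurable]: "(\<lambda>\<mu>. LINT z|\<mu>. f z) \<in> borel_measurable normalized_space"
    using f lip_functions_subset_test_functions by (intro borel_measurable_eval) auto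
  have [measurable]: "(\<lambda>\<mu> :: (real ^ 'n) measure. emeasure \<mu> (cball 0 R)) \<in> borel_measurable normalized_space"
    by (rule measurable_emeasure_compact) simp
  have "(\<lambda>\<mu> :: (real ^ 'n) measure. enn2real (emeasure \<mu> (cball 0 R))) \<in> borel_measurable normalized_space"
    by measurable
  then have [measurable]: "(\<lambda>\<mu> :: (real ^ 'n) measure. measure \<mu> (cball 0 R)) \<in> borel_measurable normalized_space"
    by (simp add: measure_def)
  have "{\<mu> \<in> space normalized_space. 0 < (LINT z|\<mu>. f z) \<and>
      ((LINT z|\<mu>. f z) \<le> 1 / real (Suc j) \<or> real j \<le> measure \<mu> (cball 0 R))} \<in> sets normalized_space" for j
    by measurable
  then show Z: "Z j \<in> sets normalized_space" for j
    unfolding Z_def space_normalized_space .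
  have "decseq Z"
  proof (rule decseq_SucI)
    fix j
    have "1 / real (Suc (Suc j)) \<le> 1 / real (Suc j)" by (rule divide_left_mono) simp_all
    then have "u \<le> 1 / real (Suc j) \<or> real j \<le> v" if "u \<le> 1 / real (Suc (Suc j)) \<or> real (Suc j) \<le> v" for u v
      using that by (elim disjE) linarith+
    then show "Z (Suc j) \<subseteq> Z j" unfolding Z_def by blast
  qed
  then have "(\<lambda>j. measure P (Z j)) \<longlonglongrightarrow> measure P (\<Inter>j. Z j)"
    using Z distribution_sets[OF P] by (intro P.finite_Lim_measure_decseq) auto
  moreover have "(\<Inter>j. Z j) = {}"
  proof (rule ccontr)
    assume "(\<Inter>j. Z j) \<noteq> {}"
    then obtain \<mu> where \<mu>: "\<And>j. \<mu> \<in> Z j" by blast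
    let ?I = "LINT z|\<mu>. f z" and ?m = "measure \<mu> (cball 0 R)"
    have "0 < ?I" using \<mu>[of 0] by (simp add: Z_def)
    obtain j where j: "1 / ?I + ?m < real j" using reals_Archimedean2 by blast
    have "0 < 1 / ?I" using \<open>0 < ?I\<close> by simp
    then have "?m < real j" using j by linarith
    moreover have "1 / ?I < real (Suc j)" using j measure_nonneg[of \<mu> "cball 0 R"] by linarith
    then have "1 / real (Suc j) < ?I" using \<open>0 < ?I\<close> by (simp add: field_simps)
    ultimately show False using \<mu>[of j] by (auto simp: Z_def)
  qed
  ultimately show "(\<lambda>j. measure P (Z j)) \<longlonglongrightarrow> 0" by simp
qed

text \<open>Both contracted measures are renormalizations of \<mu> by the same factor a, at the base
  points 0 and x, hence translates of each other by a x and - a x. Both directions are recorded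
  because the Hopf argument uses the two measures symmetrically.\<close>

lemma zoom_out_translates:
  assumes \<mu>: "\<mu> \<in> normalized_measures" "0 \<in> supp \<mu>" "x \<in> supp \<mu>" and a: "0 < a"
  defines "\<nu> \<equiv> renorm_total a 0 \<mu>" and "\<rho> \<equiv> renorm_total a 0 (renorm_total 1 x \<mu>)"
  shows "\<nu> \<in> normalized_measures" "\<rho> \<in> normalized_measures"
    "\<rho> = renorm 1 (a *\<^sub>R x) \<nu>" "\<nu> = renorm 1 (- (a *\<^sub>R x)) \<rho>"
    "0 < emeasure \<nu> (sup_ball 1 (a *\<^sub>R x))" "0 < emeasure \<rho> (sup_ball 1 (- (a *\<^sub>R x)))"
proof -
  note r = normalized_measures_radon[OF \<mu>(1)]
  have T: "renorm_total 1 x \<mu> = renorm 1 x \<mu>" "renorm 1 x \<mu> \<in> flow_domain"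
    by (rule renorm_total_supp[OF \<mu>(1,3) zero_less_one])+
  have \<nu>: "\<nu> = renorm a 0 \<mu>"
    unfolding \<nu>_def by (rule renorm_total_supp[OF \<mu>(1,2) a])
  have "\<rho> = renorm a 0 (renorm 1 x \<mu>)"
    unfolding \<rho>_def T(1) using T(2) a by (intro renorm_total_supp) (auto simp: flow_domain_def)
  also have "\<dots> = renorm a x \<mu>"
    using renorm_renorm[OF r a zero_less_one, of x 0] supp_sup_ball_pos[OF r \<mu>(3)] by simp
  finally have \<rho>: "\<rho> = renorm a x \<mu>" .
  show n: "\<nu> \<in> normalized_measures" "\<rho> \<in> normalized_measures"
    using renorm_total_supp(2)[OF \<mu>(1,2) a] renorm_total_supp(2)[OF \<mu>(1,3) a]
    by (simp_all add: \<nu> \<rho> flow_domain_def)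
  show "\<rho> = renorm 1 (a *\<^sub>R x) \<nu>"
    unfolding \<nu> \<rho> using renorm_renorm[OF r zero_less_one a, of 0 "a *\<^sub>R x"] supp_sup_ball_pos[OF r \<mu>(2)] a by simp
  show "\<nu> = renorm 1 (- (a *\<^sub>R x)) \<rho>"
    unfolding \<nu> \<rho> using renorm_renorm[OF r zero_less_one a, of x "- (a *\<^sub>R x)"] supp_sup_ball_pos[OF r \<mu>(3)] a by simp
  have "a *\<^sub>R x \<in> supp \<nu>" "- (a *\<^sub>R x) \<in> supp \<rho>"
    unfolding \<nu> \<rho> supp_renorm[OF r a] using a \<mu> by simp_all
  then show "0 < emeasure \<nu> (sup_ball 1 (a *\<^sub>R x))" "0 < emeasure \<rho> (sup_ball 1 (- (a *\<^sub>R x)))"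
    using n by (auto intro!: supp_sup_ball_pos normalized_measures_radon)
qed

lemma AE_joint_law_supp:
  fixes P :: "(real ^ 'n) measure measure"
  assumes P: "distribution P" "scale_invariant P"
  shows "AE \<omega> in joint_law P. 0 \<in> supp (fst \<omega>) \<and> snd \<omega> \<in> supp (fst \<omega>) \<and> snd \<omega> \<in> sup_ball 1 0"
proof (rule AE_joint_law[OF P(1)])
  have "Measurable.pred (normalized_space \<Otimes>\<^sub>M borel) (\<lambda>\<omega> :: (real ^ 'n) measure \<times> (real ^ 'n). snd \<omega> \<in> supp (fst \<omega>))"
    using pred_supp by (simp add: case_prod_beta')
  moreover have "Measurable.pred (normalized_space \<Otimes>\<^sub>M borel) (\<lambda>\<omega> :: (real ^ 'n) measure \<times> (real ^ 'n). 0 \<in> supp (fst \<omega>))"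
    using measurable_compose[OF measurable_fst measurable_compose[OF measurable_Pair2'[of 0 borel normalized_space] pred_supp]] by simp
  moreover have "Measurable.pred (normalized_space \<Otimes>\<^sub>M borel) (\<lambda>\<omega> :: (real ^ 'n) measure \<times> (real ^ 'n). snd \<omega> \<in> sup_ball 1 0)"
    using sup_ball_borel[of 1 "0 :: real ^ 'n"] by measurable
  ultimately show "Measurable.pred (normalized_space \<Otimes>\<^sub>M borel)
      (\<lambda>\<omega> :: (real ^ 'n) measure \<times> (real ^ 'n). 0 \<in> supp (fst \<omega>) \<and> snd \<omega> \<in> supp (fst \<omega>) \<and> snd \<omega> \<in> sup_ball 1 0)"
    by (intro pred_intros_logic)
  have "AE \<mu> in P. \<mu> \<in> flow_domain" using P(2) by (simp add: scale_invariant_def)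
  then show "AE \<mu> in P. AE x in \<mu>. x \<in> sup_ball 1 0 \<longrightarrow>
      0 \<in> supp (fst (\<mu>, x)) \<and> snd (\<mu>, x) \<in> supp (fst (\<mu>, x)) \<and> snd (\<mu>, x) \<in> sup_ball 1 0"
  proof eventually_elim
    case (elim \<mu>)
    then have "0 \<in> supp \<mu>" "\<mu> \<in> radon_measures"
      by (auto simp: flow_domain_def normalized_measures_radon)
    then show ?case
      using AE_supp[of \<mu>] by (auto elim!: AE_mp)
  qed
qed

text \<open>By invariance the contracted \<mu> has law P for every n. The law of the contracted
  translate gives A the averaged mass of the preimage of A, and the P-measure of this preimage
  equals that of A; one bound from absolute continuity therefore serves all n.\<close>

lemma asymptotic_pair_joint_law:
  fixes P :: "(real ^ 'n) measure measure"
  assumes P: "distribution P" "scale_invariant P"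
    and ac: "absolutely_continuous P (averaged_translates (sup_ball 1 0) P)"
  shows "asymptotic_pair (joint_law P) normalized_space P
    (\<lambda>n \<omega>. renorm_total (exp (- real n)) 0 (fst \<omega>))
    (\<lambda>n \<omega>. renorm_total (exp (- real n)) 0 (translated \<omega>))"
proof -
  let ?m = "joint_law P" and ?P' = "averaged_translates (sup_ball 1 0) P"
  let ?T = "\<lambda>n. renorm_total (exp (- real n)) 0 :: (real ^ 'n) measure \<Rightarrow> _"
  interpret m: prob_space ?m by (rule prob_space_joint_law[OF P(1)])
  interpret P: prob_space P using P by (simp add: distribution_def)
  interpret P': prob_space ?P' by (rule prob_space_averaged_unit_ball[OF P(1)])
  have fst: "fst \<in> ?m \<rightarrow>\<^sub>M normalized_space"
    unfolding measurable_cong_sets[OF sets_joint_law[OF P(1)] refl] by simp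
  have tr: "translated \<in> ?m \<rightarrow>\<^sub>M normalized_space"
    unfolding measurable_cong_sets[OF sets_joint_law[OF P(1)] refl] by (rule measurable_translated)
  have T: "?T n \<in> normalized_space \<rightarrow>\<^sub>M normalized_space" for n
    by (rule measurable_renorm_total_measure) simp
  have T_P: "measure P (?T n -` A \<inter> normalized_measures) = measure P A" if "A \<in> sets normalized_space" for n A
  proof -
    have "measure (distr P normalized_space (?T n)) A = measure P (?T n -` A \<inter> space P)"
      by (rule measure_distr) (use T that in \<open>simp_all add: measurable_cong_sets[OF distribution_sets[OF P(1)] refl]\<close>)
    then show ?thesis
      using distr_renorm_total[OF P, of "exp (- real n)"] by (simp add: distribution_space[OF P(1)])
  qed
  have X: "measure ?m {\<omega> \<in> space ?m. ?T n (fst \<omega>) \<in> A} = measure P A" if A: "A \<in> sets normalized_space" for n A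
  proof -
    have "measure P (?T n -` A \<inter> normalized_measures) = measure (distr ?m normalized_space fst) (?T n -` A \<inter> normalized_measures)"
      by (simp add: distr_fst_joint_law[OF P(1)])
    also have "\<dots> = measure ?m (fst -` (?T n -` A \<inter> normalized_measures) \<inter> space ?m)"
      using measurable_sets[OF T A] by (intro measure_distr fst) simp
    also have "fst -` (?T n -` A \<inter> normalized_measures) \<inter> space ?m = {\<omega> \<in> space ?m. ?T n (fst \<omega>) \<in> A}"
      by (auto simp: space_joint_law[OF P(1)])
    finally show ?thesis using T_P[OF A] by simp
  qed
  have Y: "measure ?m {\<omega> \<in> space ?m. ?T n (translated \<omega>) \<in> A} = measure ?P' (?T n -` A \<inter> normalized_measures)"
    if A: "A \<in> sets normalized_space" for n A
  proof -
    have "measure ?P' (?T n -` A \<inter> normalized_measures) = measure (distr ?m normalized_space translated) (?T n -` A \<inter> normalized_measures)"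
      by (simp add: distr_translated_joint_law[OF P(1)])
    also have "\<dots> = measure ?m (translated -` (?T n -` A \<inter> normalized_measures) \<inter> space ?m)"
      using measurable_sets[OF T A] by (intro measure_distr tr) simp
    also have "translated -` (?T n -` A \<inter> normalized_measures) \<inter> space ?m = {\<omega> \<in> space ?m. ?T n (translated \<omega>) \<in> A}"
      using measurable_space[OF tr] by auto
    finally show ?thesis by simp
  qed
  show ?thesis
  proof
    show "(\<lambda>\<omega>. ?T n (fst \<omega>)) \<in> ?m \<rightarrow>\<^sub>M normalized_space" for n
      by (rule measurable_compose[OF fst T])
    show "(\<lambda>\<omega>. ?T n (translated \<omega>)) \<in> ?m \<rightarrow>\<^sub>M normalized_space" for n
      by (rule measurable_compose[OF tr T])
    fix e :: real assume e: "0 < e"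
    obtain d where d: "0 < d" "\<And>A. A \<in> sets P \<Longrightarrow> measure P A < d \<Longrightarrow> measure ?P' A < e"
      using absolutely_continuous_uniform[OF P.finite_measure_axioms P'.finite_measure_axioms ac _ e]
      by (auto simp: distribution_sets[OF P(1)])
    show "\<exists>d>0. \<forall>A\<in>sets normalized_space. measure P A < d \<longrightarrow>
       (\<forall>n. m.prob {\<omega> \<in> space ?m. ?T n (fst \<omega>) \<in> A} < e \<and> m.prob {\<omega> \<in> space ?m. ?T n (translated \<omega>) \<in> A} < e)"
    \<comment> \<open>\<open>e\<close> controls the first sequence, whose law is exactly
      \<open>P\<close>; \<open>d\<close> controls the second.\<close>
    proof (intro exI[of _ "min d e"] conjI ballI impI allI)
      fix A :: "(real ^ 'n) measure set" and n
      assume A: "A \<in> sets normalized_space" and small: "measure P A < min d e"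
      show "m.prob {\<omega> \<in> space ?m. ?T n (fst \<omega>) \<in> A} < e" using X[OF A] small by simp
      have "?T n -` A \<inter> normalized_measures \<in> sets P"
        using measurable_sets[OF T A] by (simp add: distribution_sets[OF P(1)])
      then show "m.prob {\<omega> \<in> space ?m. ?T n (translated \<omega>) \<in> A} < e"
        unfolding Y[OF A] using T_P[OF A] small by (intro d(2)) auto
    qed (use d e in simp)
  qed (simp add: distribution_sets[OF P(1)])
qed

text \<open>Disagreement about an invariant set at time -n is, up to a null set, disagreement at
  time 0. Its probability therefore does not depend on n and equals its limit 0.\<close>

lemma invariant_set_translated:
  fixes P :: "(real ^ 'n) measure measure"
  assumes P: "distribution P" "scale_invariant P"
    and ac: "absolutely_continuous P (averaged_translates (sup_ball 1 0) P)"
    and A: "A \<in> sets normalized_space" "\<And>t. {\<mu> \<in> flow_domain. scale_star t \<mu> \<in> A} = A \<inter> flow_domain"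
  shows "AE \<omega> in joint_law P. fst \<omega> \<in> A \<longleftrightarrow> translated \<omega> \<in> A"
proof -
  define X where "X n \<omega> = renorm_total (exp (- real n)) 0 (fst \<omega>)" for n and \<omega> :: "(real ^ 'n) measure \<times> (real ^ 'n)"
  define Y where "Y n \<omega> = renorm_total (exp (- real n)) 0 (translated \<omega>)" for n and \<omega> :: "(real ^ 'n) measure \<times> (real ^ 'n)"
  let ?m = "joint_law P"
  interpret asymptotic_pair ?m normalized_space P X Y
    using asymptotic_pair_joint_law[OF P ac] by (simp add: X_def[abs_def] Y_def[abs_def])
  have good: "AE \<omega> in ?m. \<omega> \<in> space ?m \<and> 0 \<in> supp (fst \<omega>) \<and> snd \<omega> \<in> supp (fst \<omega>) \<and> snd \<omega> \<in> sup_ball 1 0"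
    using AE_joint_law_supp[OF P] by (rule AE_mp) (auto intro!: AE_I2)
  let ?d = "sqrt (real DIM(real ^ 'n))"
  obtain G :: "(real ^ 'n \<Rightarrow> real) set" where G: "countable G" "G \<subseteq> lip_functions"
    "sets normalized_space = sigma_sets normalized_measures (pos_set ` G)"
    using normalized_space_generator .
  have basic: "asymp_equal (pos_set f)" if "f \<in> G" for f
  proof -
    have f: "f \<in> lip_functions" using that G by auto
    obtain L where L: "L-lipschitz_on UNIV f" using f by (auto simp: lip_functions_def)
    have L0: "0 \<le> L" using L by (rule lipschitz_on_nonneg)
    obtain R where R: "\<And>z. f z \<noteq> 0 \<Longrightarrow> norm z \<le> R"
      using f by (auto simp: lip_functions_def bounded_iff)
    define Z where "Z = (\<lambda>j. {\<mu> \<in> normalized_measures. 0 < (LINT z|\<mu>. f z) \<and>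
      ((LINT z|\<mu>. f z) \<le> 1 / real (Suc j) \<or> real j \<le> measure \<mu> (cball 0 (R + 1)))})"
    \<comment> \<open>Off \<open>Z j\<close> the margin exceeds \<open>1 / Suc j\<close> and the
      ball has mass below \<open>j\<close>, so a shift of length at most \<open>\<eta>\<close> with
      \<open>L * \<eta> * j \<le> 1 / Suc j\<close> cannot destroy positivity.\<close>
    have key: "\<rho> \<in> pos_set f"
      if "\<nu> \<in> pos_set f" "\<nu> \<notin> Z j" "\<rho> = renorm 1 y \<nu>" "\<rho> \<in> normalized_measures"
        "0 < emeasure \<nu> (sup_ball 1 y)" "norm y \<le> \<eta>" "\<eta> \<le> 1" "L * \<eta> * real j \<le> 1 / real (Suc j)"
      for \<nu> \<rho> :: "(real ^ 'n) measure" and y \<eta> j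
    proof -
      have \<nu>: "\<nu> \<in> normalized_measures" "1 / real (Suc j) < (LINT z|\<nu>. f z)" "measure \<nu> (cball 0 (R + 1)) < real j"
        using that(1,2) by (auto simp: pos_set_def Z_def)
      have "0 \<le> \<eta>" using that(6) norm_ge_zero order_trans by blast
      then have "L * \<eta> * measure \<nu> (cball 0 (R + 1)) \<le> L * \<eta> * real j"
        using \<nu>(3) L0 by (intro mult_left_mono) auto
      then have "0 < (LINT z|renorm 1 y \<nu>. f z)"
        using that \<nu> by (intro integral_translate_pos[OF _ f L R that(6,7)] normalized_measures_radon) auto
      then show ?thesis using that by (simp add: pos_set_def)
    qed
    show ?thesis
    \<comment> \<open>For large \<open>n\<close> the two memberships agree almost surely unless one
      of the measures lies in \<open>Z j\<close>, so the exceptional events can be empty.\<close>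
    proof (rule asymp_equal_approx[where Z=Z and W="\<lambda>_ _. {}"])
      show "pos_set f \<in> sets normalized_space" unfolding G(3) using that by (intro sigma_sets.Basic) auto
      show "Z j \<in> sets normalized_space" for j
        using pos_set_shrinking(1)[OF P(1) f] by (simp add: Z_def)
      show "(\<lambda>j. measure P (Z j)) \<longlonglongrightarrow> 0"
        using pos_set_shrinking(2)[OF P(1) f] by (simp add: Z_def)
      fix j
      \<comment> \<open>\<open>?d\<close> bounds the Euclidean norm on the sup-norm unit ball, so
        this sequence bounds the length of the contracted translation.\<close>
      have lim: "(\<lambda>n. exp (- real n) * ?d) \<longlonglongrightarrow> 0"
        using tendsto_mult_left_zero[of "\<lambda>n. exp (- real n)" sequentially ?d] by (simp add: filterlim_compose[OF exp_at_bot] filterlim_uminus_at_bot filterlim_real_sequentially)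
      have "(\<lambda>n. L * (exp (- real n) * ?d) * real j) \<longlonglongrightarrow> L * 0 * real j"
        by (intro tendsto_mult tendsto_const lim)
      then have "\<forall>\<^sub>F n in sequentially. L * (exp (- real n) * ?d) * real j < 1 / real (Suc j)"
        by (intro order_tendstoD(2)) auto
      moreover have "\<forall>\<^sub>F n in sequentially. exp (- real n) * ?d < 1"
        by (rule order_tendstoD(2)[OF lim]) simp
      ultimately show "\<forall>\<^sub>F n in sequentially. AE \<omega> in ?m. (X n \<omega> \<in> pos_set f) \<noteq> (Y n \<omega> \<in> pos_set f) \<longrightarrow>
         X n \<omega> \<in> Z j \<or> Y n \<omega> \<in> Z j \<or> \<omega> \<in> {}"
      proof eventually_elim
        case (elim n)
        show ?case
          using good
        proof (rule AE_mp, intro AE_I2 impI)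
          fix \<omega> assume g: "\<omega> \<in> space ?m \<and> 0 \<in> supp (fst \<omega>) \<and> snd \<omega> \<in> supp (fst \<omega>) \<and> snd \<omega> \<in> sup_ball 1 0"
            and ne: "(X n \<omega> \<in> pos_set f) \<noteq> (Y n \<omega> \<in> pos_set f)"
          let ?a = "exp (- real n)" and ?y = "exp (- real n) *\<^sub>R snd \<omega>"
          have \<mu>: "fst \<omega> \<in> normalized_measures" "0 \<in> supp (fst \<omega>)" "snd \<omega> \<in> supp (fst \<omega>)"
            using g by (auto simp: space_joint_law[OF P(1)])
          note z = zoom_out_translates[OF \<mu>, of ?a, simplified, folded X_def Y_def]
          have "norm (snd \<omega>) \<le> ?d" using g sup_ball_subset_cball[of 1 0] by (auto simp: dist_norm)
          then have y: "norm ?y \<le> ?a * ?d" "norm (- ?y) \<le> ?a * ?d" by simp_all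
          show "X n \<omega> \<in> Z j \<or> Y n \<omega> \<in> Z j \<or> \<omega> \<in> {}"
          proof (rule ccontr)
            assume "\<not> ?thesis"
            then have "X n \<omega> \<in> pos_set f \<Longrightarrow> Y n \<omega> \<in> pos_set f" "Y n \<omega> \<in> pos_set f \<Longrightarrow> X n \<omega> \<in> pos_set f"
              using key[OF _ _ z(3) z(2) z(5) y(1)] key[OF _ _ z(4) z(1) z(6) y(2)] elim by auto
            then show False using ne by auto
          qed
        qed
      qed
    qed simp_all
  qed
  have "asymp_equal A"
    by (rule asymp_equal_sigma_sets[where G="pos_set ` G"]) (use G(3) basic A in auto)
  then have lim: "(\<lambda>n. prob {\<omega> \<in> space ?m. (X n \<omega> \<in> A) \<noteq> (Y n \<omega> \<in> A)}) \<longlonglongrightarrow> 0"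
    by (simp add: asymp_equal_def)
  have inv: "renorm_total (exp (- real n)) 0 \<mu> \<in> A \<longleftrightarrow> \<mu> \<in> A" if "\<mu> \<in> flow_domain" for \<mu> n
  proof -
    have "\<mu> \<in> {\<mu> \<in> flow_domain. scale_star (- real n) \<mu> \<in> A} \<longleftrightarrow> \<mu> \<in> A \<inter> flow_domain"
      unfolding A(2) ..
    then show ?thesis using that by (simp add: scale_star_eq)
  qed
  let ?E = "{\<omega> \<in> space ?m. (fst \<omega> \<in> A) \<noteq> (translated \<omega> \<in> A)}"
  have E: "?E \<in> events"
  proof -
    have [measurable]: "fst \<in> ?m \<rightarrow>\<^sub>M normalized_space" "translated \<in> ?m \<rightarrow>\<^sub>M normalized_space"
      unfolding measurable_cong_sets[OF sets_joint_law[OF P(1)] refl] using measurable_translated by simp_all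
    have "fst -` A \<inter> space ?m \<in> events" "translated -` A \<inter> space ?m \<in> events"
      using A(1) by measurable
    moreover have "?E = ((fst -` A \<inter> space ?m) - (translated -` A \<inter> space ?m)) \<union> ((translated -` A \<inter> space ?m) - (fst -` A \<inter> space ?m))"
      by auto
    ultimately show ?thesis by simp
  qed
  have "prob {\<omega> \<in> space ?m. (X n \<omega> \<in> A) \<noteq> (Y n \<omega> \<in> A)} = prob ?E" for n
  proof (rule finite_measure_eq_AE)
    show "AE \<omega> in ?m. \<omega> \<in> {\<omega> \<in> space ?m. (X n \<omega> \<in> A) \<noteq> (Y n \<omega> \<in> A)} \<longleftrightarrow> \<omega> \<in> ?E"
      using good
    proof (rule AE_mp, intro AE_I2 impI)
      fix \<omega> assume g: "\<omega> \<in> space ?m \<and> 0 \<in> supp (fst \<omega>) \<and> snd \<omega> \<in> supp (fst \<omega>) \<and> snd \<omega> \<in> sup_ball 1 0"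
      then have "fst \<omega> \<in> normalized_measures" by (auto simp: space_joint_law[OF P(1)])
      then have "fst \<omega> \<in> flow_domain" "translated \<omega> \<in> flow_domain"
        using g renorm_total_supp[of "fst \<omega>" "snd \<omega>" 1] by (auto simp: flow_domain_def)
      then show "\<omega> \<in> {\<omega> \<in> space ?m. (X n \<omega> \<in> A) \<noteq> (Y n \<omega> \<in> A)} \<longleftrightarrow> \<omega> \<in> ?E"
        by (simp add: X_def Y_def inv)
    qed
  qed (use sets_ne[OF A(1)] E in auto)
  then have "prob ?E = 0" using LIMSEQ_unique[OF lim] by simp
  then have "?E \<in> null_sets ?m" using E by (simp add: null_sets_def emeasure_eq_measure)
  then show ?thesis by (rule AE_I') auto
qed

text \<open>\<open>invariant_algebra\<close> is given by generators. Almost sure agreement passes to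
  complements, because both measures are normalized, and to countable unions, where only countably
  many null sets are joined.\<close>

lemma invariant_algebra_translated:
  fixes P :: "(real ^ 'n) measure measure"
  assumes P: "distribution P" "scale_invariant P"
    and ac: "absolutely_continuous P (averaged_translates (sup_ball 1 0) P)"
    and A: "A \<in> sets invariant_algebra"
  shows "AE \<omega> in joint_law P. fst \<omega> \<in> A \<longleftrightarrow> translated \<omega> \<in> A"
proof -
  let ?G = "{A \<in> sets (normalized_space :: (real ^ 'n) measure measure).
        \<forall>t. {\<mu> \<in> flow_domain. scale_star t \<mu> \<in> A} = A \<inter> flow_domain}"
  have "?G \<subseteq> Pow normalized_measures"
    using sets.sets_into_space[of _ "normalized_space :: (real ^ 'n) measure measure"] by auto
  then have "A \<in> sigma_sets normalized_measures ?G"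
    using A unfolding invariant_algebra_def by (simp add: sets_measure_of)
  then show ?thesis
  proof induction
    case (Basic A)
    then show ?case by (intro invariant_set_translated[OF P ac]) auto
  next
    case Empty
    show ?case by simp
  next
    case (Compl A)
    show ?case
      using Compl.IH
    proof (rule AE_mp, intro AE_I2 impI)
      fix \<omega> assume \<omega>: "\<omega> \<in> space (joint_law P)" "fst \<omega> \<in> A \<longleftrightarrow> translated \<omega> \<in> A"
      then have "fst \<omega> \<in> normalized_measures" by (auto simp: space_joint_law[OF P(1)])
      then show "fst \<omega> \<in> normalized_measures - A \<longleftrightarrow> translated \<omega> \<in> normalized_measures - A"
        using \<omega>(2) renorm_total_normalized[OF zero_less_one] by auto
    qed
  next
    case (Union A)
    from Union.IH have "AE \<omega> in joint_law P. \<forall>i. fst \<omega> \<in> A i \<longleftrightarrow> translated \<omega> \<in> A i"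
      by (simp add: AE_all_countable)
    then show ?case by (rule AE_mp) (auto intro!: AE_I2)
  qed
qed

text \<open>Almost surely a measure and its translate lie in the invariant set \<open>A\<close>
  together, so restricting \<open>P\<close> to \<open>A\<close> and averaging translates commute.
  This makes the density found for \<open>P\<close> correct conditionally on the invariant
  sets.\<close>

lemma averaged_translates_invariant:
  assumes P: "distribution P" "scale_invariant P"
    and ac: "absolutely_continuous P (averaged_translates (sup_ball 1 0) P)"
    and A: "A \<in> sets invariant_algebra" and B: "B \<in> sets normalized_space"
  shows "(\<integral>\<^sup>+\<mu>. emeasure \<mu> {x \<in> sup_ball 1 0. renorm_total 1 x \<mu> \<in> B} * indicator A \<mu> \<partial>P) =
    emeasure (averaged_translates (sup_ball 1 0) P) (A \<inter> B)"
proof -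
  let ?m = "joint_law P"
  have A': "A \<in> sets normalized_space"
    using A subalgebra_invariant_algebra by (auto simp: subalgebra_def)
  have fst: "fst \<in> ?m \<rightarrow>\<^sub>M normalized_space"
    unfolding measurable_cong_sets[OF sets_joint_law[OF P(1)] refl] by simp
  have tr: "translated \<in> ?m \<rightarrow>\<^sub>M normalized_space"
    unfolding measurable_cong_sets[OF sets_joint_law[OF P(1)] refl] by (rule measurable_translated)
  let ?V = "(fst -` A \<inter> space ?m) \<inter> (translated -` B \<inter> space ?m)"
  have V: "?V \<in> sets ?m" using measurable_sets[OF fst A'] measurable_sets[OF tr B] by auto
  have "(\<integral>\<^sup>+\<mu>. emeasure \<mu> {x \<in> sup_ball 1 0. renorm_total 1 x \<mu> \<in> B} * indicator A \<mu> \<partial>P) =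
      (\<integral>\<^sup>+\<mu>. emeasure \<mu> {x \<in> sup_ball 1 0. (\<mu>, x) \<in> ?V} \<partial>P)"
    by (rule nn_integral_cong) (auto simp: distribution_space[OF P(1)] space_joint_law[OF P(1)] split: split_indicator)
  also have "\<dots> = emeasure ?m ?V"
    using V P(1) by (intro emeasure_joint_law[symmetric]) auto
  also have "\<dots> = emeasure ?m (translated -` (A \<inter> B) \<inter> space ?m)"
  proof (rule emeasure_eq_AE)
    show "AE \<omega> in ?m. \<omega> \<in> ?V \<longleftrightarrow> \<omega> \<in> translated -` (A \<inter> B) \<inter> space ?m"
      using invariant_algebra_translated[OF P ac A] by (rule AE_mp) (auto intro!: AE_I2)
  qed (use V measurable_sets[OF tr sets.Int[OF A' B]] in auto)
  also have "\<dots> = emeasure (distr ?m normalized_space translated) (A \<inter> B)"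
    using A' B by (intro emeasure_distr[symmetric] tr) auto
  finally show ?thesis by (simp add: distr_translated_joint_law[OF P(1)])
qed

subsection \<open>Ergodic components\<close>

text \<open>Countability lets one null set of components serve all test sets; stability under
  intersections lets measures agreeing on the test sets be identified. The whole space enters as the
  empty intersection.\<close>

lemma countable_Int_stable_generator:
  obtains E :: "(real ^ 'n) measure set set" where
    "countable E" "Int_stable E" "E \<subseteq> Pow normalized_measures" "normalized_measures \<in> E"
    "sets normalized_space = sigma_sets normalized_measures E"
proof -
  obtain G :: "(real ^ 'n \<Rightarrow> real) set" where G: "countable G" "G \<subseteq> lip_functions"
    "sets normalized_space = sigma_sets normalized_measures (pos_set ` G)"
    using normalized_space_generator .
  define E where "E = (\<lambda>F. normalized_measures \<inter> \<Inter>(pos_set ` F)) ` {F. finite F \<and> F \<subseteq> G}"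
  have sub: "E \<subseteq> Pow normalized_measures" by (auto simp: E_def)
  have sets: "E \<subseteq> sets normalized_space"
  proof
    fix A assume "A \<in> E"
    then obtain F where F: "finite F" "F \<subseteq> G" "A = space normalized_space \<inter> \<Inter>(pos_set ` F)" by (auto simp: E_def)
    have "pos_set f \<in> sets normalized_space" if "f \<in> F" for f
      unfolding G(3) using that F(2) by (intro sigma_sets.Basic) auto
    then have "(\<Inter>f\<in>F. pos_set f) \<in> sets normalized_space" if "F \<noteq> {}"
      using that F(1) by (intro sets.finite_INT) auto
    then show "A \<in> sets normalized_space"
      unfolding F(3) by (cases "F = {}") (auto simp del: space_normalized_space)
  qed
  show thesis
  proof (rule that[of E])
    show "countable E"
      unfolding E_def by (intro countable_image countable_Collect_finite_subset G)
    show "Int_stable E"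
    proof (rule Int_stableI)
      fix A B assume "A \<in> E" "B \<in> E"
      then obtain F F' where F: "finite F" "F \<subseteq> G" "A = normalized_measures \<inter> \<Inter>(pos_set ` F)"
        "finite F'" "F' \<subseteq> G" "B = normalized_measures \<inter> \<Inter>(pos_set ` F')" by (auto simp: E_def)
      then show "A \<inter> B \<in> E" unfolding E_def by (intro image_eqI[of _ _ "F \<union> F'"]) auto
    qed
    show "normalized_measures \<in> E" unfolding E_def by (intro image_eqI[of _ _ "{}"]) auto
    show "sets normalized_space = sigma_sets normalized_measures E"
    proof
      show "sigma_sets normalized_measures E \<subseteq> sets normalized_space"
        using sets.sigma_sets_subset[OF sets] by simp
      have "pos_set ` G \<subseteq> E"
      proof
        fix A assume "A \<in> pos_set ` G"
        then obtain f where "f \<in> G" "A = pos_set f" by auto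
        then show "A \<in> E" unfolding E_def by (intro image_eqI[of _ _ "{f}"]) (auto simp: pos_set_def)
      qed
      then show "sets normalized_space \<subseteq> sigma_sets normalized_measures E"
        unfolding G(3) by (intro sigma_sets_mono') auto
    qed
  qed (rule sub)
qed

section \<open>The kernel of ergodic components\<close>

locale decomposed =
  fixes P :: "(real ^ 'n) measure measure" and Q :: "(real ^ 'n) measure \<Rightarrow> (real ^ 'n) measure measure"
  assumes P: "distribution P" and Q: "ergodic_decomposition P Q"
begin

lemma prob_P: "prob_space P"
  using P by (simp add: distribution_def)

sublocale finite_measure_subalgebra P invariant_algebra
proof -
  interpret prob_space P by (rule prob_P)
  have "subalgebra P invariant_algebra"
    using subalgebra_invariant_algebra distribution_sets[OF P] distribution_space[OF P]
    by (auto simp: subalgebra_def)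
  then show "finite_measure_subalgebra P invariant_algebra"
    by unfold_locales
qed

lemma Q_kernel: "Q \<in> P \<rightarrow>\<^sub>M prob_algebra normalized_space"
  using Q by (simp add: ergodic_decomposition_def)

lemma Q_distribution: "\<mu> \<in> normalized_measures \<Longrightarrow> distribution (Q \<mu>)"
  using measurable_space[OF Q_kernel, of \<mu>] by (simp add: distribution_space[OF P] space_prob_algebra distribution_def)

lemma nn_integral_P_decompose:
  assumes "g \<in> borel_measurable normalized_space"
  shows "(\<integral>\<^sup>+\<mu>. g \<mu> \<partial>P) = (\<integral>\<^sup>+\<mu>. (\<integral>\<^sup>+\<nu>. g \<nu> \<partial>Q \<mu>) \<partial>P)"
proof -
  have "P = P \<bind> Q" using Q by (simp add: ergodic_decomposition_def)
  then have "(\<integral>\<^sup>+\<mu>. g \<mu> \<partial>P) = (\<integral>\<^sup>+\<mu>. g \<mu> \<partial>(P \<bind> Q))" by simp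
  also have "\<dots> = (\<integral>\<^sup>+\<mu>. (\<integral>\<^sup>+\<nu>. g \<nu> \<partial>Q \<mu>) \<partial>P)"
    by (rule nn_integral_bind[OF assms measurable_prob_algebraD[OF Q_kernel]])
  finally show ?thesis .
qed

text \<open>Holds because \<open>P\<close> is the barycentre of the components.\<close>

lemma AE_Q:
  assumes "Measurable.pred normalized_space p" "AE \<mu> in P. p \<mu>"
  shows "AE \<mu> in P. AE \<nu> in Q \<mu>. p \<nu>"
proof -
  have "P \<bind> Q = P" using Q by (simp add: ergodic_decomposition_def)
  then have "AE \<mu> in P \<bind> Q. p \<mu>" using assms(2) by (simp only:)
  then show ?thesis
    by (simp add: AE_bind[OF measurable_prob_algebraD[OF Q_kernel] assms(1)])
qed

text \<open>Conditioning on the invariant sets fixes the indicator of \<open>A\<close>, so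
  \<open>Q \<mu>\<close> gives \<open>A\<close> mass 1 or 0 according to whether \<mu> lies in
  \<open>A\<close>. The exceptional null set depends on \<open>A\<close>.\<close>

lemma Q_invariant_set:
  assumes A: "A \<in> sets invariant_algebra"
  shows "AE \<mu> in P. AE \<nu> in Q \<mu>. \<nu> \<in> A \<longleftrightarrow> \<mu> \<in> A"
proof -
  interpret P: prob_space P by (rule prob_P)
  have AN: "A \<in> sets normalized_space"
    using A subalgebra_invariant_algebra by (auto simp: subalgebra_def)
  have "AE \<mu> in P. measure (Q \<mu>) A = real_cond_exp P invariant_algebra (indicator A) \<mu>"
    using Q AN by (simp add: ergodic_decomposition_def)
  moreover have "AE \<mu> in P. real_cond_exp P invariant_algebra (indicator A) \<mu> = indicator A \<mu>"
  proof (rule real_cond_exp_F_meas)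
    show "integrable P (indicator A :: _ \<Rightarrow> real)"
      using AN by (simp add: distribution_sets[OF P] less_top[symmetric])
  qed (use A in simp)
  ultimately show ?thesis
    using AE_space
  proof eventually_elim
    case (elim \<mu>)
    then have d: "distribution (Q \<mu>)" by (intro Q_distribution) (simp add: distribution_space[OF P])
    interpret Q\<mu>: prob_space "Q \<mu>" using d by (simp add: distribution_def)
    have AQ: "A \<in> sets (Q \<mu>)" using AN by (simp add: distribution_sets[OF d])
    show ?case
    proof (cases "\<mu> \<in> A")
      case True
      then have "Q\<mu>.prob A = 1" using elim by simp
      then have "AE \<nu> in Q \<mu>. \<nu> \<in> A" using Q\<mu>.prob_eq_1[OF AQ] by simp
      then show ?thesis using True by simp
    next
      case False
      then have "Q\<mu>.prob A = 0" using elim by simp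
      then have "AE \<nu> in Q \<mu>. \<nu> \<notin> A" using Q\<mu>.prob_eq_0[OF AQ] by simp
      then show ?thesis using False by simp
    qed
  qed
qed

text \<open>For almost every \<mu> the indicator of \<open>A\<close> is
  \<open>Q \<mu>\<close>-almost surely constant, equal to its value at \<mu>, and can be pulled out
  of the inner integral.\<close>

lemma set_nn_integral_decompose:
  assumes A: "A \<in> sets invariant_algebra" and g: "g \<in> borel_measurable normalized_space"
  shows "(\<integral>\<^sup>+\<mu>. g \<mu> * indicator A \<mu> \<partial>P) = (\<integral>\<^sup>+\<mu>. (\<integral>\<^sup>+\<nu>. g \<nu> \<partial>Q \<mu>) * indicator A \<mu> \<partial>P)"
proof -
  have AN: "A \<in> sets normalized_space"
    using A subalgebra_invariant_algebra by (auto simp: subalgebra_def)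
  have "(\<integral>\<^sup>+\<mu>. g \<mu> * indicator A \<mu> \<partial>P) = (\<integral>\<^sup>+\<mu>. (\<integral>\<^sup>+\<nu>. g \<nu> * indicator A \<nu> \<partial>Q \<mu>) \<partial>P)"
    using g AN by (intro nn_integral_P_decompose) simp
  also have "\<dots> = (\<integral>\<^sup>+\<mu>. (\<integral>\<^sup>+\<nu>. g \<nu> \<partial>Q \<mu>) * indicator A \<mu> \<partial>P)"
  proof (rule nn_integral_cong_AE)
    show "AE \<mu> in P. (\<integral>\<^sup>+\<nu>. g \<nu> * indicator A \<nu> \<partial>Q \<mu>) = (\<integral>\<^sup>+\<nu>. g \<nu> \<partial>Q \<mu>) * indicator A \<mu>"
      using Q_invariant_set[OF A]
    proof (eventually_elim)
      case (elim \<mu>)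
      then have "(\<integral>\<^sup>+\<nu>. g \<nu> * indicator A \<nu> \<partial>Q \<mu>) = (\<integral>\<^sup>+\<nu>. (if \<mu> \<in> A then g \<nu> else 0) \<partial>Q \<mu>)"
        by (intro nn_integral_cong_AE, eventually_elim) (auto split: split_indicator)
      then show ?case by (cases "\<mu> \<in> A") auto
    qed
  qed
  finally show ?thesis .
qed

text \<open>The kernel is only assumed measurable for \<open>P\<close>. The conditional expectations
  in \<open>ergodic_decomposition\<close> supply versions measurable for the invariant algebra,
  first for indicators and then for sums, multiples and monotone limits.\<close>

lemma Q_integral_invariant:
  fixes g :: "(real ^ 'n) measure \<Rightarrow> ennreal"
  assumes "g \<in> borel_measurable normalized_space"
  shows "\<exists>g'\<in>borel_measurable invariant_algebra. AE \<mu> in P. (\<integral>\<^sup>+\<nu>. g \<nu> \<partial>Q \<mu>) = g' \<mu>"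
  using assms
proof (induction rule: borel_measurable_induct)
  case (cong f g)
  then obtain g' where g': "g' \<in> borel_measurable invariant_algebra" "AE \<mu> in P. (\<integral>\<^sup>+\<nu>. g \<nu> \<partial>Q \<mu>) = g' \<mu>" by blast
  have "AE \<mu> in P. (\<integral>\<^sup>+\<nu>. f \<nu> \<partial>Q \<mu>) = g' \<mu>"
    using g'(2) AE_space
  proof eventually_elim
    case (elim \<mu>)
    then have "distribution (Q \<mu>)" by (intro Q_distribution) (simp add: distribution_space[OF P])
    then have "(\<integral>\<^sup>+\<nu>. f \<nu> \<partial>Q \<mu>) = (\<integral>\<^sup>+\<nu>. g \<nu> \<partial>Q \<mu>)"
      using cong(3) by (intro nn_integral_cong) (simp add: distribution_space)
    then show ?case using elim by simp
  qed
  then show ?case using g'(1) by blast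
next
  case (set A)
  let ?g' = "\<lambda>\<mu>. ennreal (real_cond_exp P invariant_algebra (indicator A) \<mu>)"
  have "AE \<mu> in P. measure (Q \<mu>) A = real_cond_exp P invariant_algebra (indicator A) \<mu>"
    using Q set by (simp add: ergodic_decomposition_def)
  then have "AE \<mu> in P. (\<integral>\<^sup>+\<nu>. indicator A \<nu> \<partial>Q \<mu>) = ?g' \<mu>"
    using AE_space
  proof eventually_elim
    case (elim \<mu>)
    then have d: "distribution (Q \<mu>)" by (intro Q_distribution) (simp add: distribution_space[OF P])
    interpret Q\<mu>: prob_space "Q \<mu>" using d by (simp add: distribution_def)
    show ?case using set elim by (simp add: distribution_sets[OF d] Q\<mu>.emeasure_eq_measure)
  qed
  then show ?case by (intro bexI[of _ ?g']) auto
next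
  case (mult u c)
  then obtain g' where g': "g' \<in> borel_measurable invariant_algebra" "AE \<mu> in P. (\<integral>\<^sup>+\<nu>. u \<nu> \<partial>Q \<mu>) = g' \<mu>" by blast
  have "AE \<mu> in P. (\<integral>\<^sup>+\<nu>. c * u \<nu> \<partial>Q \<mu>) = c * g' \<mu>"
    using g'(2) AE_space
  proof eventually_elim
    case (elim \<mu>)
    then have "distribution (Q \<mu>)" by (intro Q_distribution) (simp add: distribution_space[OF P])
    then have "u \<in> borel_measurable (Q \<mu>)"
      using mult(2) by (simp add: measurable_cong_sets[OF distribution_sets refl])
    then show ?case using elim by (simp add: nn_integral_cmult)
  qed
  then show ?case using g'(1) by (intro bexI[of _ "\<lambda>\<mu>. c * g' \<mu>"]) auto
next
  case (add u v)
  obtain u' where u': "u' \<in> borel_measurable invariant_algebra" "AE \<mu> in P. (\<integral>\<^sup>+\<nu>. u \<nu> \<partial>Q \<mu>) = u' \<mu>" using add by blast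
  obtain v' where v': "v' \<in> borel_measurable invariant_algebra" "AE \<mu> in P. (\<integral>\<^sup>+\<nu>. v \<nu> \<partial>Q \<mu>) = v' \<mu>" using add by blast
  have "AE \<mu> in P. (\<integral>\<^sup>+\<nu>. v \<nu> + u \<nu> \<partial>Q \<mu>) = v' \<mu> + u' \<mu>"
    using u'(2) v'(2) AE_space
  proof eventually_elim
    case (elim \<mu>)
    then have "distribution (Q \<mu>)" by (intro Q_distribution) (simp add: distribution_space[OF P])
    then have "u \<in> borel_measurable (Q \<mu>)" "v \<in> borel_measurable (Q \<mu>)"
      using add(1,3) by (simp_all add: measurable_cong_sets[OF distribution_sets refl])
    then show ?case using elim by (simp add: nn_integral_add)
  qed
  then show ?case using u'(1) v'(1) by (intro bexI[of _ "\<lambda>\<mu>. v' \<mu> + u' \<mu>"]) auto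
next
  case (seq U)
  then have "\<forall>i. \<exists>g'\<in>borel_measurable invariant_algebra. AE \<mu> in P. (\<integral>\<^sup>+\<nu>. U i \<nu> \<partial>Q \<mu>) = g' \<mu>" by blast
  then obtain g' where g': "\<And>i. g' i \<in> borel_measurable invariant_algebra" "\<And>i. AE \<mu> in P. (\<integral>\<^sup>+\<nu>. U i \<nu> \<partial>Q \<mu>) = g' i \<mu>" by metis
  have "AE \<mu> in P. \<forall>i. (\<integral>\<^sup>+\<nu>. U i \<nu> \<partial>Q \<mu>) = g' i \<mu>" using g'(2) by (simp add: AE_all_countable)
  then have "AE \<mu> in P. (\<integral>\<^sup>+\<nu>. (SUP i. U i) \<nu> \<partial>Q \<mu>) = (SUP i. g' i \<mu>)"
    using AE_space
  proof eventually_elim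
    case (elim \<mu>)
    then have "distribution (Q \<mu>)" by (intro Q_distribution) (simp add: distribution_space[OF P])
    then have "U i \<in> borel_measurable (Q \<mu>)" for i
      using seq(1) by (simp add: measurable_cong_sets[OF distribution_sets refl])
    then have "(\<integral>\<^sup>+\<nu>. (SUP i. U i \<nu>) \<partial>Q \<mu>) = (SUP i. \<integral>\<^sup>+\<nu>. U i \<nu> \<partial>Q \<mu>)"
      using seq by (intro nn_integral_monotone_convergence_SUP) auto
    then show ?case using elim by (simp add: image_comp)
  qed
  moreover have "(\<lambda>\<mu>. SUP i. g' i \<mu>) \<in> borel_measurable invariant_algebra"
    using g'(1) by measurable
  ultimately show ?case by (intro bexI[of _ "\<lambda>\<mu>. SUP i. g' i \<mu>"]) auto
qed

text \<open>Both sides have versions measurable for the invariant algebra. Used as densities against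
  the restriction of \<open>P\<close> to that algebra, they define the same measure, and finiteness
  makes the density unique.\<close>

lemma Q_integral_eqI:
  fixes g1 g2 :: "(real ^ 'n) measure \<Rightarrow> ennreal"
  assumes g: "g1 \<in> borel_measurable normalized_space" "g2 \<in> borel_measurable normalized_space"
    and eq: "\<And>A. A \<in> sets invariant_algebra \<Longrightarrow> (\<integral>\<^sup>+\<mu>. g1 \<mu> * indicator A \<mu> \<partial>P) = (\<integral>\<^sup>+\<mu>. g2 \<mu> * indicator A \<mu> \<partial>P)"
    and fin: "(\<integral>\<^sup>+\<mu>. g1 \<mu> \<partial>P) \<noteq> \<infinity>"
  shows "AE \<mu> in P. (\<integral>\<^sup>+\<nu>. g1 \<nu> \<partial>Q \<mu>) = (\<integral>\<^sup>+\<nu>. g2 \<nu> \<partial>Q \<mu>)"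
proof -
  obtain h1 where h1: "h1 \<in> borel_measurable invariant_algebra" "AE \<mu> in P. (\<integral>\<^sup>+\<nu>. g1 \<nu> \<partial>Q \<mu>) = h1 \<mu>"
    using Q_integral_invariant[OF g(1)] by blast
  obtain h2 where h2: "h2 \<in> borel_measurable invariant_algebra" "AE \<mu> in P. (\<integral>\<^sup>+\<nu>. g2 \<nu> \<partial>Q \<mu>) = h2 \<mu>"
    using Q_integral_invariant[OF g(2)] by blast
  let ?M = "restr_to_subalg P invariant_algebra"
  have m: "h \<in> borel_measurable ?M" if "h \<in> borel_measurable invariant_algebra" for h :: "_ \<Rightarrow> ennreal"
    using that by (rule measurable_in_subalg[OF subalg])
  have int: "(\<integral>\<^sup>+\<mu>. h \<mu> * indicator A \<mu> \<partial>?M) = (\<integral>\<^sup>+\<mu>. g \<mu> * indicator A \<mu> \<partial>P)"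
    if h: "h \<in> borel_measurable invariant_algebra" "AE \<mu> in P. (\<integral>\<^sup>+\<nu>. g \<nu> \<partial>Q \<mu>) = h \<mu>"
      and g: "g \<in> borel_measurable normalized_space" and A: "A \<in> sets invariant_algebra" for g h A
  proof -
    have "(\<integral>\<^sup>+\<mu>. h \<mu> * indicator A \<mu> \<partial>?M) = (\<integral>\<^sup>+\<mu>. h \<mu> * indicator A \<mu> \<partial>P)"
      using h(1) A by (intro nn_integral_subalgebra2[OF subalg]) simp
    also have "\<dots> = (\<integral>\<^sup>+\<mu>. (\<integral>\<^sup>+\<nu>. g \<nu> \<partial>Q \<mu>) * indicator A \<mu> \<partial>P)"
      using h(2) by (intro nn_integral_cong_AE) (auto elim!: AE_mp)
    finally show ?thesis using set_nn_integral_decompose[OF A g] by simp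
  qed
  have "density ?M h1 = density ?M h2"
  proof (rule measure_eqI)
    fix A assume "A \<in> sets (density ?M h1)"
    then have A: "A \<in> sets invariant_algebra" "A \<in> sets ?M" by (simp_all add: sets_restr_to_subalg[OF subalg])
    show "emeasure (density ?M h1) A = emeasure (density ?M h2) A"
      using int[OF h1 g(1) A(1)] int[OF h2 g(2) A(1)] eq[OF A(1)]
      by (simp add: emeasure_density m h1(1) h2(1) A(2))
  qed simp
  moreover have "(\<integral>\<^sup>+\<mu>. h1 \<mu> \<partial>?M) \<noteq> \<infinity>"
  proof -
    have "(\<integral>\<^sup>+\<mu>. h1 \<mu> \<partial>?M) = (\<integral>\<^sup>+\<mu>. h1 \<mu> \<partial>P)"
      by (rule nn_integral_subalgebra2[OF subalg h1(1)])
    also have "\<dots> = (\<integral>\<^sup>+\<mu>. (\<integral>\<^sup>+\<nu>. g1 \<nu> \<partial>Q \<mu>) \<partial>P)"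
      using h1(2) by (intro nn_integral_cong_AE) (auto elim!: AE_mp)
    also have "\<dots> = (\<integral>\<^sup>+\<mu>. g1 \<mu> \<partial>P)" by (rule nn_integral_P_decompose[OF g(1), symmetric])
    finally show ?thesis using fin by simp
  qed
  ultimately have "AE \<mu> in ?M. h1 \<mu> = h2 \<mu>"
    using finite_density_unique[OF m[OF h1(1)] m[OF h2(1)]] by simp
  then have "AE \<mu> in P. h1 \<mu> = h2 \<mu>" by (rule AE_restr_to_subalg[OF subalg])
  then show ?thesis using h1(2) h2(2) by eventually_elim simp
qed

text \<open>Fix a test set B and let P' be the averaged law. Over an invariant set A, the translates
  landing in B have total mass P'(A \<inter> B), which is also the integral of h over A \<inter> B;
  hence the two sides give B the same mass for almost every component. The countable generator
  combines the test sets.\<close>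

lemma components_density:
  assumes inv: "scale_invariant P"
    and ac: "absolutely_continuous P (averaged_translates (sup_ball 1 0) P)"
  defines "h \<equiv> RN_deriv P (averaged_translates (sup_ball 1 0) P)"
  shows "AE \<mu> in P. averaged_translates (sup_ball 1 0) (Q \<mu>) = density (Q \<mu>) h"
proof -
  interpret P: prob_space P by (rule prob_P)
  let ?P' = "averaged_translates (sup_ball 1 0) P"
  interpret P': prob_space ?P' by (rule prob_space_averaged_unit_ball[OF P])
  let ?J = "\<lambda>B \<mu>. emeasure \<mu> {x \<in> sup_ball 1 0. renorm_total 1 x \<mu> \<in> B}"
  have h: "h \<in> borel_measurable normalized_space"
    using borel_measurable_RN_deriv[of P ?P'] unfolding h_def measurable_cong_sets[OF distribution_sets[OF P] refl] .
  have dens: "density P h = ?P'"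
    unfolding h_def by (rule density_RN_deriv[OF ac]) (simp add: distribution_sets[OF P])
  obtain E :: "(real ^ 'n) measure set set" where
    E: "countable E" "Int_stable E" "E \<subseteq> Pow normalized_measures" "normalized_measures \<in> E"
    "sets normalized_space = sigma_sets normalized_measures E"
    by (rule countable_Int_stable_generator)
  have eq: "AE \<mu> in P. (\<integral>\<^sup>+\<nu>. ?J B \<nu> \<partial>Q \<mu>) = (\<integral>\<^sup>+\<nu>. h \<nu> * indicator B \<nu> \<partial>Q \<mu>)" if "B \<in> E" for B
  proof (rule Q_integral_eqI)
    have B: "B \<in> sets normalized_space" unfolding E(5) using that by (rule sigma_sets.Basic)
    show "?J B \<in> borel_measurable normalized_space"
      by (rule measurable_emeasure_translates[OF sup_ball_borel B])
    show "(\<lambda>\<nu>. h \<nu> * indicator B \<nu>) \<in> borel_measurable normalized_space" using h B by simp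
    show "(\<integral>\<^sup>+\<mu>. ?J B \<mu> \<partial>P) \<noteq> \<infinity>"
      using emeasure_averaged_translates[OF distribution_sets[OF P] sup_ball_borel B, of 1 0] by (metis P'.emeasure_finite infinity_ennreal_def)
    fix A assume A: "A \<in> sets (invariant_algebra :: (real ^ 'n) measure measure)"
    then have AN: "A \<in> sets normalized_space" using subalgebra_invariant_algebra by (auto simp: subalgebra_def)
    have "(\<integral>\<^sup>+\<mu>. ?J B \<mu> * indicator A \<mu> \<partial>P) = emeasure (density P h) (A \<inter> B)"
      unfolding dens by (rule averaged_translates_invariant[OF P inv ac A B])
    also have "\<dots> = (\<integral>\<^sup>+\<mu>. h \<mu> * indicator (A \<inter> B) \<mu> \<partial>P)"
      using AN B h by (intro emeasure_density) (auto simp: distribution_sets[OF P] cong: measurable_cong_sets)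
    also have "\<dots> = (\<integral>\<^sup>+\<mu>. h \<mu> * indicator B \<mu> * indicator A \<mu> \<partial>P)"
      by (intro nn_integral_cong) (auto split: split_indicator)
    finally show "(\<integral>\<^sup>+\<mu>. ?J B \<mu> * indicator A \<mu> \<partial>P) = (\<integral>\<^sup>+\<mu>. h \<mu> * indicator B \<mu> * indicator A \<mu> \<partial>P)" .
  qed
  then have "AE \<mu> in P. \<forall>B\<in>E. (\<integral>\<^sup>+\<nu>. ?J B \<nu> \<partial>Q \<mu>) = (\<integral>\<^sup>+\<nu>. h \<nu> * indicator B \<nu> \<partial>Q \<mu>)"
    by (simp add: AE_ball_countable[OF E(1)])
  then show ?thesis
    using AE_space
  proof eventually_elim
    case (elim \<mu>)
    then have d: "distribution (Q \<mu>)" by (intro Q_distribution) (simp add: distribution_space[OF P])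
    interpret A: prob_space "averaged_translates (sup_ball 1 0) (Q \<mu>)" by (rule prob_space_averaged_unit_ball[OF d])
    show ?case
    proof (rule measure_eqI_generator_eq[OF E(2,3)])
      fix B assume BE: "B \<in> E"
      then have B: "B \<in> sets normalized_space" unfolding E(5) by (rule sigma_sets.Basic)
      have "emeasure (averaged_translates (sup_ball 1 0) (Q \<mu>)) B = (\<integral>\<^sup>+\<nu>. ?J B \<nu> \<partial>Q \<mu>)"
        by (rule emeasure_averaged_translates[OF distribution_sets[OF d] sup_ball_borel B])
      also have "\<dots> = (\<integral>\<^sup>+\<nu>. h \<nu> * indicator B \<nu> \<partial>Q \<mu>)" using elim BE by simp
      also have "\<dots> = emeasure (density (Q \<mu>) h) B"
        using B h by (intro emeasure_density[symmetric]) (auto simp: distribution_sets[OF d] cong: measurable_cong_sets)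
      finally show "emeasure (averaged_translates (sup_ball 1 0) (Q \<mu>)) B = emeasure (density (Q \<mu>) h) B" .
    next
      show "range (\<lambda>_ :: nat. normalized_measures) \<subseteq> E" using E(4) by auto
      show "emeasure (averaged_translates (sup_ball 1 0) (Q \<mu>)) normalized_measures \<noteq> \<infinity>" by simp
    qed (simp_all add: E(5) distribution_sets[OF d])
  qed
qed

text \<open>As \<open>P\<close> is absolutely continuous with respect to its averaged law, the
  density \<open>h\<close> vanishes only on a \<open>P\<close>-null set. Such a set is null for
  almost every component, so \<open>h\<close> is almost everywhere nonzero there too, and passing to
  a measure with such a density keeps the null sets.\<close>

lemma components_null_sets:
  assumes inv: "scale_invariant P"
    and null: "null_sets P = null_sets (averaged_translates (sup_ball 1 0) P)"
  shows "AE \<mu> in P. null_sets (Q \<mu>) = null_sets (averaged_translates (sup_ball 1 0) (Q \<mu>))"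
proof -
  interpret P: prob_space P by (rule prob_P)
  let ?P' = "averaged_translates (sup_ball 1 0) P"
  have ac: "absolutely_continuous P ?P'" using null by (simp add: absolutely_continuous_def)
  define h where "h = RN_deriv P ?P'"
  have h: "h \<in> borel_measurable normalized_space"
    using borel_measurable_RN_deriv[of P ?P'] unfolding h_def measurable_cong_sets[OF distribution_sets[OF P] refl] .
  have hP: "h \<in> borel_measurable P" unfolding h_def by simp
  have dens: "density P h = ?P'"
    unfolding h_def by (rule density_RN_deriv[OF ac]) (simp add: distribution_sets[OF P])
  let ?Z = "{\<mu> \<in> space P. h \<mu> = 0}"
  have "?Z \<in> null_sets (density P h)"
    unfolding null_sets_density_iff[OF hP] using hP by auto
  then have "?Z \<in> null_sets P" unfolding dens null .
  then have "AE \<mu> in P. h \<mu> \<noteq> 0" by (rule AE_I') auto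
  then have "AE \<mu> in P. AE \<nu> in Q \<mu>. h \<nu> \<noteq> 0"
    using h by (intro AE_Q) simp_all
  then show ?thesis
    using components_density[OF inv ac] AE_space
  proof eventually_elim
    case (elim \<mu>)
    then have d: "distribution (Q \<mu>)" by (intro Q_distribution) (simp add: distribution_space[OF P])
    have hQ: "h \<in> borel_measurable (Q \<mu>)" using h by (simp add: measurable_cong_sets[OF distribution_sets[OF d] refl])
    have "A \<in> null_sets (density (Q \<mu>) h) \<longleftrightarrow> A \<in> null_sets (Q \<mu>)" for A
    proof
      assume "A \<in> null_sets (density (Q \<mu>) h)"
      then have "A \<in> sets (Q \<mu>)" "AE \<nu> in Q \<mu>. \<nu> \<in> A \<longrightarrow> h \<nu> = 0"
        unfolding null_sets_density_iff[OF hQ] by auto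
      then have "AE \<nu> in Q \<mu>. \<nu> \<notin> A" using elim(1) by (auto elim!: AE_mp)
      then show "A \<in> null_sets (Q \<mu>)" using \<open>A \<in> sets (Q \<mu>)\<close> by (simp add: AE_iff_null_sets)
    next
      assume "A \<in> null_sets (Q \<mu>)"
      then show "A \<in> null_sets (density (Q \<mu>) h)"
        unfolding null_sets_density_iff[OF hQ] using AE_not_in[of A "Q \<mu>"] by (auto elim!: eventually_mono)
    qed
    then show ?case using elim(2) unfolding h_def by auto
  qed
qed

end

subsection \<open>The quasi-Palm property under rescaling\<close>

lemma null_sets_averaged_translates:
  assumes Q: "distribution Q" and U: "U \<in> sets borel"
  shows "A \<in> null_sets (averaged_translates U Q) \<longleftrightarrow>
    A \<in> sets normalized_space \<and> (AE \<mu> in Q. emeasure \<mu> {x \<in> U. renorm_total 1 x \<mu> \<in> A} = 0)"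
proof (cases "A \<in> sets normalized_space")
  case True
  have "(\<lambda>\<mu>. emeasure \<mu> {x \<in> U. renorm_total 1 x \<mu> \<in> A}) \<in> borel_measurable Q"
    using measurable_emeasure_translates[OF U True] by (simp add: measurable_cong_sets[OF distribution_sets[OF Q] refl])
  then show ?thesis
    using True by (simp add: null_sets_def emeasure_averaged_translates[OF distribution_sets[OF Q] U] nn_integral_0_iff_AE)
qed auto

lemma null_sets_averaged_translates_antimono:
  assumes Q: "distribution Q" and U: "U \<in> sets borel" "V \<in> sets borel" and sub: "U \<subseteq> V"
  shows "null_sets (averaged_translates V Q) \<subseteq> null_sets (averaged_translates U Q)"
proof
  fix A assume "A \<in> null_sets (averaged_translates V Q)"
  then have A: "A \<in> sets normalized_space" and AE: "AE \<mu> in Q. emeasure \<mu> {x \<in> V. renorm_total 1 x \<mu> \<in> A} = 0"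
    by (simp_all add: null_sets_averaged_translates[OF Q U(2)])
  have "AE \<mu> in Q. emeasure \<mu> {x \<in> U. renorm_total 1 x \<mu> \<in> A} = 0"
    using AE AE_space
  proof eventually_elim
    case (elim \<mu>)
    then have \<mu>: "\<mu> \<in> normalized_measures" by (simp add: distribution_space[OF Q])
    have "{x \<in> V. renorm_total 1 x \<mu> \<in> A} = V \<inter> ((\<lambda>x. renorm_total 1 x \<mu>) -` A \<inter> space borel)" by auto
    also have "\<dots> \<in> sets borel"
      using U(2) measurable_sets[OF measurable_renorm_total_point[OF zero_less_one \<mu>] A] by (rule sets.Int)
    finally have "emeasure \<mu> {x \<in> U. renorm_total 1 x \<mu> \<in> A} \<le> emeasure \<mu> {x \<in> V. renorm_total 1 x \<mu> \<in> A}"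
      using sub by (intro emeasure_mono) (auto simp: radon_sets normalized_measures_radon[OF \<mu>])
    then show ?case using elim(1) by simp
  qed
  then show "A \<in> null_sets (averaged_translates U Q)"
    using A by (simp add: null_sets_averaged_translates[OF Q U(1)])
qed

lemma AE_renorm_total:
  assumes Q: "distribution Q" "scale_invariant Q" and a: "0 < a"
    and p: "Measurable.pred normalized_space p"
  shows "(AE \<mu> in Q. p (renorm_total a 0 \<mu>)) \<longleftrightarrow> (AE \<mu> in Q. p \<mu>)"
proof -
  have "renorm_total a 0 \<in> Q \<rightarrow>\<^sub>M normalized_space"
    unfolding measurable_cong_sets[OF distribution_sets[OF Q(1)] refl] by (rule measurable_renorm_total_measure[OF a])
  from AE_distr_iff[OF this, of p] p show ?thesis
    unfolding distr_renorm_total[OF Q a] by (simp add: pred_def)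
qed

text \<open>Translating by \<open>a *\<^sub>R x\<close> after the rescaling is rescaling after the
  translation by \<open>x\<close>. Only vanishing is compared, because the rescaled measure carries
  the extra factor \<open>1 / emeasure \<mu> (sup_ball (1 / a) 0)\<close>.\<close>

lemma emeasure_translates_scaled:
  assumes \<mu>: "\<mu> \<in> flow_domain" and a: "0 < a" and U: "U \<in> sets borel" and A: "A \<in> sets normalized_space"
  shows "emeasure (renorm_total a 0 \<mu>) {z \<in> U. renorm_total 1 z (renorm_total a 0 \<mu>) \<in> A} = 0 \<longleftrightarrow>
    emeasure \<mu> {x. a *\<^sub>R x \<in> U \<and> renorm_total a 0 (renorm_total 1 x \<mu>) \<in> A} = 0"
proof -
  have n: "\<mu> \<in> normalized_measures" and supp: "0 \<in> supp \<mu>" using \<mu> by (auto simp: flow_domain_def)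
  note r = normalized_measures_radon[OF n]
  let ?\<nu> = "renorm_total a 0 \<mu>"
  have \<nu>: "?\<nu> = renorm a 0 \<mu>" by (rule renorm_total_supp(1)[OF n supp a])
  let ?B = "{z \<in> U. renorm_total 1 z ?\<nu> \<in> A}"
  have "?B = U \<inter> ((\<lambda>z. renorm_total 1 z ?\<nu>) -` A \<inter> space borel)" by auto
  also have "\<dots> \<in> sets borel"
    using U measurable_sets[OF measurable_renorm_total_point[OF zero_less_one renorm_total_normalized[OF a n]] A] by (rule sets.Int)
  finally have B: "?B \<in> sets borel" .
  have vB: "{x. a *\<^sub>R x \<in> ?B} \<in> sets borel"
    using affine_vimage_borel[OF B, of a 0] by simp
  have "emeasure ?\<nu> ?B = emeasure \<mu> {x. a *\<^sub>R x \<in> ?B} / emeasure \<mu> (sup_ball (1 / a) 0)"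
    using emeasure_renorm[OF r B a, of 0] unfolding \<nu> by simp
  then have "emeasure ?\<nu> ?B = 0 \<longleftrightarrow> emeasure \<mu> {x. a *\<^sub>R x \<in> ?B} = 0"
    using radon_sup_ball_finite[OF r, of "1 / a" 0] by (simp add: less_top[symmetric])
  also have "emeasure \<mu> {x. a *\<^sub>R x \<in> ?B} = emeasure \<mu> {x. a *\<^sub>R x \<in> U \<and> renorm_total a 0 (renorm_total 1 x \<mu>) \<in> A}"
  proof (rule emeasure_eq_AE)
    show "AE x in \<mu>. x \<in> {x. a *\<^sub>R x \<in> ?B} \<longleftrightarrow> x \<in> {x. a *\<^sub>R x \<in> U \<and> renorm_total a 0 (renorm_total 1 x \<mu>) \<in> A}"
      using AE_supp[OF r]
    proof eventually_elim
      case (elim x)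
      have "renorm_total a 0 (renorm_total 1 x \<mu>) = renorm_total 1 (a *\<^sub>R x) ?\<nu>"
        using zoom_out_translates(3,5)[OF n supp elim a] by (simp add: renorm_total_def[of 1 "a *\<^sub>R x"])
      then show ?case by simp
    qed
    show "{x. a *\<^sub>R x \<in> ?B} \<in> sets \<mu>" using vB by (simp add: radon_sets[OF r])
    have "(\<lambda>x. renorm_total a 0 (renorm_total 1 x \<mu>)) \<in> borel \<rightarrow>\<^sub>M normalized_space"
      by (rule measurable_compose[OF measurable_renorm_total_point[OF zero_less_one n] measurable_renorm_total_measure[OF a]])
    from measurable_sets[OF this A] have "(\<lambda>x. renorm_total a 0 (renorm_total 1 x \<mu>)) -` A \<in> sets borel" by simp
    moreover have "{x. a *\<^sub>R x \<in> U \<and> renorm_total a 0 (renorm_total 1 x \<mu>) \<in> A} =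
        {x. a *\<^sub>R (x - 0) \<in> U} \<inter> (\<lambda>x. renorm_total a 0 (renorm_total 1 x \<mu>)) -` A" by auto
    ultimately show "{x. a *\<^sub>R x \<in> U \<and> renorm_total a 0 (renorm_total 1 x \<mu>) \<in> A} \<in> sets \<mu>"
      using affine_vimage_borel[OF U, of a 0] by (simp only: radon_sets[OF r] sets.Int)
  qed
  finally show ?thesis .
qed

text \<open>Replacing \<mu> by its rescaling, which preserves \<open>Q\<close>, turns the ball of
  radius \<open>a\<close> into the unit ball and \<open>A\<close> into its preimage under the
  rescaling. The hypothesis at radius 1 applies to this preimage, which again by invariance is null
  exactly when \<open>A\<close> is.\<close>

lemma null_sets_averaged_sup_ball:
  assumes Q: "distribution Q" "scale_invariant Q"
    and null: "null_sets Q = null_sets (averaged_translates (sup_ball 1 0) Q)" and a: "0 < a"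
  shows "null_sets (averaged_translates (sup_ball a 0) Q) = null_sets Q"
proof (rule set_eqI)
  fix A :: "(real ^ 'a) measure set"
  let ?A' = "{\<mu> \<in> normalized_measures. renorm_total a 0 \<mu> \<in> A}"
  show "A \<in> null_sets (averaged_translates (sup_ball a 0) Q) \<longleftrightarrow> A \<in> null_sets Q"
  proof (cases "A \<in> sets normalized_space")
    case True
    note [measurable] = True
    have A': "?A' \<in> sets normalized_space"
      using measurable_sets[OF measurable_renorm_total_measure[OF a, of 0] True] by (simp add: vimage_def Int_def conj_commute)
    let ?J = "\<lambda>\<mu>. emeasure \<mu> {x \<in> sup_ball a 0. renorm_total 1 x \<mu> \<in> A}"
    have [measurable]: "?J \<in> borel_measurable normalized_space"
      by (rule measurable_emeasure_translates[OF sup_ball_borel True])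
    have ball: "a *\<^sub>R x \<in> sup_ball a 0 \<longleftrightarrow> x \<in> sup_ball 1 0" for x :: "real ^ 'a"
      using affine_vimage_sup_ball[OF a, of 0 a 0] a by auto
    have "A \<in> null_sets (averaged_translates (sup_ball a 0) Q) \<longleftrightarrow> (AE \<mu> in Q. ?J \<mu> = 0)"
      using True by (simp add: null_sets_averaged_translates[OF Q(1) sup_ball_borel])
    also have "\<dots> \<longleftrightarrow> (AE \<mu> in Q. ?J (renorm_total a 0 \<mu>) = 0)"
      by (rule AE_renorm_total[OF Q a, symmetric]) measurable
    also have "\<dots> \<longleftrightarrow> (AE \<mu> in Q. emeasure \<mu> {x \<in> sup_ball 1 0. renorm_total 1 x \<mu> \<in> ?A'} = 0)"
    proof -
      have "AE \<mu> in Q. \<mu> \<in> flow_domain" using Q(2) by (simp add: scale_invariant_def)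
      then have "AE \<mu> in Q. ?J (renorm_total a 0 \<mu>) = 0 \<longleftrightarrow>
          emeasure \<mu> {x \<in> sup_ball 1 0. renorm_total 1 x \<mu> \<in> ?A'} = 0"
      proof eventually_elim
        case (elim \<mu>)
        then have "renorm_total 1 x \<mu> \<in> normalized_measures" for x
          by (intro renorm_total_normalized flow_domain_normalized) simp_all
        then show ?case
          using emeasure_translates_scaled[OF elim a sup_ball_borel True, of a 0] by (simp add: ball)
      qed
      then show ?thesis by (rule eventually_cong)
    qed
    also have "\<dots> \<longleftrightarrow> ?A' \<in> null_sets (averaged_translates (sup_ball 1 0) Q)"
      using A' by (simp add: null_sets_averaged_translates[OF Q(1) sup_ball_borel])
    also have "\<dots> \<longleftrightarrow> ?A' \<in> null_sets Q" by (simp add: null)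
    also have "\<dots> \<longleftrightarrow> (AE \<mu> in Q. \<mu> \<notin> ?A')"
      using A' by (intro AE_iff_null_sets) (simp add: distribution_sets[OF Q(1)])
    also have "\<dots> \<longleftrightarrow> (AE \<mu> in Q. renorm_total a 0 \<mu> \<notin> A)"
      by (rule AE_cong) (simp add: distribution_space[OF Q(1)])
    also have "\<dots> \<longleftrightarrow> (AE \<mu> in Q. \<mu> \<notin> A)"
      by (rule AE_renorm_total[OF Q a]) measurable
    also have "\<dots> \<longleftrightarrow> A \<in> null_sets Q"
      using True by (intro AE_iff_null_sets[symmetric]) (simp add: distribution_sets[OF Q(1)])
    finally show ?thesis .
  next
    case False
    then have "A \<notin> null_sets (averaged_translates (sup_ball a 0) Q)" "A \<notin> null_sets Q"
      by (auto simp: null_sets_def distribution_sets[OF Q(1)])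
    then show ?thesis by simp
  qed
qed

text \<open>Null sets of the averaged law become fewer as the neighborhood grows. The unit ball is
  closed and hence not an instance of the definition, but it lies between two open Euclidean balls.
  Conversely, a bounded open neighborhood of 0 lies between two sup-norm balls, for which rescaling
  has settled the question.\<close>

lemma quasi_palm_iff_unit_ball:
  fixes Q :: "(real ^ 'n) measure measure"
  assumes Q: "distribution Q" "scale_invariant Q"
  shows "quasi_palm Q \<longleftrightarrow> null_sets Q = null_sets (averaged_translates (sup_ball 1 0) Q)"
proof
  let ?d = "sqrt (real DIM(real ^ 'n))"
  let ?N = "\<lambda>U. null_sets (averaged_translates U Q)"
  assume qp: "quasi_palm Q"
  have eq: "?N (ball 0 r) = null_sets Q" if "0 < r" for r
    using qp[unfolded quasi_palm_def, rule_format, of "ball 0 r"] that by simp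
  \<comment> \<open>The summand 1 leaves room for an open ball around the closed one of radius
    \<open>?d\<close>.\<close>
  have "0 < ?d + 1" by (simp add: add_pos_pos add_nonneg_pos)
  have "sup_ball 1 0 \<subseteq> ball (0 :: real ^ 'n) (?d + 1)"
    using sup_ball_subset_cball[of 1 "0 :: real ^ 'n"] by force
  then have "?N (ball 0 (?d + 1)) \<subseteq> ?N (sup_ball 1 0)"
    by (intro null_sets_averaged_translates_antimono Q sup_ball_borel) auto
  moreover have "ball (0 :: real ^ 'n) 1 \<subseteq> sup_ball 1 0"
    using cball_subset_sup_ball[of "0 :: real ^ 'n" 1] by force
  then have "?N (sup_ball 1 0) \<subseteq> ?N (ball 0 1)"
    by (intro null_sets_averaged_translates_antimono Q sup_ball_borel) auto
  ultimately show "null_sets Q = ?N (sup_ball 1 0)"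
    using eq[OF \<open>0 < ?d + 1\<close>] eq[of 1] by auto
next
  let ?N = "\<lambda>U. null_sets (averaged_translates U Q)"
  assume null: "null_sets Q = ?N (sup_ball 1 0)"
  show "quasi_palm Q"
    unfolding quasi_palm_def
  proof (intro allI impI)
    fix U :: "(real ^ 'n) set" assume U: "open U \<and> bounded U \<and> 0 \<in> U"
    obtain R where R: "0 < R" "U \<subseteq> cball 0 R"
      using U bounded_pos[of U] by (auto simp: subset_iff)
    then have "U \<subseteq> sup_ball R 0" using cball_subset_sup_ball[of 0 R] by blast
    then have 1: "?N (sup_ball R 0) \<subseteq> ?N U"
      using U by (intro null_sets_averaged_translates_antimono Q sup_ball_borel) auto
    obtain e where e: "0 < e" "cball 0 e \<subseteq> U" using U open_contains_cball by blast
    let ?d = "sqrt (real DIM(real ^ 'n))"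
    have d: "0 < ?d" by simp
    have "sup_ball (e / ?d) 0 \<subseteq> U"
      using sup_ball_subset_cball[of "e / ?d" "0 :: real ^ 'n"] e(2) d by auto
    then have 2: "?N U \<subseteq> ?N (sup_ball (e / ?d) 0)"
      using U by (intro null_sets_averaged_translates_antimono Q sup_ball_borel) auto
    have "?N (sup_ball R 0) = null_sets Q"
      by (rule null_sets_averaged_sup_ball[OF Q null R(1)])
    moreover have "?N (sup_ball (e / ?d) 0) = null_sets Q"
      using e(1) d by (intro null_sets_averaged_sup_ball[OF Q null] divide_pos_pos)
    ultimately show "null_sets Q = ?N U" using 1 2 by auto
  qed
qed

theorem theorem1p3:
  fixes P :: "(real ^ 'n) measure measure"
    and Q :: "(real ^ 'n) measure \<Rightarrow> (real ^ 'n) measure measure"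
  assumes "fractal_distribution P"
    and "ergodic_decomposition P Q"
  shows "AE \<mu> in P. ergodic_fractal_distribution (Q \<mu>)"
proof -
  have FD: "distribution P" "scale_invariant P" "quasi_palm P"
    using assms(1) by (simp_all add: fractal_distribution_def)
  interpret decomposed P Q
    by unfold_locales (fact FD(1), fact assms(2))
  have "AE \<mu> in P. ergodic (Q \<mu>)"
    using assms(2) by (simp add: ergodic_decomposition_def)
  moreover have "AE \<mu> in P. null_sets (Q \<mu>) = null_sets (averaged_translates (sup_ball 1 0) (Q \<mu>))"
    using FD quasi_palm_iff_unit_ball[OF FD(1,2)] by (intro components_null_sets) simp_all
  ultimately show ?thesis
    using AE_space
  proof eventually_elim
    case (elim \<mu>)
    then have "distribution (Q \<mu>)" by (intro Q_distribution) (simp add: distribution_space[OF FD(1)])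
    moreover have "scale_invariant (Q \<mu>)" using elim(1) by (simp add: ergodic_def)
    ultimately show ?case
      using elim quasi_palm_iff_unit_ball[of "Q \<mu>"]
      by (simp add: ergodic_fractal_distribution_def fractal_distribution_def)
  qed
qed

end
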